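(* Let $V=\tilde L_{Y_{1,1}Y_{2,q^3}}$ be the $8$-dimensional evaluation adjoint module of the quantum affine algebra of type $A_2^{(1)}$, and $\check R^{\mathrm{ad},\mathrm{ad}}(z)=\check R^{V,V}(z)$ the normalized intertwiner. As $U_q(A_2)$-modules $V\otimes V\cong L_{2\omega_1+2\omega_2}\oplus L_{3\omega_1}\oplus L_{3\omega_2}\oplus2L_{\omega_1+\omega_2}\oplus L_{\omega_0}$. For a suitable choice of a basis in the $2$-dimensional space of singular vectors of weight $\omega_1+\omega_2$, independent of $z$, in terms of projectors $$\check R^{\mathrm{ad},\mathrm{ad}}(z)=P_{2\omega_1+2\omega_2}^q-q^{-2}\frac{1-q^2z}{1-q^{-2}z}\big(P_{3\omega_1}^q+P_{3\omega_2}^q\big)-\frac{q^{-5}f(z)}{(1-q^{-2}z)^2(1-q^{-6}z)}\otimes P_{\omega_1+\omega_2}^q+q^{-8}\frac{(1-q^2z)(1-q^6z)}{(1-q^{-2}z)(1-q^{-6}z)}P_{\omega_0}^q,$$ where $$f(z)=\begin{bmatrix}[3]\big([2]^{\mathrm i}\big)^2z(q^{-1}z-q)&(z-1)(qz-q^{-1})(q^{-1}z-q)\\(z-1)\big(z^2-([2]_6+[2]_2-2)z+1\big)&-[3]\big([2]^{\mathrm i}\big)^2z(qz-q^{-1})\end{bmatrix}.$$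
   Context: Conventions. $q\in\mathbb C^\times$ is not a root of unity. $[n]_k=\frac{q^{kn}-q^{-kn}}{q^k-q^{-k}}$, $[3]=[3]_1$, $[2]^{\mathrm i}=q-q^{-1}$. $U_q\tilde{\mathfrak g}$ is the level zero quantum affine algebra of type $A_2^{(1)}$ with generators $E_i,F_i,K_i^{\pm1}$, $i=0,1,2$ ($K_iE_jK_i^{-1}=q^{\tilde C_{ij}}E_j$, $[E_i,F_j]=\delta_{ij}\frac{K_i-K_i^{-1}}{q-q^{-1}}$, $q$-Serre relations, $K_0K_1K_2=1$) and coproduct $\Delta K_i=K_i\otimes K_i$, $\Delta E_i=E_i\otimes K_i^{1/2}+K_i^{-1/2}\otimes E_i$, $\Delta F_i=F_i\otimes K_i^{1/2}+K_i^{-1/2}\otimes F_i$. $U_q(A_2)$ is generated by the generators with $i\ne0$; $L_\lambda$ is its irreducible module of highest weight $\lambda$ ($\omega_0=0$). In Drinfeld's new realization (generators $X^\pm_{i,n}$, Cartan currents $\Phi_i^\pm(z)$), irreducible finite-dimensional modules are classified by Drinfeld polynomials: on the highest $\ell$-weight vector $\Phi_i^\pm(z)$ acts by the expansion of $q^{\deg p_i}p_i(zq^{-1})/p_i(zq)$ in $z^{\pm1}$. $\tilde L_{Y_{1,1}Y_{2,q^3}}$ is the module with $p_1(z)=1-z$, $p_2(z)=1-q^3z$; as a $U_q(A_2)$-module it is $L_{\omega_1+\omega_2}$. $V(a)$ is the pullback of $V$ by the automorphism $X_i^\pm(z)\mapsto X_i^\pm(az)$, $\Phi_i^\pm(z)\mapsto\Phi_i^\pm(az)$.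 With $v$ the highest $\ell$-weight vector, $\check R^{V,V}(z)\in\mathrm{End}(V\otimes V)$ is the unique operator, rational in $z$, which for generic $z$ intertwines $V(z)\otimes V\to V\otimes V(z)$ and fixes $v\otimes v$. $P_\lambda^q$ is the projector onto the $L_\lambda$-isotypic component along the others. A singular vector is a weight vector killed by $E_1,E_2$. Given a basis $u_1,u_2$ of the space of singular vectors of weight $\omega_1+\omega_2$ and a $2\times2$ matrix $f$, $f\otimes P^q_{\omega_1+\omega_2}$ is the operator which is zero on the other isotypic components and acts on the $L_{\omega_1+\omega_2}$-isotypic component as the $U_q(A_2)$-endomorphism with $u_j\mapsto\sum_if_{ij}u_i$. *)

theory Defs
  imports "HOL-Analysis.Analysis" "HOL-Computational_Algebra.Polynomial_FPS"
begin

text \<open>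
  A representation on the space of column vectors is given by the matrices of the generators.
  Nodes of the affine Dynkin diagram are the elements 0, 1, 2 of the numeral type 3
  (which has 3 = 0); the nodes of the finite diagram are 1 and 2.
\<close>

definition mat_scale :: "'a::times \<Rightarrow> 'a^'n^'m \<Rightarrow> 'a^'n^'m" (infixl "*k" 70) where
  "c *k A = (\<chi> i j. c * A $ i $ j)"

definition cartan :: "3 \<Rightarrow> 3 \<Rightarrow> int" where
  "cartan i j = (if i = j then 2 else - 1)"

record ('n::finite) chevalley =
  genE :: "3 \<Rightarrow> complex^'n^'n"
  genF :: "3 \<Rightarrow> complex^'n^'n"
  genK :: "3 \<Rightarrow> complex^'n^'n"

text \<open>
  A representation of the affine algebra also records the modes of the Drinfeld currents,
  \<open>X\<^sup>\<plusminus>\<^sub>i(z) = \<Sum>\<^sub>n X\<^sup>\<plusminus>\<^bsub>i,n\<^esub> z\<^sup>n\<close> and \<open>\<Phi>\<^sup>\<plusminus>\<^sub>i(z) = \<Sum>\<^sub>n \<Phi>\<^sup>\<plusminus>\<^bsub>i,n\<^esub> z\<^sup>n\<close>.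
  They carry information for \<open>i = 1, 2\<close> only; their values at \<open>i = 0\<close> are never used.
\<close>

record ('n::finite) affine_rep = "'n chevalley" +
  curXp :: "3 \<Rightarrow> int \<Rightarrow> complex^'n^'n"
  curXm :: "3 \<Rightarrow> int \<Rightarrow> complex^'n^'n"
  curPhip :: "3 \<Rightarrow> int \<Rightarrow> complex^'n^'n"
  curPhim :: "3 \<Rightarrow> int \<Rightarrow> complex^'n^'n"

definition qcomm :: "complex \<Rightarrow> complex^'n^'n \<Rightarrow> complex^'n^'n \<Rightarrow> complex^'n^'n" where
  "qcomm c A B = A ** B - c *k (B ** A)"

definition q_serre :: "complex \<Rightarrow> complex^'n^'n \<Rightarrow> complex^'n^'n \<Rightarrow> bool" where
  "q_serre q A B \<longleftrightarrow> A ** A ** B - (q + inverse q) *k (A ** B ** A) + B ** A ** A = 0"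

definition chevalley_relations :: "complex \<Rightarrow> ('n::finite, 'x) chevalley_scheme \<Rightarrow> bool" where
  "chevalley_relations q M \<longleftrightarrow>
     (\<forall>i. invertible (genK M i)) \<and>
     (\<forall>i j. genK M i ** genK M j = genK M j ** genK M i) \<and>
     genK M 0 ** genK M 1 ** genK M 2 = mat 1 \<and>
     (\<forall>i j. genK M i ** genE M j ** matrix_inv (genK M i) = (q powi cartan i j) *k genE M j) \<and>
     (\<forall>i j. genK M i ** genF M j ** matrix_inv (genK M i) = (q powi (- cartan i j)) *k genF M j) \<and>
     (\<forall>i j. qcomm 1 (genE M i) (genF M j) =
        (if i = j then inverse (q - inverse q) *k (genK M i - matrix_inv (genK M i)) else 0)) \<and>
     (\<forall>i j. i \<noteq> j \<longrightarrow> q_serre q (genE M i) (genE M j) \<and> q_serre q (genF M i) (genF M j))"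

text \<open>
  The relations involving only one of the families \<open>X\<^sup>+\<close> (with \<open>c = q\<close>) or \<open>X\<^sup>-\<close>
  (with \<open>c = q\<^sup>-\<^sup>1\<close>), in modes. In terms of currents the first conjunct reads
  \<open>(w - c\<^bsup>C i j\<^esup> z) Y\<^sub>i(z) X\<^sub>j(w) = (c\<^bsup>C i j\<^esup> w - z) X\<^sub>j(w) Y\<^sub>i(z)\<close>
  for \<open>Y = X, \<Phi>\<^sup>+, \<Phi>\<^sup>-\<close>.
\<close>

definition half_current_relations ::
  "complex \<Rightarrow> (3 \<Rightarrow> int \<Rightarrow> complex^'n^'n) \<Rightarrow> (3 \<Rightarrow> int \<Rightarrow> complex^'n^'n) \<Rightarrow>
   (3 \<Rightarrow> int \<Rightarrow> complex^'n^'n) \<Rightarrow> bool" where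
  "half_current_relations c X Phip Phim \<longleftrightarrow>
     (\<forall>Y \<in> {X, Phip, Phim}. \<forall>i \<in> {1, 2}. \<forall>j \<in> {1, 2}. \<forall>m n.
        Y i (m + 1) ** X j n - (c powi cartan i j) *k (Y i m ** X j (n + 1)) =
        (c powi cartan i j) *k (X j n ** Y i (m + 1)) - X j (n + 1) ** Y i m) \<and>
     (\<forall>i \<in> {1, 2}. \<forall>j \<in> {1, 2}. i \<noteq> j \<longrightarrow> (\<forall>m n l.
        (\<Sum>(r, t) \<leftarrow> [(m, n), (n, m)].
           X i r ** X i t ** X j l - (c + inverse c) *k (X i r ** X j l ** X i t)
           + X j l ** X i r ** X i t) = 0))"

definition drinfeld_relations :: "complex \<Rightarrow> 'n::finite affine_rep \<Rightarrow> bool" where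
  "drinfeld_relations q V \<longleftrightarrow>
     (\<forall>i \<in> {1, 2}. \<forall>n. (n < 0 \<longrightarrow> curPhip V i n = 0) \<and> (n > 0 \<longrightarrow> curPhim V i n = 0)) \<and>
     (\<forall>i \<in> {1, 2}. curPhip V i 0 ** curPhim V i 0 = mat 1) \<and>
     (\<forall>A \<in> {curPhip V, curPhim V}. \<forall>B \<in> {curPhip V, curPhim V}.
        \<forall>i \<in> {1, 2}. \<forall>j \<in> {1, 2}. \<forall>m n. A i m ** B j n = B j n ** A i m) \<and>
     (\<forall>i \<in> {1, 2}. \<forall>j \<in> {1, 2}. \<forall>m n. qcomm 1 (curXp V i m) (curXm V j n) =
        (if i = j then inverse (q - inverse q) *k (curPhip V i (m + n) - curPhim V i (m + n))
         else 0)) \<and>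
     half_current_relations q (curXp V) (curPhip V) (curPhim V) \<and>
     half_current_relations (inverse q) (curXm V) (curPhip V) (curPhim V)"

text \<open>
  Drinfeld's isomorphism between the two presentations. Level zero gives
  \<open>K\<^sub>0 = (K\<^sub>1 K\<^sub>2)\<^sup>-\<^sup>1\<close>. A different normalization of \<open>E\<^sub>0\<close> and \<open>F\<^sub>0\<close> would amount to a shift
  \<open>z \<mapsto> a z\<close> of all currents.
\<close>

definition drinfeld_isomorphism :: "complex \<Rightarrow> 'n::finite affine_rep \<Rightarrow> bool" where
  "drinfeld_isomorphism q V \<longleftrightarrow>
     (\<forall>i \<in> {1, 2}. genE V i = curXp V i 0 \<and> genF V i = curXm V i 0 \<and> genK V i = curPhip V i 0) \<and>
     genE V 0 = qcomm (inverse q) (curXm V 2 0) (curXm V 1 1) ** genK V 0 \<and>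
     genF V 0 = matrix_inv (genK V 0) ** qcomm q (curXp V 1 (- 1)) (curXp V 2 0)"

definition affine_module :: "complex \<Rightarrow> 'n::finite affine_rep \<Rightarrow> bool" where
  "affine_module q V \<longleftrightarrow>
     chevalley_relations q V \<and> drinfeld_relations q V \<and> drinfeld_isomorphism q V"

text \<open>
  The pullback by \<open>X\<^sup>\<plusminus>\<^sub>i(z) \<mapsto> X\<^sup>\<plusminus>\<^sub>i(a z)\<close>, \<open>\<Phi>\<^sup>\<plusminus>\<^sub>i(z) \<mapsto> \<Phi>\<^sup>\<plusminus>\<^sub>i(a z)\<close>. Its effect on \<open>E\<^sub>0\<close>
  (which contains the mode \<open>X\<^sup>-\<^bsub>1,1\<^esub>\<close>) and \<open>F\<^sub>0\<close> (which contains \<open>X\<^sup>+\<^bsub>1,-1\<^esub>\<close>) is forced by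
  \<^const>\<open>drinfeld_isomorphism\<close>.
\<close>

definition shift_module :: "complex \<Rightarrow> 'n::finite affine_rep \<Rightarrow> 'n affine_rep" where
  "shift_module a V = V
     \<lparr>genE := (genE V)(0 := a *k genE V 0),
      genF := (genF V)(0 := inverse a *k genF V 0),
      curXp := (\<lambda>i n. (a powi n) *k curXp V i n),
      curXm := (\<lambda>i n. (a powi n) *k curXm V i n),
      curPhip := (\<lambda>i n. (a powi n) *k curPhip V i n),
      curPhim := (\<lambda>i n. (a powi n) *k curPhim V i n)\<rparr>"

text \<open>
  The set \<open>I\<close> selects the subalgebra generated by the Chevalley generators with indices in \<open>I\<close>:
  the whole affine algebra for \<^term>\<open>UNIV\<close>, and \<open>U\<^sub>q(A\<^sub>2)\<close> for \<^term>\<open>{1, 2}\<close>.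
\<close>

definition submodule ::
  "3 set \<Rightarrow> ('n::finite, 'x) chevalley_scheme \<Rightarrow> (complex^'n) set \<Rightarrow> bool" where
  "submodule I M W \<longleftrightarrow> vec.subspace W \<and>
     (\<forall>i \<in> I. \<forall>x \<in> W. genE M i *v x \<in> W \<and> genF M i *v x \<in> W \<and>
        genK M i *v x \<in> W \<and> matrix_inv (genK M i) *v x \<in> W)"

definition simple_submodule ::
  "3 set \<Rightarrow> ('n::finite, 'x) chevalley_scheme \<Rightarrow> (complex^'n) set \<Rightarrow> bool" where
  "simple_submodule I M W \<longleftrightarrow> submodule I M W \<and> W \<noteq> {0} \<and>
     (\<forall>U. submodule I M U \<and> U \<subseteq> W \<longrightarrow> U = {0} \<or> U = W)"

definition lweight_plus :: "complex \<Rightarrow> complex poly \<Rightarrow> complex fps" where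
  "lweight_plus q p = fps_const (q ^ degree p) *
     (fps_of_poly (pcompose p [:0, inverse q:]) / fps_of_poly (pcompose p [:0, q:]))"

text \<open>The expansion at \<open>z = \<infinity>\<close>, as a power series in \<open>z\<^sup>-\<^sup>1\<close>.\<close>

definition lweight_minus :: "complex \<Rightarrow> complex poly \<Rightarrow> complex fps" where
  "lweight_minus q p = fps_const (q ^ degree p) *
     (fps_of_poly (reflect_poly (pcompose p [:0, inverse q:])) /
      fps_of_poly (reflect_poly (pcompose p [:0, q:])))"

definition highest_lweight_vector ::
  "complex \<Rightarrow> (3 \<Rightarrow> complex poly) \<Rightarrow> 'n::finite affine_rep \<Rightarrow> complex^'n \<Rightarrow> bool" where
  "highest_lweight_vector q p V v \<longleftrightarrow> v \<noteq> 0 \<and>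
     (\<forall>i \<in> {1, 2}. (\<forall>n. curXp V i n *v v = 0) \<and>
        (\<forall>n. curPhip V i (int n) *v v = fps_nth (lweight_plus q (p i)) n *s v) \<and>
        (\<forall>n. curPhim V i (- int n) *v v = fps_nth (lweight_minus q (p i)) n *s v))"

definition evaluation_adjoint :: "complex \<Rightarrow> 'n::finite affine_rep \<Rightarrow> complex^'n \<Rightarrow> bool" where
  "evaluation_adjoint q V v \<longleftrightarrow> affine_module q V \<and> simple_submodule UNIV V UNIV \<and>
     highest_lweight_vector q (\<lambda>i. if i = 1 then [:1, - 1:] else [:1, - (q ^ 3):]) V v"

text \<open>A pair \<open>(a, b)\<close> stands for the weight \<open>a \<omega>\<^sub>1 + b \<omega>\<^sub>2\<close>.\<close>

definition singular_space ::
  "complex \<Rightarrow> ('n::finite, 'x) chevalley_scheme \<Rightarrow> nat \<times> nat \<Rightarrow> (complex^'n) set" where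
  "singular_space q M l = {x. genE M 1 *v x = 0 \<and> genE M 2 *v x = 0 \<and>
     genK M 1 *v x = q ^ fst l *s x \<and> genK M 2 *v x = q ^ snd l *s x}"

definition is_L ::
  "complex \<Rightarrow> ('n::finite, 'x) chevalley_scheme \<Rightarrow> nat \<times> nat \<Rightarrow> (complex^'n) set \<Rightarrow> bool" where
  "is_L q M l W \<longleftrightarrow> simple_submodule {1, 2} M W \<and> (\<exists>x \<in> W. x \<noteq> 0 \<and> x \<in> singular_space q M l)"

definition decomposes_as ::
  "complex \<Rightarrow> ('n::finite, 'x) chevalley_scheme \<Rightarrow> (nat \<times> nat) list \<Rightarrow> bool" where
  "decomposes_as q M ls \<longleftrightarrow> (\<exists>W.
     (\<forall>k < length ls. is_L q M (ls ! k) (W k)) \<and>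
     (\<forall>x. \<exists>!y. y \<in> (\<Pi>\<^sub>E k \<in> {..<length ls}. W k) \<and> (\<Sum>k < length ls. y k) = x))"

definition isotypic ::
  "complex \<Rightarrow> ('n::finite, 'x) chevalley_scheme \<Rightarrow> nat \<times> nat \<Rightarrow> (complex^'n) set" where
  "isotypic q M l = vec.span (\<Union>{W. is_L q M l W})"

definition isotypic_projector ::
  "complex \<Rightarrow> ('n::finite, 'x) chevalley_scheme \<Rightarrow> nat \<times> nat \<Rightarrow> complex^'n^'n" where
  "isotypic_projector q M l = (THE P. (\<forall>x \<in> isotypic q M l. P *v x = x) \<and>
     (\<forall>l'. l' \<noteq> l \<longrightarrow> (\<forall>x \<in> isotypic q M l'. P *v x = 0)))"

definition singular_basis ::
  "complex \<Rightarrow> ('n::finite, 'x) chevalley_scheme \<Rightarrow> nat \<times> nat \<Rightarrow> (2 \<Rightarrow> complex^'n) \<Rightarrow> bool" where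
  "singular_basis q M l u \<longleftrightarrow>
     inj u \<and> vec.independent (range u) \<and> vec.span (range u) = singular_space q M l"

text \<open>The operator \<open>f \<otimes> P\<^sub>l\<close> relative to the basis \<open>u\<close> of singular vectors.\<close>

definition tensor_projector ::
  "complex \<Rightarrow> ('n::finite, 'x) chevalley_scheme \<Rightarrow> nat \<times> nat \<Rightarrow> (2 \<Rightarrow> complex^'n) \<Rightarrow>
   complex^2^2 \<Rightarrow> complex^'n^'n" where
  "tensor_projector q M l u f = (THE T.
     (\<forall>l'. l' \<noteq> l \<longrightarrow> (\<forall>x \<in> isotypic q M l'. T *v x = 0)) \<and>
     (\<forall>x \<in> isotypic q M l. T *v x \<in> isotypic q M l \<and>
        (\<forall>i \<in> {1, 2}. T *v (genE M i *v x) = genE M i *v (T *v x) \<and>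
                      T *v (genF M i *v x) = genF M i *v (T *v x) \<and>
                      T *v (genK M i *v x) = genK M i *v (T *v x))) \<and>
     (\<forall>j. T *v u j = (\<Sum>i \<in> UNIV. f $ i $ j *s u i)))"

definition kron :: "complex^'n^'n \<Rightarrow> complex^'m^'m \<Rightarrow> complex^('n \<times> 'm)^('n \<times> 'm)" where
  "kron A B = (\<chi> a b. A $ fst a $ fst b * B $ snd a $ snd b)"

definition tensor_vec :: "complex^'n \<Rightarrow> complex^'m \<Rightarrow> complex^('n \<times> 'm)" where
  "tensor_vec x y = (\<chi> a. x $ fst a * y $ snd a)"

text \<open>
  The parameter \<open>s\<close> is a fixed square root of \<open>q\<close>. On modules spanned by vectors of integral
  weight, \<open>K\<^sub>i\<^bsup>1/2\<^esup>\<close> is the operator acting by \<open>s\<^sup>k\<close> where \<open>K\<^sub>i\<close> acts by \<open>q\<^sup>k\<close>.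
\<close>

definition half_K :: "complex \<Rightarrow> ('n::finite, 'x) chevalley_scheme \<Rightarrow> 3 \<Rightarrow> complex^'n^'n" where
  "half_K s M i = (THE S. \<forall>(k::int) x.
     genK M i *v x = ((s\<^sup>2) powi k) *s x \<longrightarrow> S *v x = (s powi k) *s x)"

definition tensor_module ::
  "complex \<Rightarrow> ('n::finite, 'x) chevalley_scheme \<Rightarrow> ('m::finite, 'y) chevalley_scheme \<Rightarrow>
   ('n \<times> 'm) chevalley" where
  "tensor_module s M N =
     \<lparr>genE = (\<lambda>i. kron (genE M i) (half_K s N i) + kron (matrix_inv (half_K s M i)) (genE N i)),
      genF = (\<lambda>i. kron (genF M i) (half_K s N i) + kron (matrix_inv (half_K s M i)) (genF N i)),
      genK = (\<lambda>i. kron (genK M i) (genK N i))\<rparr>"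

definition intertwines ::
  "('n::finite, 'x) chevalley_scheme \<Rightarrow> ('n, 'y) chevalley_scheme \<Rightarrow> complex^'n^'n \<Rightarrow> bool" where
  "intertwines M N R \<longleftrightarrow> (\<forall>i. R ** genE M i = genE N i ** R \<and>
     R ** genF M i = genF N i ** R \<and> R ** genK M i = genK N i ** R)"

text \<open>Rational functions are identified when they agree at all but finitely many points.\<close>

definition rational_fun :: "(complex \<Rightarrow> complex) \<Rightarrow> bool" where
  "rational_fun f \<longleftrightarrow> (\<exists>p r. r \<noteq> 0 \<and> (\<forall>\<^sub>F z in cofinite. f z = poly p z / poly r z))"

definition normalized_R ::
  "complex \<Rightarrow> 'n::finite affine_rep \<Rightarrow> complex^'n \<Rightarrow>
   (complex \<Rightarrow> complex^('n \<times> 'n)^('n \<times> 'n)) \<Rightarrow> bool" where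
  "normalized_R s V v R \<longleftrightarrow>
     (\<forall>a b. rational_fun (\<lambda>z. R z $ a $ b)) \<and>
     (\<forall>\<^sub>F z in cofinite.
        intertwines (tensor_module s (shift_module z V) V) (tensor_module s V (shift_module z V)) (R z) \<and>
        R z *v tensor_vec v v = tensor_vec v v)"

definition qnum :: "complex \<Rightarrow> nat \<Rightarrow> nat \<Rightarrow> complex" where
  "qnum q k n = (q ^ (k * n) - inverse q ^ (k * n)) / (q ^ k - inverse q ^ k)"

definition f_matrix :: "complex \<Rightarrow> complex \<Rightarrow> complex^2^2" where
  "f_matrix q z = vector
     [vector [qnum q 1 3 * (q - inverse q)\<^sup>2 * z * (inverse q * z - q),
              (z - 1) * (q * z - inverse q) * (inverse q * z - q)],
      vector [(z - 1) * (z\<^sup>2 - (qnum q 6 2 + qnum q 2 2 - 2) * z + 1),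
              - qnum q 1 3 * (q - inverse q)\<^sup>2 * z * (q * z - inverse q)]]"

end

theory Submission
  imports Defs
begin

text \<open>
  An intertwiner commutes with \<open>U\<^sub>q(A\<^sub>2)\<close> and is therefore determined by its values on the singular
  vectors of \<open>V \<otimes> V\<close>. They form a space of dimension six, with basis \<open>u\<^sub>0, \<dots>, u\<^sub>5\<close> of weights
  \<open>2\<omega>\<^sub>1 + 2\<omega>\<^sub>2\<close>, \<open>3\<omega>\<^sub>1\<close>, \<open>3\<omega>\<^sub>2\<close>, \<open>\<omega>\<^sub>1 + \<omega>\<^sub>2\<close> (twice) and \<open>0\<close>. Conversely every linear map on singular
  vectors that preserves weights extends to a unique \<open>U\<^sub>q(A\<^sub>2)\<close>-endomorphism. The extension is
  constructed through its graph: the submodule of \<open>M \<oplus> M\<close> generated by the graph of the given map is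
  again a graph, because a nonzero element \<open>(0, y)\<close> of it could be raised to a singular one
  (\<open>graph_functional\<close>). The projectors, the operators \<open>f \<otimes> P\<close> and the decomposition of \<open>V \<otimes> V\<close> are all
  expressed by the matrix units \<open>Op m k\<close> obtained in this way. What is needed about \<open>V \<otimes> V\<close> is that it is
  generated by its singular vectors and that none of them is in the image of \<open>F\<^sub>1\<close> and \<open>F\<^sub>2\<close>; both follow
  from a contravariant form that is nondegenerate on singular vectors (\<open>generated_by_singular\<close>).

  For the affine generators, put \<open>A = E\<^sub>0 \<otimes> K\<^sub>0\<^sup>1\<^sup>/\<^sup>2\<close> and \<open>B = K\<^sub>0\<^sup>-\<^sup>1\<^sup>/\<^sup>2 \<otimes> E\<^sub>0\<close>. Then \<open>E\<^sub>0\<close> acts by \<open>z A + B\<close> on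
  \<open>V(z) \<otimes> V\<close> and by \<open>A + z B\<close> on \<open>V \<otimes> V(z)\<close>. Both commute with \<open>F\<^sub>1\<close> and \<open>F\<^sub>2\<close>, so that the relation
  \<open>R (z A + B) = (A + z B) R\<close> has to be tested on \<open>u\<^sub>0, \<dots>, u\<^sub>5\<close> only. Expanding \<open>A u\<^sub>k\<close> and \<open>B u\<^sub>k\<close> in
  monomials in \<open>F\<^sub>1, F\<^sub>2\<close> applied to the \<open>u\<^sub>j\<close> (\<open>EA_u0\<close> to \<open>EB_u5\<close>) turns it into polynomial identities in \<open>q\<close>
  and \<open>z\<close>, which hold exactly for the coefficients in the theorem. The relation for \<open>F\<^sub>0\<close> is then
  automatic, since in finite-dimensional \<open>U\<^sub>q(sl\<^sub>2)\<close>-modules \<open>F\<close> is determined by \<open>E\<close> and \<open>K\<close>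
  (\<open>commutes_E_lowers_weight_zero\<close>).

  The same expansions show uniqueness. The difference of two normalized intertwiners kills \<open>u\<^sub>0\<close>; by the
  expansion of \<open>(z A + B) u\<^sub>0\<close> it kills, for generic \<open>z\<close>, \<open>u\<^sub>1\<close>, \<open>u\<^sub>2\<close> and one vector of weight \<open>\<omega>\<^sub>1 + \<omega>\<^sub>2\<close>, then
  by that of \<open>(z A + B) u\<^sub>1\<close> a second such vector, and finally \<open>u\<^sub>5\<close> (\<open>intertwiner_unique_0\<close>).

  All of this takes place in explicit coordinates. The hypotheses on \<open>V\<close> determine the matrices of
  \<open>E\<^sub>i\<close>, \<open>K\<^sub>i\<close> and of \<open>F\<^sub>1, F\<^sub>2\<close> in a basis of monomials applied to \<open>v\<close>; the currents enter only through the
  value \<open>E\<^sub>0 v\<close> (\<open>E0_b0\<close>).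
\<close>

section \<open>Matrices, tensor products and dual bases\<close>

lemma mat_scale_mult_vec: "(c *k A) *v x = c *s (A *v (x :: complex^'n))"
  by (simp add: mat_scale_def matrix_vector_mult_def vec_eq_iff sum_distrib_left mult.assoc)

lemma mat_scale_mult_left: "(c *k A) ** (B :: complex^'l^'m) = c *k (A ** B)"
  by (simp add: mat_scale_def matrix_matrix_mult_def vec_eq_iff sum_distrib_left mult.assoc)

lemma mat_scale_mult_right: "(A :: complex^'m^'n) ** (c *k B) = c *k (A ** B)"
  by (simp add: mat_scale_def matrix_matrix_mult_def vec_eq_iff sum_distrib_left mult.left_commute)

lemma mat_scale_scale: "a *k (b *k (A :: complex^'n^'m)) = (a * b) *k A"
  by (simp add: mat_scale_def vec_eq_iff)

lemma mat_scale_one [simp]: "1 *k (A :: complex^'n^'m) = A"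
  by (simp add: mat_scale_def vec_eq_iff)

lemma mat_scale_zero [simp]: "0 *k (A :: complex^'n^'m) = 0" "c *k (0 :: complex^'n^'m) = 0"
  by (simp_all add: mat_scale_def vec_eq_iff)

lemma mat_scale_add: "c *k (A + B :: complex^'n^'m) = c *k A + c *k B"
  by (simp add: mat_scale_def vec_eq_iff distrib_left)

lemma mat_scale_diff: "c *k (A - B :: complex^'n^'m) = c *k A - c *k B"
  by (simp add: mat_scale_def vec_eq_iff right_diff_distrib)

lemma mat_scale_nth [simp]: "(c *k A) $ i $ j = c * A $ i $ j"
  by (simp add: mat_scale_def)

lemma mult_vec_scale: "(A :: complex^'n^'m) *v (c *s x) = c *s (A *v x)"
  by (simp add: vec.scale)

lemma mult_vec_sum: "(A :: complex^'n^'m) *v (\<Sum>i\<in>I. f i) = (\<Sum>i\<in>I. A *v f i)"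
  by (rule vec.sum)

lemma sum_mult_vec: "(\<Sum>i\<in>I. A i) *v (x :: complex^'n) = (\<Sum>i\<in>I. A i *v x)"
  by (induct I rule: infinite_finite_induct) (simp_all add: matrix_vector_mult_add_rdistrib)

lemma mult_vec_diff: "(A :: complex^'n^'m) *v (x - y) = A *v x - A *v y"
  by (rule vec.diff)

lemma mult_vec_minus: "(A :: complex^'n^'m) *v (- x) = - (A *v x)"
  by (rule vec.neg)

lemma diff_mult_vec: "(A - B) *v (x :: complex^'n) = A *v x - B *v x"
  by (simp add: matrix_vector_mult_def vec_eq_iff left_diff_distrib sum_subtractf)

lemma mult_vec_add: "(A :: complex^'n^'m) *v (x + y) = A *v x + A *v y"
  by (rule vec.add)

lemmas mat_vec_simps = mat_scale_mult_vec mult_vec_scale mult_vec_add mult_vec_diff mult_vec_minus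
  diff_mult_vec matrix_vector_mult_add_rdistrib matrix_vector_mul_assoc [symmetric]

lemma mult_matrix_inv:
  assumes "invertible (A :: complex^'n^'n)"
  shows "A ** matrix_inv A = mat 1" "matrix_inv A ** A = mat 1"
  using someI_ex [OF assms [unfolded invertible_def]] by (simp_all add: matrix_inv_def)

lemma matrix_inv_eqI:
  assumes "(A :: complex^'n^'n) ** B = mat 1"
  shows "matrix_inv A = B"
proof -
  have BA: "B ** A = mat 1"
    using assms matrix_left_right_inverse by blast
  have inv: "invertible A"
    unfolding invertible_def using assms BA by blast
  have "matrix_inv A = matrix_inv A ** (A ** B)"
    using assms by simp
  also have "\<dots> = B"
    by (simp add: matrix_mul_assoc mult_matrix_inv [OF inv])
  finally show ?thesis .
qed

lemma kron_mult_tensor_vec: "kron A B *v tensor_vec x y = tensor_vec (A *v x) (B *v y)"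
proof -
  have "(\<Sum>p\<in>UNIV. A $ i $ fst p * B $ j $ snd p * (x $ fst p * y $ snd p)) =
      (\<Sum>a\<in>UNIV. A $ i $ a * x $ a) * (\<Sum>b\<in>UNIV. B $ j $ b * y $ b)" for i j
    unfolding sum_product by (simp add: sum.cartesian_product UNIV_Times_UNIV ac_simps split_def)
  then show ?thesis
    by (simp add: kron_def tensor_vec_def matrix_vector_mult_def vec_eq_iff)
qed

lemma kron_mult_kron: "kron A B ** kron C D = kron (A ** C) (B ** D)"
proof -
  have "(\<Sum>p\<in>UNIV. A $ i $ fst p * B $ j $ snd p * (C $ fst p $ k * D $ snd p $ l)) =
      (\<Sum>a\<in>UNIV. A $ i $ a * C $ a $ k) * (\<Sum>b\<in>UNIV. B $ j $ b * D $ b $ l)" for i j k l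
    unfolding sum_product by (simp add: sum.cartesian_product UNIV_Times_UNIV ac_simps split_def)
  then show ?thesis
    by (simp add: kron_def matrix_matrix_mult_def vec_eq_iff)
qed

lemma kron_mat_1: "kron (mat 1) (mat 1) = mat 1"
  by (auto simp: kron_def mat_def vec_eq_iff)

lemma transpose_kron: "transpose (kron A B) = kron (transpose A) (transpose B)"
  by (simp add: transpose_def kron_def vec_eq_iff)

lemma kron_scale:
  "kron (c *k A) B = c *k kron A B" "kron A (c *k B) = c *k kron A B"
  by (simp_all add: kron_def vec_eq_iff)

lemma kron_diff:
  "kron (A - A') B = kron A B - kron A' B" "kron A (B - B') = kron A B - kron A B'"
  by (simp_all add: kron_def vec_eq_iff algebra_simps)

lemma kron_zero [simp]: "kron 0 B = 0" "kron A 0 = 0"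
  by (simp_all add: kron_def vec_eq_iff)

lemma tensor_vec_linear:
  "tensor_vec (x + x') y = tensor_vec x y + tensor_vec x' y"
  "tensor_vec x (y + y') = tensor_vec x y + tensor_vec x y'"
  "tensor_vec (c *s x) y = c *s tensor_vec x y"
  "tensor_vec x (c *s y) = c *s tensor_vec x y"
  "tensor_vec 0 y = 0" "tensor_vec x 0 = 0"
  by (simp_all add: tensor_vec_def vec_eq_iff algebra_simps)

definition dot :: "complex^'n \<Rightarrow> complex^'n \<Rightarrow> complex" where
  "dot x y = (\<Sum>a\<in>UNIV. x $ a * y $ a)"

lemma dot_linear:
  "dot x (y + z) = dot x y + dot x z" "dot (x + y) z = dot x z + dot y z"
  "dot x (c *s y) = c * dot x y" "dot (c *s x) y = c * dot x y"
  "dot x (- y) = - dot x y" "dot x (y - z) = dot x y - dot x z"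
  "dot x 0 = 0" "dot 0 x = 0"
  by (simp_all add: dot_def algebra_simps sum.distrib sum_distrib_left sum_negf sum_subtractf)

lemma dot_commute: "dot x y = dot y x"
  by (simp add: dot_def mult.commute)

lemma dot_sum: "dot x (\<Sum>i\<in>I. f i) = (\<Sum>i\<in>I. dot x (f i))"
  by (induct I rule: infinite_finite_induct) (simp_all add: dot_linear)

lemma dot_mult_vec: "dot (A *v x) y = dot x (transpose A *v y)"
proof -
  have "dot (A *v x) y = (\<Sum>i\<in>UNIV. \<Sum>j\<in>UNIV. A $ i $ j * x $ j * y $ i)"
    by (simp add: dot_def matrix_vector_mult_def sum_distrib_right)
  also have "\<dots> = (\<Sum>j\<in>UNIV. \<Sum>i\<in>UNIV. A $ i $ j * x $ j * y $ i)"
    by (rule sum.swap)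
  also have "\<dots> = dot x (transpose A *v y)"
    by (simp add: dot_def matrix_vector_mult_def transpose_def sum_distrib_left ac_simps)
  finally show ?thesis .
qed

lemma dot_tensor_vec: "dot (tensor_vec x y) (tensor_vec x' y') = dot x x' * dot y y'"
  unfolding dot_def tensor_vec_def sum_product
  by (simp add: sum.cartesian_product UNIV_Times_UNIV ac_simps split_def)

lemma dot_eq_0I: "(\<And>y. dot x y = 0) \<Longrightarrow> x = 0"
proof -
  assume *: "\<And>y. dot x y = 0"
  have "dot x (axis a 1) = x $ a" for a
    by (simp add: dot_def axis_def if_distrib cong: if_cong)
  with * show "x = 0" by (simp add: vec_eq_iff)
qed

text \<open>
  A proper subspace of \<open>complex^'n\<close> is contained in the kernel of a nonzero linear form: take a
  coordinate with respect to a basis that extends a basis of the subspace.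
\<close>

lemma proper_subspace_annihilator:
  fixes S :: "(complex^'n) set"
  assumes S: "vec.subspace S" and proper: "S \<noteq> UNIV"
  obtains y where "y \<noteq> 0" "\<And>x. x \<in> S \<Longrightarrow> dot y x = 0"
proof -
  obtain B where B: "B \<subseteq> S" "vec.independent B" "S \<subseteq> vec.span B"
    using vec.basis_exists by metis
  define C where "C = vec.extend_basis B"
  have C: "B \<subseteq> C" "vec.independent C" "vec.span C = UNIV"
    unfolding C_def using vec.extend_basis_superset vec.independent_extend_basis
      vec.span_extend_basis B(2) by auto
  have "B \<noteq> C"
    using proper B C S vec.span_minimal [OF B(1) S] by blast
  then obtain b where b: "b \<in> C" "b \<notin> B" using C by blast
  let ?f = "\<lambda>x. vec.representation C x b"
  define y where "y = (\<chi> a. ?f (axis a 1))"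
  have f: "?f x = dot y x" for x
  proof -
    have "?f x = ?f (\<Sum>a\<in>UNIV. x $ a *s axis a 1)"
      by (simp add: basis_expansion)
    also have "\<dots> = (\<Sum>a\<in>UNIV. ?f (x $ a *s axis a 1))"
      by (simp add: vec.representation_sum [OF C(2)] C(3))
    also have "\<dots> = dot y x"
      by (simp add: vec.representation_scale [OF C(2)] C(3) dot_def y_def mult.commute)
    finally show ?thesis .
  qed
  show thesis
  proof
    have "dot y b = 1" using vec.representation_basis [OF C(2) b(1)] f [of b] by simp
    then show "y \<noteq> 0" by (auto simp: dot_def)
    fix x assume "x \<in> S"
    then have x: "x \<in> vec.span B" using B by blast
    have "vec.representation C x = vec.representation B x"
      by (rule vec.representation_extend [OF C(2) x C(1)])
    then show "dot y x = 0"
      using b(2) vec.representation_ne_zero f by (metis)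
  qed
qed

text \<open>Coordinate forms of a basis that is indexed by natural numbers.\<close>

lemma dual_basis_exists:
  fixes b :: "nat \<Rightarrow> complex^'n"
  assumes indep: "\<And>c. (\<Sum>k<CARD('n). c k *s b k) = 0 \<Longrightarrow> \<forall>k<CARD('n). c k = 0"
  obtains \<beta> where "\<And>j k. j < CARD('n) \<Longrightarrow> k < CARD('n) \<Longrightarrow> dot (\<beta> j) (b k) = (if j = k then 1 else 0)"
    and "\<And>x. x = (\<Sum>k<CARD('n). dot (\<beta> k) x *s b k)"
proof -
  obtain h :: "nat \<Rightarrow> 'n" where h: "bij_betw h {..<CARD('n)} UNIV"
    using ex_bij_betw_nat_finite [of "UNIV :: 'n set"] by (auto simp: atLeast0LessThan)
  define g where "g = inv_into {..<CARD('n)} h"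
  have g: "bij_betw g UNIV {..<CARD('n)}"
    unfolding g_def by (rule bij_betw_inv_into [OF h])
  have gh: "g (h k) = k" if "k < CARD('n)" for k
    using that h unfolding g_def by (auto simp: bij_betw_def intro: inv_into_f_f)
  have hg: "h (g a) = a" for a
    using h unfolding g_def by (auto simp: bij_betw_def intro: f_inv_into_f)
  have gl: "g a < CARD('n)" for a using g by (auto simp: bij_betw_def)
  define A where "A = (\<chi> a j. b (g j) $ a)"
  have col: "column j A = b (g j)" for j by (simp add: column_def A_def vec_eq_iff)
  have "\<exists>B. B ** A = mat 1"
    unfolding matrix_left_invertible_independent_columns
  proof (intro allI impI)
    fix c i assume "(\<Sum>i\<in>UNIV. c i *s column i A) = 0"
    also have "(\<Sum>i\<in>UNIV. c i *s column i A) = (\<Sum>k<CARD('n). c (h k) *s b k)"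
      by (rule sum.reindex_bij_witness [of _ h g]) (use h g gh hg in \<open>auto simp: col bij_betw_def\<close>)
    finally show "c i = 0" using indep [of "\<lambda>k. c (h k)"] gl [of i] hg [of i] by metis
  qed
  then obtain B where BA: "B ** A = mat 1" by blast
  then have AB: "A ** B = mat 1" using matrix_left_right_inverse by blast
  define \<beta> where "\<beta> j = B $ h j" for j
  show thesis
  proof
    fix j k assume jk: "j < CARD('n)" "k < CARD('n)"
    have "dot (\<beta> j) (b k) = (B ** A) $ h j $ h k"
      by (simp add: dot_def \<beta>_def matrix_matrix_mult_def A_def gh jk)
    also have "\<dots> = (if j = k then 1 else 0)"
      using h jk by (auto simp: BA mat_def bij_betw_def inj_on_def)
    finally show "dot (\<beta> j) (b k) = (if j = k then 1 else 0)" .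
  next
    fix x :: "complex^'n"
    have "x = A *v (B *v x)" by (simp add: matrix_vector_mul_assoc AB)
    also have "\<dots> = (\<Sum>j\<in>UNIV. (B *v x) $ j *s b (g j))"
      by (simp add: matrix_mult_sum col)
    also have "\<dots> = (\<Sum>k<CARD('n). (B *v x) $ h k *s b k)"
      by (rule sum.reindex_bij_witness [of _ h g]) (use h g gh hg in \<open>auto simp: bij_betw_def\<close>)
    also have "\<dots> = (\<Sum>k<CARD('n). dot (\<beta> k) x *s b k)"
      by (simp add: \<beta>_def dot_def matrix_vector_mult_def)
    finally show "x = (\<Sum>k<CARD('n). dot (\<beta> k) x *s b k)" .
  qed
qed

lemma mat_eq_on_basis:
  assumes "\<And>x. x = (\<Sum>k<n. f k x *s b k)" "\<And>k. k < n \<Longrightarrow> A *v b k = B *v b k"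
  shows "(A :: complex^'n^'m) = B"
proof -
  have "A *v x = B *v x" for x
    by (subst (1 2) assms(1) [of x]) (simp add: mult_vec_sum mult_vec_scale assms(2))
  then show ?thesis by (simp add: matrix_eq)
qed

section \<open>Modules generated by singular vectors\<close>

lemma generic_power_inject:
  fixes q :: complex
  assumes q: "q \<noteq> 0" and generic: "\<And>n::nat. n > 0 \<Longrightarrow> q ^ n \<noteq> 1" and eq: "q ^ a = q ^ b"
  shows "a = b"
proof -
  have False if "q ^ i = q ^ j" "i < j" for i j :: nat
  proof -
    have "q ^ j = q ^ i * q ^ (j - i)" using that by (metis le_add_diff_inverse less_imp_le power_add)
    with that q have "q ^ (j - i) = 1" by simp
    with generic [of "j - i"] that show False by simp
  qed
  with eq show ?thesis by (metis nat_neq_iff)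
qed

text \<open>
  A finite-dimensional \<open>U\<^sub>q(A\<^sub>2)\<close>-module with a basis \<open>u 0, \<dots>, u (N - 1)\<close> of its singular vectors,
  \<open>u k\<close> of weight \<open>l k\<close>. The linear forms \<open>\<phi> k\<close> restrict to the coordinates on the space of singular
  vectors. The last three assumptions express complete reducibility, in the form in which a
  contravariant form provides it, and local nilpotency of \<open>E\<^sub>1, E\<^sub>2\<close>.
\<close>

locale split_module =
  fixes q :: complex and M :: "('m::finite, 'x) chevalley_scheme"
    and N :: nat and u :: "nat \<Rightarrow> complex^'m" and l :: "nat \<Rightarrow> nat \<times> nat"
    and \<phi> :: "nat \<Rightarrow> complex^'m \<Rightarrow> complex"
  assumes q_nonzero: "q \<noteq> 0"
    and q_generic: "\<And>n::nat. n > 0 \<Longrightarrow> q ^ n \<noteq> 1"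
    and K_invertible: "\<And>i. i \<in> {1, 2} \<Longrightarrow> invertible (genK M i)"
    and KE: "\<And>i j. i \<in> {1, 2} \<Longrightarrow> j \<in> {1, 2} \<Longrightarrow>
      genK M i ** genE M j = (q powi cartan i j) *k (genE M j ** genK M i)"
    and KF: "\<And>i j. i \<in> {1, 2} \<Longrightarrow> j \<in> {1, 2} \<Longrightarrow>
      genK M i ** genF M j = (q powi (- cartan i j)) *k (genF M j ** genK M i)"
    and EF: "\<And>i j. i \<in> {1, 2} \<Longrightarrow> j \<in> {1, 2} \<Longrightarrow>
      genE M i ** genF M j - genF M j ** genE M i =
      (if i = j then inverse (q - inverse q) *k (genK M i - matrix_inv (genK M i)) else 0)"
    and u_singular: "\<And>k. k < N \<Longrightarrow> u k \<in> singular_space q M (l k)"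
    and \<phi>_u: "\<And>j k. j < N \<Longrightarrow> k < N \<Longrightarrow> \<phi> k (u j) = (if j = k then 1 else 0)"
    and \<phi>_linear: "\<phi> k (x + y) = \<phi> k x + \<phi> k y" "\<phi> k (c *s x) = c * \<phi> k x"
    and singular_expand: "\<And>x. genE M 1 *v x = 0 \<Longrightarrow> genE M 2 *v x = 0 \<Longrightarrow>
      x = (\<Sum>k<N. \<phi> k x *s u k)"
    and singular_not_lowered: "\<And>x a b. genE M 1 *v x = 0 \<Longrightarrow> genE M 2 *v x = 0 \<Longrightarrow>
      x = genF M 1 *v a + genF M 2 *v b \<Longrightarrow> x = 0"
    and generated: "\<And>S. vec.subspace S \<Longrightarrow>
      (\<And>i x. i \<in> {1, 2} \<Longrightarrow> x \<in> S \<Longrightarrow> genF M i *v x \<in> S) \<Longrightarrow>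
      (\<And>x. genE M 1 *v x = 0 \<Longrightarrow> genE M 2 *v x = 0 \<Longrightarrow> x \<in> S) \<Longrightarrow> S = UNIV"
    and raising_nilpotent: "\<And>S x. (\<And>i y. i \<in> {1, 2} \<Longrightarrow> y \<in> S \<Longrightarrow> genE M i *v y \<in> S) \<Longrightarrow>
      x \<in> S \<Longrightarrow> x \<noteq> 0 \<Longrightarrow> \<exists>y\<in>S. y \<noteq> 0 \<and> genE M 1 *v y = 0 \<and> genE M 2 *v y = 0"
begin

abbreviation "J i \<equiv> matrix_inv (genK M i)"

definition sing :: "complex^'m \<Rightarrow> bool" where
  "sing x \<longleftrightarrow> (\<forall>i\<in>{1,2}. genE M i *v x = 0)"

definition lw :: "3 \<Rightarrow> nat \<Rightarrow> nat" where
  "lw i k = (if i = 1 then fst (l k) else snd (l k))"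

lemma sing_iff: "sing x \<longleftrightarrow> genE M 1 *v x = 0 \<and> genE M 2 *v x = 0"
  by (auto simp: sing_def)

lemma JK: "i \<in> {1, 2} \<Longrightarrow> J i *v (genK M i *v x) = x" "i \<in> {1, 2} \<Longrightarrow> genK M i *v (J i *v x) = x"
  by (simp_all add: matrix_vector_mul_assoc mult_matrix_inv K_invertible)

lemma KE_vec: "i \<in> {1, 2} \<Longrightarrow> j \<in> {1, 2} \<Longrightarrow>
    genK M i *v (genE M j *v x) = q powi cartan i j *s (genE M j *v (genK M i *v x))"
  using arg_cong [OF KE, of i j "\<lambda>A. A *v x"] by (simp add: mat_vec_simps)

lemma KF_vec: "i \<in> {1, 2} \<Longrightarrow> j \<in> {1, 2} \<Longrightarrow>
    genK M i *v (genF M j *v x) = q powi (- cartan i j) *s (genF M j *v (genK M i *v x))"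
  using arg_cong [OF KF, of i j "\<lambda>A. A *v x"] by (simp add: mat_vec_simps)

lemma JE_vec: assumes "i \<in> {1, 2}" "j \<in> {1, 2}"
  shows "J i *v (genE M j *v x) = q powi (- cartan i j) *s (genE M j *v (J i *v x))"
proof -
  have "genE M j *v x = genE M j *v (genK M i *v (J i *v x))" using JK assms by simp
  also have "\<dots> = q powi (- cartan i j) *s (genK M i *v (genE M j *v (J i *v x)))"
    using q_nonzero by (simp add: KE_vec [OF assms] power_int_minus)
  finally show ?thesis using JK assms by (simp add: mult_vec_scale)
qed

lemma JF_vec: assumes "i \<in> {1, 2}" "j \<in> {1, 2}"
  shows "J i *v (genF M j *v x) = q powi (cartan i j) *s (genF M j *v (J i *v x))"
proof -
  have "genF M j *v x = genF M j *v (genK M i *v (J i *v x))" using JK assms by simp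
  also have "\<dots> = q powi (cartan i j) *s (genK M i *v (genF M j *v (J i *v x)))"
    using q_nonzero by (simp add: KF_vec [OF assms] power_int_minus)
  finally show ?thesis using JK assms by (simp add: mult_vec_scale)
qed

lemma EF_vec: "i \<in> {1, 2} \<Longrightarrow> j \<in> {1, 2} \<Longrightarrow>
    genE M i *v (genF M j *v x) = genF M j *v (genE M i *v x) +
      (if i = j then inverse (q - inverse q) *s (genK M i *v x + - 1 *s (J i *v x)) else 0)"
  using arg_cong [OF EF, of i j "\<lambda>A. A *v x"]
  by (auto simp: mat_vec_simps diff_eq_eq add.commute split: if_splits)

lemma sing_K: "i \<in> {1, 2} \<Longrightarrow> sing x \<Longrightarrow> sing (genK M i *v x)"
proof -
  assume i: "i \<in> {1, 2}" and x: "sing x"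
  have "genE M j *v (genK M i *v x) = 0" if "j \<in> {1, 2}" for j
    using KE_vec [OF i that, of x] x that q_nonzero by (auto simp: sing_def)
  then show ?thesis by (simp add: sing_def)
qed

lemma sing_J: "i \<in> {1, 2} \<Longrightarrow> sing x \<Longrightarrow> sing (J i *v x)"
proof -
  assume i: "i \<in> {1, 2}" and x: "sing x"
  have "genE M j *v (J i *v x) = 0" if "j \<in> {1, 2}" for j
    using JE_vec [OF i that, of x] x that q_nonzero by (auto simp: sing_def)
  then show ?thesis by (simp add: sing_def)
qed

lemma u_sing: "k < N \<Longrightarrow> sing (u k)"
  using u_singular [of k] by (auto simp: sing_def singular_space_def)

lemma K_u: "i \<in> {1, 2} \<Longrightarrow> k < N \<Longrightarrow> genK M i *v u k = q ^ lw i k *s u k"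
  using u_singular [of k] by (auto simp: singular_space_def lw_def)

lemma J_u: "i \<in> {1, 2} \<Longrightarrow> k < N \<Longrightarrow> J i *v u k = inverse (q ^ lw i k) *s u k"
  using JK(1) [of i "u k"] q_nonzero
  by (metis K_u mult_vec_scale vec.scale_left_imp_eq vec.scale_one vec.scale_scale left_inverse power_not_zero)

lemma \<phi>_sum: "\<phi> k (\<Sum>j\<in>A. f j) = (\<Sum>j\<in>A. \<phi> k (f j))"
  using \<phi>_linear(2) [of k 0 0] by (induct A rule: infinite_finite_induct) (simp_all add: \<phi>_linear)

lemma \<phi>_combination: "k < N \<Longrightarrow> \<phi> k (\<Sum>j<N. c j *s u j) = c k"
  by (simp add: \<phi>_sum \<phi>_linear \<phi>_u if_distrib cong: if_cong)

lemma sing_expand: "sing x \<Longrightarrow> x = (\<Sum>k<N. \<phi> k x *s u k)"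
  using singular_expand by (simp add: sing_iff)

lemma \<phi>_K: assumes "i \<in> {1, 2}" "sing x" "k < N" shows "\<phi> k (genK M i *v x) = q ^ lw i k * \<phi> k x"
proof -
  have "genK M i *v x = (\<Sum>j<N. (\<phi> j x * q ^ lw i j) *s u j)"
    by (subst (1) sing_expand [OF assms(2)]) (simp add: mult_vec_sum mult_vec_scale K_u [OF assms(1)] cong: sum.cong_simp)
  then show ?thesis using assms by (simp add: \<phi>_combination)
qed

lemma \<phi>_J: assumes "i \<in> {1, 2}" "sing x" "k < N"
  shows "\<phi> k (J i *v x) = inverse (q ^ lw i k) * \<phi> k x"
proof -
  have "J i *v x = (\<Sum>j<N. (\<phi> j x * inverse (q ^ lw i j)) *s u j)"
    by (subst (1) sing_expand [OF assms(2)]) (simp add: mult_vec_sum mult_vec_scale J_u [OF assms(1)] cong: sum.cong_simp)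
  then show ?thesis using assms by (simp add: \<phi>_combination)
qed

text \<open>
  The submodule of \<open>M \<oplus> M\<close> generated by the pairs \<open>(x, \<phi> k x u m)\<close> with \<open>x\<close> singular. It contains the
  graph of the map on singular vectors with \<open>u k \<mapsto> u m\<close>, and will be the graph of the extension of this map.
  Only closure under the \<open>F\<^sub>i\<close> is required; closure under \<open>K\<^sub>i\<close> and \<open>E\<^sub>i\<close> is a consequence of the
  commutation relations.
\<close>

inductive graph :: "nat \<Rightarrow> nat \<Rightarrow> complex^'m \<Rightarrow> complex^'m \<Rightarrow> bool" for m k where
  base: "sing x \<Longrightarrow> graph m k x (\<phi> k x *s u m)"
| add: "graph m k x y \<Longrightarrow> graph m k x' y' \<Longrightarrow> graph m k (x + x') (y + y')"
| scale: "graph m k x y \<Longrightarrow> graph m k (c *s x) (c *s y)"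
| lower: "i \<in> {1, 2} \<Longrightarrow> graph m k x y \<Longrightarrow> graph m k (genF M i *v x) (genF M i *v y)"

lemma graph_K:
  assumes "graph m k x y" "i \<in> {1, 2}" "m < N" "k < N" "l m = l k"
  shows "graph m k (genK M i *v x) (genK M i *v y)"
  using assms(1)
proof induct
  case (base x)
  have "genK M i *v (\<phi> k x *s u m) = \<phi> k (genK M i *v x) *s u m"
    using assms base by (simp add: mult_vec_scale K_u \<phi>_K lw_def mult.commute)
  then show ?case using graph.base [OF sing_K [OF assms(2) base], of m k] by simp
next
  case (lower j x y)
  then show ?case using assms(2) by (simp add: KF_vec graph.lower graph.scale)
qed (auto simp: mat_vec_simps intro: graph.intros)

lemma graph_J:
  assumes "graph m k x y" "i \<in> {1, 2}" "m < N" "k < N" "l m = l k"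
  shows "graph m k (J i *v x) (J i *v y)"
  using assms(1)
proof induct
  case (base x)
  have "J i *v (\<phi> k x *s u m) = \<phi> k (J i *v x) *s u m"
    using assms base by (simp add: mult_vec_scale J_u \<phi>_J lw_def mult.commute)
  then show ?case using graph.base [OF sing_J [OF assms(2) base], of m k] by simp
next
  case (lower j x y)
  then show ?case using assms(2) by (simp add: JF_vec graph.lower graph.scale)
qed (auto simp: mat_vec_simps intro: graph.intros)

lemma graph_0: "graph m k 0 0"
  using graph.base [of 0 m k] graph.scale [of m k 0 _ 0] by (simp add: sing_def)

lemma graph_E:
  assumes "graph m k x y" "i \<in> {1, 2}" and mk: "m < N" "k < N" "l m = l k"
  shows "graph m k (genE M i *v x) (genE M i *v y)"
  using assms(1)
proof induct
  case (base x)
  then have "genE M i *v x = 0" "genE M i *v (\<phi> k x *s u m) = 0"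
    using assms u_sing [of m] by (auto simp: sing_def mult_vec_scale)
  then show ?case by (simp add: graph_0)
next
  case (lower j x y)
  have "graph m k (genF M j *v (genE M i *v x) +
      (if i = j then inverse (q - inverse q) *s (genK M i *v x + - 1 *s (J i *v x)) else 0))
     (genF M j *v (genE M i *v y) +
      (if i = j then inverse (q - inverse q) *s (genK M i *v y + - 1 *s (J i *v y)) else 0))"
    using lower assms graph_K [OF lower(2) assms(2) mk] graph_J [OF lower(2) assms(2) mk]
    by (cases "i = j") (auto intro!: graph.add graph.scale graph.lower graph_0 simp del: vec.scale_minus_left)
  then show ?case using assms(2) lower(1) by (simp only: EF_vec)
qed (auto simp: mat_vec_simps intro: graph.intros)

definition lowered :: "complex^'m \<Rightarrow> bool" where
  "lowered x \<longleftrightarrow> (\<exists>a b. x = genF M 1 *v a + genF M 2 *v b)"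

lemma lowered_intros:
  "lowered x \<Longrightarrow> lowered y \<Longrightarrow> lowered (x + y)" "lowered x \<Longrightarrow> lowered (c *s x)"
  "lowered 0" "i \<in> {1, 2} \<Longrightarrow> lowered (genF M i *v x)"
proof -
  show "lowered (x + y)" if "lowered x" "lowered y"
  proof -
    from that obtain a b a' b' where "x = genF M 1 *v a + genF M 2 *v b"
      "y = genF M 1 *v a' + genF M 2 *v b'" by (auto simp: lowered_def)
    then have "x + y = genF M 1 *v (a + a') + genF M 2 *v (b + b')" by (simp add: mat_vec_simps)
    then show ?thesis unfolding lowered_def by blast
  qed
  show "lowered (c *s x)" if "lowered x"
  proof -
    from that obtain a b where "x = genF M 1 *v a + genF M 2 *v b" by (auto simp: lowered_def)
    then have "c *s x = genF M 1 *v (c *s a) + genF M 2 *v (c *s b)"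
      by (simp add: mat_vec_simps vec.scale_right_distrib)
    then show ?thesis unfolding lowered_def by blast
  qed
  have "0 = genF M 1 *v 0 + genF M 2 *v 0" by simp
  then show "lowered 0" unfolding lowered_def by blast
  have "genF M 1 *v x = genF M 1 *v x + genF M 2 *v 0" "genF M 2 *v x = genF M 1 *v 0 + genF M 2 *v x"
    by simp_all
  then show "i \<in> {1, 2} \<Longrightarrow> lowered (genF M i *v x)" unfolding lowered_def by blast
qed

lemma sing_lowered_0: "sing x \<Longrightarrow> lowered x \<Longrightarrow> x = 0"
  using singular_not_lowered by (auto simp: sing_iff lowered_def)

lemma sing_add: "sing x \<Longrightarrow> sing y \<Longrightarrow> sing (x + y)" "sing x \<Longrightarrow> sing (c *s x)"
  by (auto simp: sing_def mat_vec_simps)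

text \<open>
  A singular element of the graph has to lie in the graph of the initial map: modulo the image of the
  \<open>F\<^sub>i\<close>, which contains no singular vector, every element does.
\<close>

lemma graph_split:
  assumes "graph m k x y"
  shows "\<exists>s. sing s \<and> lowered (x + - 1 *s s) \<and> lowered (y + - \<phi> k s *s u m)"
  using assms
proof induct
  case (base x)
  then show ?case by (intro exI [of _ x]) (simp add: lowered_intros)
next
  case (add x y x' y')
  then obtain s s' where
    *: "sing s" "lowered (x + - 1 *s s)" "lowered (y + - \<phi> k s *s u m)"
       "sing s'" "lowered (x' + - 1 *s s')" "lowered (y' + - \<phi> k s' *s u m)" by auto
  have "x + x' + - 1 *s (s + s') = (x + - 1 *s s) + (x' + - 1 *s s')"
    "y + y' + - \<phi> k (s + s') *s u m = (y + - \<phi> k s *s u m) + (y' + - \<phi> k s' *s u m)"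
    by (simp_all add: vec_eq_iff \<phi>_linear algebra_simps)
  then show ?case using * lowered_intros(1) sing_add(1) by metis
next
  case (scale x y c)
  then obtain s where
    *: "sing s" "lowered (x + - 1 *s s)" "lowered (y + - \<phi> k s *s u m)" by auto
  have "c *s x + - 1 *s (c *s s) = c *s (x + - 1 *s s)"
    "c *s y + - \<phi> k (c *s s) *s u m = c *s (y + - \<phi> k s *s u m)"
    by (simp_all add: vec_eq_iff \<phi>_linear algebra_simps)
  then show ?case using * lowered_intros(2) sing_add(2) by metis
next
  case (lower i x y)
  have "sing 0" "\<phi> k 0 = 0" using \<phi>_linear(2) [of k 0 0] by (simp_all add: sing_def)
  then show ?case using lower by (intro exI [of _ 0]) (simp add: lowered_intros)
qed

text \<open>
  The vectors \<open>y\<close> with \<open>graph m k 0 y\<close> form a submodule, which would contain a singular vector if it were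
  nonzero; by the splitting above such a singular vector would be in the image of the \<open>F\<^sub>i\<close>.
\<close>

lemma graph_functional:
  assumes mk: "m < N" "k < N" "l m = l k"
  shows "graph m k 0 y \<Longrightarrow> y = 0"
proof (rule ccontr)
  assume y: "graph m k 0 y" "y \<noteq> 0"
  obtain y' where y': "graph m k 0 y'" "y' \<noteq> 0" "sing y'"
  proof -
    have "\<exists>y'\<in>{y. graph m k 0 y}. y' \<noteq> 0 \<and> genE M 1 *v y' = 0 \<and> genE M 2 *v y' = 0"
    proof (rule raising_nilpotent)
      show "y \<in> {y. graph m k 0 y}" "y \<noteq> 0" using y by simp_all
      show "genE M i *v z \<in> {y. graph m k 0 y}" if "i \<in> {1, 2}" "z \<in> {y. graph m k 0 y}" for i z
        using that graph_E [OF _ _ mk, of 0 z i] by simp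
    qed
    then show thesis using that by (auto simp: sing_iff)
  qed
  obtain s where s: "sing s" "lowered (0 + - 1 *s s)" "lowered (y' + - \<phi> k s *s u m)"
    using graph_split [OF y'(1)] by blast
  have "s = 0"
    using sing_lowered_0 [OF s(1)] lowered_intros(2) [OF s(2), of "-1"] by simp
  then have "lowered y'" using s(3) \<phi>_linear(2) [of k 0 0] by simp
  then show False using sing_lowered_0 y' by blast
qed

lemma graph_total: "\<exists>y. graph m k x y"
proof -
  have "{x. \<exists>y. graph m k x y} = UNIV"
  proof (rule generated)
    show "vec.subspace {x. \<exists>y. graph m k x y}"
      by (auto simp: vec.subspace_def intro: graph.add graph.scale graph_0)
    show "genF M i *v x \<in> {x. \<exists>y. graph m k x y}"
      if "i \<in> {1, 2}" "x \<in> {x. \<exists>y. graph m k x y}" for i x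
      using that graph.lower by blast
    show "x \<in> {x. \<exists>y. graph m k x y}" if "genE M 1 *v x = 0" "genE M 2 *v x = 0" for x
      using graph.base [of x m k] that by (auto simp: sing_iff)
  qed
  then show ?thesis by blast
qed

text \<open>
  The operator that sends \<open>u k\<close> to \<open>u m\<close> and kills the other \<open>u j\<close>; it is meaningful for \<open>l m = l k\<close>.
\<close>

definition Op :: "nat \<Rightarrow> nat \<Rightarrow> complex^'m^'m" where
  "Op m k = matrix (\<lambda>x. SOME y. graph m k x y)"

context
  fixes m k assumes mk: "m < N" "k < N" "l m = l k"
begin

lemma graph_unique: "graph m k x y \<Longrightarrow> graph m k x y' \<Longrightarrow> y = y'"
proof -
  assume "graph m k x y" "graph m k x y'"
  then have "graph m k (x + - 1 *s x) (y + - 1 *s y')"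
    by (intro graph.add graph.scale)
  then show "y = y'" using graph_functional [OF mk, of "y - y'"] by simp
qed

lemma graph_some: "graph m k x (SOME y. graph m k x y)"
  using graph_total by (rule someI_ex)

lemma graph_Op: "graph m k x (Op m k *v x)"
proof -
  have "Vector_Spaces.linear (*s) (*s) (\<lambda>x. SOME y. graph m k x y)"
    unfolding Vector_Spaces.linear_iff
    by (intro conjI allI vec.vector_space_axioms)
      (rule graph_unique [OF graph_some], intro graph.add graph.scale graph_some)+
  then show ?thesis using graph_some by (simp add: Op_def matrix_works)
qed

lemma Op_eqI: "graph m k x y \<Longrightarrow> Op m k *v x = y"
  using graph_Op graph_unique by blast

lemma Op_sing: "sing x \<Longrightarrow> Op m k *v x = \<phi> k x *s u m"
  by (intro Op_eqI graph.base)

lemma Op_u: "j < N \<Longrightarrow> Op m k *v u j = (if j = k then u m else 0)"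
  using mk by (simp add: Op_sing u_sing \<phi>_u)

lemma Op_commute:
  "i \<in> {1, 2} \<Longrightarrow> Op m k *v (genF M i *v x) = genF M i *v (Op m k *v x)"
  "i \<in> {1, 2} \<Longrightarrow> Op m k *v (genE M i *v x) = genE M i *v (Op m k *v x)"
  "i \<in> {1, 2} \<Longrightarrow> Op m k *v (genK M i *v x) = genK M i *v (Op m k *v x)"
  "i \<in> {1, 2} \<Longrightarrow> Op m k *v (J i *v x) = J i *v (Op m k *v x)"
  by (auto intro!: Op_eqI graph.lower graph_Op graph_E graph_K graph_J mk)

end

lemma generated_eqI:
  assumes "\<And>i x. i \<in> {1, 2} \<Longrightarrow> A *v (genF M i *v x) = genF M i *v (A *v x)"
    and "\<And>i x. i \<in> {1, 2} \<Longrightarrow> B *v (genF M i *v x) = genF M i *v (B *v x)"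
    and "\<And>k. k < N \<Longrightarrow> A *v u k = B *v u k"
  shows "A = (B :: complex^'m^'m)"
proof -
  have "{x. A *v x = B *v x} = UNIV"
  proof (rule generated)
    fix x assume "genE M 1 *v x = 0" "genE M 2 *v x = 0"
    then have x: "x = (\<Sum>k<N. \<phi> k x *s u k)" by (rule singular_expand)
    have "A *v (\<Sum>k<N. \<phi> k x *s u k) = B *v (\<Sum>k<N. \<phi> k x *s u k)"
      by (simp add: mult_vec_sum mult_vec_scale assms(3) cong: sum.cong_simp)
    with x show "x \<in> {x. A *v x = B *v x}" by simp
  qed (auto simp: vec.subspace_def mat_vec_simps assms)
  then show ?thesis by (simp add: matrix_eq set_eq_iff)
qed

end

section \<open>Isotypic components and equivariant operators\<close>

context split_module
begin

lemma sing_components_weight: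
  assumes "x \<in> singular_space q M l0" "k < N" "l k \<noteq> l0"
  shows "\<phi> k x = 0"
proof (rule ccontr)
  assume nz: "\<phi> k x \<noteq> 0"
  have x: "sing x" "genK M 1 *v x = q ^ fst l0 *s x" "genK M 2 *v x = q ^ snd l0 *s x"
    using assms(1) by (auto simp: singular_space_def sing_def)
  have "q ^ lw 1 k * \<phi> k x = q ^ fst l0 * \<phi> k x" "q ^ lw 2 k * \<phi> k x = q ^ snd l0 * \<phi> k x"
    using \<phi>_K [of 1 x k] \<phi>_K [of 2 x k] x assms(2) by (metis \<phi>_linear(2) insertCI)+
  then have "lw 1 k = fst l0" "lw 2 k = snd l0"
    using nz generic_power_inject [OF q_nonzero q_generic] by simp_all
  then show False using assms(3) by (simp add: lw_def prod_eq_iff)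
qed

lemma singular_space_expand:
  assumes "x \<in> singular_space q M l0"
  shows "x = (\<Sum>k | k < N \<and> l k = l0. \<phi> k x *s u k)"
proof -
  have "x = (\<Sum>k<N. \<phi> k x *s u k)"
    using assms by (intro sing_expand) (auto simp: singular_space_def sing_def)
  also have "\<dots> = (\<Sum>k | k < N \<and> l k = l0. \<phi> k x *s u k)"
    using sing_components_weight [OF assms] by (intro sum.mono_neutral_right) auto
  finally show ?thesis .
qed

text \<open>
  An operator that commutes with \<open>U\<^sub>q(A\<^sub>2)\<close> is a combination of the \<^const>\<open>Op\<close>, whose
  coefficients can be read off from its values on the singular vectors.
\<close>

lemma equivariant_on_u:
  assumes A: "\<And>i. i \<in> {1, 2} \<Longrightarrow> A ** genE M i = genE M i ** A"
    "\<And>i. i \<in> {1, 2} \<Longrightarrow> A ** genK M i = genK M i ** A" and k: "k < N"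
  shows "A *v u k = (\<Sum>m | m < N \<and> l m = l k. \<phi> m (A *v u k) *s u m)"
proof (rule singular_space_expand)
  have E: "genE M i *v (A *v u k) = 0" if "i \<in> {1, 2}" for i
    using arg_cong [OF A(1) [OF that], of "\<lambda>B. B *v u k"] u_sing [OF k] that
    by (auto simp: mat_vec_simps sing_def)
  have K: "genK M i *v (A *v u k) = q ^ lw i k *s (A *v u k)" if "i \<in> {1, 2}" for i
    using arg_cong [OF A(2) [OF that], of "\<lambda>B. B *v u k"] K_u [OF that k]
    by (simp add: mat_vec_simps)
  show "A *v u k \<in> singular_space q M (l k)"
    using E [of 1] E [of 2] K [of 1] K [of 2] by (simp add: singular_space_def lw_def)
qed

definition proj :: "nat \<times> nat \<Rightarrow> complex^'m^'m" where
  "proj l0 = (\<Sum>k | k < N \<and> l k = l0. Op k k)"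

lemma proj_commute:
  assumes "i \<in> {1, 2}"
  shows "proj l0 *v (genF M i *v x) = genF M i *v (proj l0 *v x)"
    "proj l0 *v (genE M i *v x) = genE M i *v (proj l0 *v x)"
    "proj l0 *v (genK M i *v x) = genK M i *v (proj l0 *v x)"
    "proj l0 *v (J i *v x) = J i *v (proj l0 *v x)"
  using assms by (simp_all add: proj_def sum_mult_vec mult_vec_sum Op_commute cong: sum.cong_simp)

lemma proj_u: "k < N \<Longrightarrow> proj l0 *v u k = (if l k = l0 then u k else 0)"
  by (auto simp: proj_def sum_mult_vec Op_u if_distrib cong: sum.cong_simp if_cong)

lemma proj_singular:
  assumes "x \<in> singular_space q M l0" shows "proj l0 *v x = x"
  using proj_u by (subst (1 2) singular_space_expand [OF assms])
    (simp add: mult_vec_sum mult_vec_scale cong: sum.cong_simp)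

lemma Op_Op:
  assumes "m < N" "k < N" "l m = l k" "j < N" "i < N" "l j = l i"
  shows "Op m k *v (Op j i *v x) = (if k = j then Op m i *v x else 0)"
proof (cases "k = j")
  case True
  have "Op m k ** Op j i = Op m i"
    by (rule generated_eqI) (use assms True in \<open>simp_all add: mat_vec_simps Op_commute Op_u\<close>)
  with True show ?thesis by (metis matrix_vector_mul_assoc)
next
  case False
  have "Op m k ** Op j i = 0"
    by (rule generated_eqI) (use assms False in \<open>auto simp: mat_vec_simps Op_commute Op_u\<close>)
  with False show ?thesis by (metis matrix_vector_mul_assoc matrix_vector_mult_0)
qed

lemma sum_Op: "(\<Sum>k<N. Op k k *v x) = x"
proof -
  have "(\<Sum>k<N. Op k k) = mat 1"
    by (rule generated_eqI)
      (simp_all add: sum_mult_vec mult_vec_sum Op_commute Op_u if_distrib cong: sum.cong_simp if_cong)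
  then show ?thesis by (metis sum_mult_vec matrix_vector_mul_lid)
qed

lemma sum_proj: "(\<Sum>l0\<in>l ` {..<N}. proj l0 *v x) = x"
proof -
  have "(\<Sum>l0\<in>l ` {..<N}. proj l0) = mat 1"
    by (rule generated_eqI)
      (auto simp: sum_mult_vec mult_vec_sum proj_commute proj_u if_distrib cong: sum.cong_simp if_cong)
  then show ?thesis by (metis sum_mult_vec matrix_vector_mul_lid)
qed

lemma proj_proj: "proj l0 *v (proj l1 *v x) = (if l0 = l1 then proj l0 *v x else 0)"
proof -
  have "proj l0 ** proj l1 = (if l0 = l1 then proj l0 else 0)"
    by (rule generated_eqI) (auto simp: mat_vec_simps proj_commute proj_u)
  then show ?thesis by (metis matrix_vector_mul_assoc matrix_vector_mult_0)
qed

text \<open>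
  Singular vectors control submodules: a nonzero submodule contains a nonzero singular vector, and
  the range of \<open>Op k k\<close> contains only one such line, so this range is simple.
\<close>

lemma submodule_singular:
  assumes U: "submodule {1, 2} M U" "U \<noteq> {0}"
  obtains x where "x \<in> U" "x \<noteq> 0" "sing x"
proof -
  have "vec.subspace U" using U by (simp add: submodule_def)
  then have "0 \<in> U" by (rule vec.subspace_0)
  then obtain y where "y \<in> U" "y \<noteq> 0" using U(2) by blast
  then have "\<exists>y\<in>U. y \<noteq> 0 \<and> genE M 1 *v y = 0 \<and> genE M 2 *v y = 0"
    using U(1) by (intro raising_nilpotent [of U y]) (auto simp: submodule_def)
  with that show thesis by (auto simp: sing_iff)
qed

lemma range_Op_is_L:
  assumes k: "k < N"
  shows "is_L q M (l k) {x. Op k k *v x = x}"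
proof -
  let ?W = "{x. Op k k *v x = x}"
  have sub: "submodule {1, 2} M ?W"
    by (auto simp: submodule_def vec.subspace_def mat_vec_simps Op_commute k)
  have uW: "u k \<in> ?W" by (simp add: Op_u k)
  have u0: "u k \<noteq> 0" using \<phi>_u [OF k k] \<phi>_linear(2) [of k 0 0] by auto
  have "U = ?W" if U: "submodule {1, 2} M U" "U \<subseteq> ?W" "U \<noteq> {0}" for U
  proof -
    obtain x where x: "x \<in> U" "x \<noteq> 0" "sing x" using submodule_singular U by blast
    have sU: "vec.subspace U" using U by (simp add: submodule_def)
    have "x = \<phi> k x *s u k"
      using x U(2) Op_sing [OF k k refl x(3)] by auto
    then have "\<phi> k x \<noteq> 0" "u k = inverse (\<phi> k x) *s x"
    proof -
      show nz: "\<phi> k x \<noteq> 0" using x(2) \<open>x = _\<close> by (metis vec.scale_zero_left)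
      have "inverse (\<phi> k x) *s x = inverse (\<phi> k x) *s (\<phi> k x *s u k)" using \<open>x = _\<close> by simp
      then show "u k = inverse (\<phi> k x) *s x" using nz by simp
    qed
    then have uU: "u k \<in> U" using x sU vec.subspace_scale by metis
    have "{x. Op k k *v x \<in> U} = UNIV"
    proof (rule generated)
      show "vec.subspace {x. Op k k *v x \<in> U}"
        using sU by (auto simp: vec.subspace_def mat_vec_simps)
      show "genF M i *v x \<in> {x. Op k k *v x \<in> U}" if "i \<in> {1, 2}" "x \<in> {x. Op k k *v x \<in> U}" for i x
        using that U(1) by (auto simp: Op_commute k submodule_def)
      show "x \<in> {x. Op k k *v x \<in> U}" if "genE M 1 *v x = 0" "genE M 2 *v x = 0" for x
        using that Op_sing [OF k k refl, of x] uU sU by (auto simp: sing_iff vec.subspace_scale)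
    qed
    then have Op_U: "Op k k *v x \<in> U" for x by blast
    have "x \<in> U" if "x \<in> ?W" for x using that Op_U [of x] by simp
    then show ?thesis using U(2) by blast
  qed
  then have "simple_submodule {1, 2} M ?W"
    unfolding simple_submodule_def using sub uW u0 by blast
  then show ?thesis
    unfolding is_L_def using uW u0 u_singular [OF k] by blast
qed

text \<open>
  A simple submodule \<open>W\<close> with a singular vector \<open>y\<close> of weight \<open>l0\<close> lies in the range of \<open>proj l0\<close>, because
  \<open>y\<close> does and the vectors of \<open>W\<close> in this range form a submodule.
\<close>

lemma isotypic_eq: "isotypic q M l0 = {x. proj l0 *v x = x}"
proof
  show "isotypic q M l0 \<subseteq> {x. proj l0 *v x = x}"
    unfolding isotypic_def
  proof (rule vec.span_minimal)
    show "vec.subspace {x. proj l0 *v x = x}" by (auto simp: vec.subspace_def mat_vec_simps)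
    show "\<Union> {W. is_L q M l0 W} \<subseteq> {x. proj l0 *v x = x}"
    proof
      fix x assume "x \<in> \<Union> {W. is_L q M l0 W}"
      then obtain W where W: "is_L q M l0 W" "x \<in> W" by blast
      then obtain y where y: "y \<in> W" "y \<noteq> 0" "y \<in> singular_space q M l0"
        by (auto simp: is_L_def)
      have simple: "simple_submodule {1, 2} M W" using W by (simp add: is_L_def)
      then have sub: "submodule {1, 2} M W" by (simp add: simple_submodule_def)
      have "submodule {1, 2} M {x \<in> W. proj l0 *v x = x}"
        using sub by (auto simp: submodule_def vec.subspace_def mat_vec_simps proj_commute)
      moreover have "y \<in> {x \<in> W. proj l0 *v x = x}" using y proj_singular by simp
      ultimately have "{x \<in> W. proj l0 *v x = x} = W"
        using simple y(2) unfolding simple_submodule_def by blast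
      with W(2) show "x \<in> {x. proj l0 *v x = x}" by blast
    qed
  qed
  show "{x. proj l0 *v x = x} \<subseteq> isotypic q M l0"
  proof
    fix x assume "x \<in> {x. proj l0 *v x = x}"
    then have x: "x = (\<Sum>k | k < N \<and> l k = l0. Op k k *v x)" by (simp add: proj_def sum_mult_vec)
    have "Op k k *v x \<in> isotypic q M l0" if "k < N" "l k = l0" for k
    proof -
      have "Op k k *v x \<in> {x. Op k k *v x = x}" by (simp add: Op_Op that)
      then show ?thesis
        using range_Op_is_L [OF that(1)] that(2) unfolding isotypic_def by (blast intro: vec.span_base)
    qed
    then have "(\<Sum>k | k < N \<and> l k = l0. Op k k *v x) \<in> isotypic q M l0"
      by (auto simp: isotypic_def intro!: vec.span_sum)
    with x show "x \<in> isotypic q M l0" by simp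
  qed
qed

lemma isotypic_projector_eq: "isotypic_projector q M l0 = proj l0"
  unfolding isotypic_projector_def
proof (rule the_equality)
  show "(\<forall>x\<in>isotypic q M l0. proj l0 *v x = x) \<and>
    (\<forall>l'. l' \<noteq> l0 \<longrightarrow> (\<forall>x\<in>isotypic q M l'. proj l0 *v x = 0))"
  proof (intro conjI ballI allI impI)
    fix x assume "x \<in> isotypic q M l0"
    then show "proj l0 *v x = x" by (simp add: isotypic_eq)
  next
    fix l' x assume "l' \<noteq> l0" "x \<in> isotypic q M l'"
    then show "proj l0 *v x = 0" using proj_proj [of l0 l' x] by (simp add: isotypic_eq)
  qed
next
  fix P assume P: "(\<forall>x\<in>isotypic q M l0. P *v x = x) \<and>
    (\<forall>l'. l' \<noteq> l0 \<longrightarrow> (\<forall>x\<in>isotypic q M l'. P *v x = 0))"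
  have P1: "P *v (proj l1 *v x) = proj l0 *v (proj l1 *v x)" for l1 x
  proof -
    have "proj l1 *v x \<in> isotypic q M l1" by (simp add: isotypic_eq proj_proj)
    with P show ?thesis by (cases "l1 = l0") (simp_all add: proj_proj del: split_paired_All)
  qed
  have "P *v x = proj l0 *v x" for x
    by (subst (1 2) sum_proj [of x, symmetric]) (simp add: mult_vec_sum P1)
  then show "P = proj l0" by (simp add: matrix_eq)
qed

lemma decomposes: "decomposes_as q M (map l [0..<N])"
proof -
  let ?W = "\<lambda>k. {x. Op k k *v x = x}"
  have "\<exists>!y. y \<in> (\<Pi>\<^sub>E k\<in>{..<N}. ?W k) \<and> (\<Sum>k<N. y k) = x" for x
  proof (rule ex1I)
    show "(\<lambda>k\<in>{..<N}. Op k k *v x) \<in> (\<Pi>\<^sub>E k\<in>{..<N}. ?W k) \<and>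
      (\<Sum>k<N. (\<lambda>k\<in>{..<N}. Op k k *v x) k) = x"
      by (auto simp: Op_Op sum_Op)
  next
    fix y assume y: "y \<in> (\<Pi>\<^sub>E k\<in>{..<N}. ?W k) \<and> (\<Sum>k<N. y k) = x"
    have "y k = Op k k *v x" if k: "k < N" for k
    proof -
      have y': "y j = Op j j *v y j" if "j < N" for j using y that by (auto simp: PiE_def Pi_def)
      have "Op k k *v x = (\<Sum>j<N. Op k k *v y j)" by (simp only: y [THEN conjunct2, symmetric] mult_vec_sum)
      also have "\<dots> = (\<Sum>j<N. if j = k then y k else 0)"
      proof (rule sum.cong [OF refl])
        fix j assume "j \<in> {..<N}"
        then show "Op k k *v y j = (if j = k then y k else 0)"
          using y' [of j] Op_Op [of k k j j "y j"] k by (cases "j = k") (metis lessThan_iff)+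
      qed
      also have "\<dots> = y k" using k by simp
      finally show ?thesis by simp
    qed
    then show "y = (\<lambda>k\<in>{..<N}. Op k k *v x)"
      using y by (auto simp: fun_eq_iff PiE_def extensional_def)
  qed
  then show ?thesis
    unfolding decomposes_as_def using range_Op_is_L by (intro exI [of _ ?W]) simp
qed

lemma singular_basis_u:
  assumes c: "inj c" "range c = {k. k < N \<and> l k = l0}"
  shows "singular_basis q M l0 (\<lambda>j :: 2. u (c j))"
proof -
  have u_inj: "j = k" if "u j = u k" "j < N" "k < N" for j k
    using \<phi>_u [of j k] \<phi>_u [of k k] that by (auto split: if_splits)
  have cN: "c j < N" "l (c j) = l0" for j using c(2) by auto
  have inj: "inj (\<lambda>j. u (c j))"
    using c(1) u_inj cN by (auto simp: inj_def)
  have span: "vec.span (range (\<lambda>j. u (c j))) = singular_space q M l0"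
  proof
    show "vec.span (range (\<lambda>j. u (c j))) \<subseteq> singular_space q M l0"
    proof (rule vec.span_minimal)
      show "range (\<lambda>j. u (c j)) \<subseteq> singular_space q M l0" using u_singular [OF cN(1)] cN(2) by auto
      show "vec.subspace (singular_space q M l0)"
        by (auto simp: vec.subspace_def singular_space_def mat_vec_simps vec.scale_right_distrib mult.commute)
    qed
    show "singular_space q M l0 \<subseteq> vec.span (range (\<lambda>j. u (c j)))"
    proof
      fix x assume "x \<in> singular_space q M l0"
      then have "x = (\<Sum>k\<in>range c. \<phi> k x *s u k)" using singular_space_expand c(2) by simp
      also have "\<dots> \<in> vec.span (range (\<lambda>j. u (c j)))"
        by (intro vec.span_sum vec.span_scale vec.span_base) auto
      finally show "x \<in> vec.span (range (\<lambda>j. u (c j)))" .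
    qed
  qed
  have "vec.independent (range (\<lambda>j. u (c j)))"
    unfolding vec.independent_explicit_module
  proof (intro allI impI)
    fix T a v assume T: "finite T" "T \<subseteq> range (\<lambda>j. u (c j))" "(\<Sum>v\<in>T. a v *s v) = 0" "v \<in> T"
    then obtain j where j: "v = u (c j)" by auto
    have \<phi>_T: "\<phi> (c j) w = (if w = v then 1 else 0)" if "w \<in> T" for w
    proof -
      from that T obtain i where i: "w = u (c i)" by auto
      have "c i = c j \<longleftrightarrow> u (c i) = u (c j)" using u_inj cN by metis
      then show ?thesis using i j \<phi>_u [OF cN(1) cN(1), of j i] by simp
    qed
    have "(\<Sum>w\<in>T. a w * \<phi> (c j) w) = (\<Sum>w\<in>T. if w = v then a v else 0)"
      by (rule sum.cong) (simp_all add: \<phi>_T)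
    also have "\<dots> = a v" using T(1,4) by simp
    finally have "\<phi> (c j) (\<Sum>w\<in>T. a w *s w) = a v" by (simp add: \<phi>_sum \<phi>_linear)
    then show "a v = 0" using T(3) \<phi>_linear(2) [of "c j" 0 0] by simp
  qed
  with inj span show ?thesis by (simp add: singular_basis_def)
qed

text \<open>
  Two operators with the defining properties agree after composition with each \<open>proj l1\<close>: for \<open>l1 = l0\<close>
  both composites commute with the \<open>F\<^sub>i\<close> and agree on singular vectors, otherwise both vanish.
\<close>

lemma tensor_projector_eq:
  assumes c: "inj c" "range c = {k. k < N \<and> l k = l0}"
  shows "tensor_projector q M l0 (\<lambda>j :: 2. u (c j)) f =
    (\<Sum>i\<in>UNIV. \<Sum>j\<in>UNIV. (f $ i $ j) *k Op (c i) (c j))" (is "_ = ?T")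
proof -
  have cN: "c j < N" "l (c j) = l0" for j using c(2) by auto
  have T: "?T *v x = (\<Sum>i\<in>UNIV. \<Sum>j\<in>UNIV. f $ i $ j *s (Op (c i) (c j) *v x))" for x
    by (simp add: sum_mult_vec mat_vec_simps)
  have T_commute: "?T *v (genF M i *v x) = genF M i *v (?T *v x)"
    "?T *v (genE M i *v x) = genE M i *v (?T *v x)"
    "?T *v (genK M i *v x) = genK M i *v (?T *v x)" if "i \<in> {1, 2}" for i x
    unfolding T using that cN by (simp_all add: Op_commute mult_vec_sum mult_vec_scale)
  have proj_Op: "proj l1 *v (Op (c i) (c j) *v x) = (if l1 = l0 then Op (c i) (c j) *v x else 0)" for l1 i j x
  proof -
    have "proj l1 ** Op (c i) (c j) = (if l1 = l0 then Op (c i) (c j) else 0)"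
      by (rule generated_eqI) (auto simp: mat_vec_simps proj_commute Op_commute proj_u Op_u cN)
    then show ?thesis by (metis matrix_vector_mul_assoc matrix_vector_mult_0)
  qed
  have Op_proj: "Op (c i) (c j) *v (proj l1 *v x) = (if l1 = l0 then Op (c i) (c j) *v x else 0)" for l1 i j x
  proof -
    have "Op (c i) (c j) ** proj l1 = (if l1 = l0 then Op (c i) (c j) else 0)"
      by (rule generated_eqI) (auto simp: mat_vec_simps proj_commute Op_commute proj_u Op_u cN)
    then show ?thesis by (metis matrix_vector_mul_assoc matrix_vector_mult_0)
  qed
  have T_u: "?T *v u (c j) = (\<Sum>i\<in>UNIV. f $ i $ j *s u (c i))" for j
    unfolding T using cN c(1)
    by (simp add: Op_u inj_eq if_distrib cong: if_cong)
  have T_0: "?T *v x = 0" if "x \<in> isotypic q M l'" "l' \<noteq> l0" for x l'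
  proof -
    have "x = proj l' *v x" using that by (simp add: isotypic_eq)
    then show ?thesis unfolding T using Op_proj that(2)
      by (smt (verit, best) sum.neutral vec.scale_zero_right)
  qed
  have T_in: "?T *v x \<in> isotypic q M l0" for x
    unfolding T isotypic_eq by (simp add: mult_vec_sum mult_vec_scale proj_Op)
  show ?thesis
    unfolding tensor_projector_def
  proof (rule the_equality)
    show "(\<forall>l'. l' \<noteq> l0 \<longrightarrow> (\<forall>x\<in>isotypic q M l'. ?T *v x = 0)) \<and>
      (\<forall>x\<in>isotypic q M l0. ?T *v x \<in> isotypic q M l0 \<and>
        (\<forall>i\<in>{1, 2}. ?T *v (genE M i *v x) = genE M i *v (?T *v x) \<and>
          ?T *v (genF M i *v x) = genF M i *v (?T *v x) \<and>
          ?T *v (genK M i *v x) = genK M i *v (?T *v x))) \<and>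
      (\<forall>j. ?T *v u (c j) = (\<Sum>i\<in>UNIV. f $ i $ j *s u (c i)))"
      using T_0 T_in T_commute T_u by blast
  next
    fix T' assume T': "(\<forall>l'. l' \<noteq> l0 \<longrightarrow> (\<forall>x\<in>isotypic q M l'. T' *v x = 0)) \<and>
      (\<forall>x\<in>isotypic q M l0. T' *v x \<in> isotypic q M l0 \<and>
        (\<forall>i\<in>{1, 2}. T' *v (genE M i *v x) = genE M i *v (T' *v x) \<and>
          T' *v (genF M i *v x) = genF M i *v (T' *v x) \<and>
          T' *v (genK M i *v x) = genK M i *v (T' *v x))) \<and>
      (\<forall>j. T' *v u (c j) = (\<Sum>i\<in>UNIV. f $ i $ j *s u (c i)))"
    have iso: "proj l1 *v x \<in> isotypic q M l1" for l1 x by (simp add: isotypic_eq proj_proj)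
    have "T' ** proj l0 = ?T ** proj l0"
    proof (rule generated_eqI)
      show "(T' ** proj l0) *v (genF M i *v x) = genF M i *v ((T' ** proj l0) *v x)"
        "(?T ** proj l0) *v (genF M i *v x) = genF M i *v ((?T ** proj l0) *v x)" if "i \<in> {1, 2}" for i x
        using that T' iso [of l0 x] T_commute by (auto simp: mat_vec_simps proj_commute)
    next
      fix k assume k: "k < N"
      show "(T' ** proj l0) *v u k = (?T ** proj l0) *v u k"
      proof (cases "l k = l0")
        case True
        then obtain j where "k = c j" using c(2) k by blast
        with True k show ?thesis using T' T_u [of j] by (simp add: mat_vec_simps proj_u)
      next
        case False
        with k show ?thesis by (simp add: mat_vec_simps proj_u)
      qed
    qed
    then have *: "T' *v (proj l0 *v x) = ?T *v (proj l0 *v x)" for x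
      by (simp only: matrix_vector_mul_assoc)
    have **: "T' *v (proj l1 *v x) = ?T *v (proj l1 *v x)" for l1 x
    proof (cases "l1 = l0")
      case False
      then have "T' *v (proj l1 *v x) = 0" using T' iso by blast
      then show ?thesis using T_0 [OF iso False] by simp
    qed (use * in simp)
    have "T' *v x = ?T *v x" for x
      by (subst (1 2) sum_proj [of x, symmetric]) (simp add: mult_vec_sum **)
    then show "T' = ?T" by (simp add: matrix_eq)
  qed
qed

end

lemma matrix_diff_ldistrib: "(A :: complex^'m^'n) ** (B - C) = A ** B - A ** C"
  by (simp add: matrix_matrix_mult_def vec_eq_iff algebra_simps sum_subtractf)

lemma matrix_diff_rdistrib: "(B - C) ** (A :: complex^'m^'n) = B ** A - C ** A"
  by (simp add: matrix_matrix_mult_def vec_eq_iff algebra_simps sum_subtractf)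

lemmas matrix_diff_distrib = matrix_diff_ldistrib matrix_diff_rdistrib

section \<open>Strings of lowering operators\<close>

lemma generic_powi_inject:
  fixes q :: complex
  assumes q: "q \<noteq> 0" and generic: "\<And>n::nat. n > 0 \<Longrightarrow> q ^ n \<noteq> 1" and eq: "q powi a = q powi b"
  shows "a = b"
proof -
  have *: "a \<le> b" if "q powi a = q powi b" for a b :: int
  proof (rule ccontr)
    assume "\<not> a \<le> b"
    then have "q powi (a - b) = 1" using that q by (simp add: power_int_diff)
    moreover have "q powi (a - b) = q ^ nat (a - b)" using \<open>\<not> a \<le> b\<close> by (simp add: power_int_def)
    ultimately show False using generic [of "nat (a - b)"] \<open>\<not> a \<le> b\<close> by simp
  qed
  show ?thesis using * [of a b] * [of b a] eq by simp
qed

text \<open>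
  The quantum integer \<open>[m]\<close> for \<open>m\<close> of either sign.
\<close>

definition qint :: "complex \<Rightarrow> int \<Rightarrow> complex" where
  "qint q m = (q powi m - q powi (- m)) / (q - inverse q)"

lemma qint_nonzero:
  assumes q: "q \<noteq> 0" and generic: "\<And>n::nat. n > 0 \<Longrightarrow> q ^ n \<noteq> 1" and "m \<noteq> 0"
  shows "qint q m \<noteq> 0"
proof -
  have "q powi m \<noteq> q powi (- m)" "q powi 1 \<noteq> q powi (- 1)"
    using generic_powi_inject [OF q generic, of m "-m"] generic_powi_inject [OF q generic, of 1 "-1"] assms(3)
    by auto
  then show ?thesis by (simp add: qint_def power_int_minus)
qed

lemma qint_recursion:
  assumes q: "q \<noteq> 0" and q2: "q - inverse q \<noteq> 0"
  shows "qint q (int k + 1) * qint q (m - int k) + qint q (m - 2 * (int k + 1)) =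
    qint q (int k + 2) * qint q (m - int k - 1)"
proof -
  define x y where "x = q powi int k" and "y = q powi m"
  have nz: "x \<noteq> 0" "y \<noteq> 0" using q by (simp_all add: x_def y_def)
  have qq: "q powi 2 = q * q" "q powi (-2) = inverse q * inverse q"
    by (simp_all add: power_int_minus power2_eq_square)
  have e: "q powi (int k + 1) = x * q" "q powi (int k + 2) = x * q * q"
    "q powi (- (int k + 1)) = inverse (x * q)" "q powi (- (int k + 2)) = inverse (x * q * q)"
    "q powi (m - int k) = y / x" "q powi (- (m - int k)) = x / y"
    "q powi (m - int k - 1) = y / (x * q)" "q powi (- (m - int k - 1)) = x * q / y"
    "q powi (m - 2 * (int k + 1)) = y / (x * x * q * q)"
    "q powi (- (m - 2 * (int k + 1))) = x * x * q * q / y"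
    using q by (simp_all add: x_def y_def power_int_add power_int_diff power_int_minus algebra_simps
        divide_simps power_int_mult power2_eq_square mult_2)
  have "(x * q - inverse (x * q)) * (y / x - x / y) +
      (q - inverse q) * (y / (x * x * q * q) - x * x * q * q / y) =
    (x * q * q - inverse (x * q * q)) * (y / (x * q) - x * q / y)"
    using nz q by (simp add: field_simps)
  then show ?thesis unfolding qint_def e using q2 by (simp add: divide_simps) (simp add: algebra_simps)
qed

text \<open>
  The string \<open>y, f y, f\<^sup>2 y, \<dots>\<close> below a singular vector \<open>y\<close> of negative weight \<open>m\<close> never ends and is
  linearly independent, since \<open>e f\<^sup>k\<^sup>+\<^sup>1 y = [k + 1] [m - k] f\<^sup>k y\<close> with nonzero coefficients.
\<close>

lemma (in vector_space) singular_string: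
  fixes q :: "'a" and y :: "nat \<Rightarrow> 'b" and \<gamma> :: "nat \<Rightarrow> 'a"
  assumes e: "\<And>x y. e (x + y) = e x + e y" "\<And>c x. e (scale c x) = scale c (e x)"
    and y0: "y 0 \<noteq> 0" "e (y 0) = 0" and ey: "\<And>k. e (y (Suc k)) = scale (\<gamma> k) (y k)"
    and \<gamma>: "\<And>k. \<gamma> k \<noteq> 0"
  shows "(\<Sum>k<n. scale (c k) (y k)) = 0 \<Longrightarrow> k < n \<Longrightarrow> c k = 0"
proof (induct n arbitrary: c k)
  case (Suc n)
  have e_sum: "e (\<Sum>k<j. g k) = (\<Sum>k<j. e (g k))" for g :: "nat \<Rightarrow> 'b" and j
    using e(2) [of 0 0] by (induct j) (simp_all add: e)
  have "0 = e (\<Sum>k<Suc n. scale (c k) (y k))" using Suc(2) e(2) [of 0 0] by simp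
  also have "\<dots> = (\<Sum>k<n. scale (c (Suc k) * \<gamma> k) (y k))"
    unfolding sum.lessThan_Suc_shift by (simp add: e e_sum ey y0)
  finally have "c (Suc j) * \<gamma> j = 0" if "j < n" for j using Suc(1) [of "\<lambda>k. c (Suc k) * \<gamma> k" j] that by simp
  then have c: "c (Suc j) = 0" if "j < n" for j using \<gamma> that by simp
  have "scale (c 0) (y 0) = 0" using Suc(2) unfolding sum.lessThan_Suc_shift by (simp add: c)
  then have "c 0 = 0" using y0 by simp
  with c Suc(3) show ?case by (cases k) auto
qed simp

lemma (in vector_space) singular_string_step:
  fixes y :: "nat \<Rightarrow> 'b" and \<gamma> \<delta> :: "nat \<Rightarrow> 'a"
  assumes f: "\<And>c x. f (scale c x) = scale c (f x)" "f 0 = 0"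
    and y0: "e (y 0) = 0" and fy: "\<And>k. y (Suc k) = f (y k)"
    and rel: "\<And>k. e (f (y k)) = f (e (y k)) + scale (\<delta> k) (y k)"
    and rec: "\<gamma> 0 = \<delta> 0" "\<And>k. \<gamma> k + \<delta> (Suc k) = \<gamma> (Suc k)"
  shows "e (y (Suc k)) = scale (\<gamma> k) (y k)"
proof (induct k)
  case 0
  show ?case using rel [of 0] by (simp add: fy y0 f rec)
next
  case (Suc k)
  have "e (y (Suc (Suc k))) = scale (\<gamma> k) (y (Suc k)) + scale (\<delta> (Suc k)) (y (Suc k))"
    using rel [of "Suc k"] unfolding Suc f(1) fy [symmetric] .
  then show ?case unfolding rec(2) [symmetric] scale_left_distrib .
qed

text \<open>
  The string below \<open>x\<close> would consist of infinitely many linearly independent vectors.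
\<close>

lemma singular_negative_weight_zero:
  fixes E F K K' :: "complex^'n^'n"
  assumes q: "q \<noteq> 0" and generic: "\<And>n::nat. n > 0 \<Longrightarrow> q ^ n \<noteq> 1"
    and EF: "E ** F - F ** E = inverse (q - inverse q) *k (K - K')"
    and inverse: "K' ** K = mat 1" and KF: "K ** F = (q powi (-2)) *k (F ** K)"
    and x: "E *v x = 0" "K *v x = q powi m *s x" "m < 0"
  shows "x = 0"
proof (rule ccontr)
  assume nz: "x \<noteq> 0"
  define y where "y k = ((*v) F ^^ k) x" for k
  have Ky: "K *v y k = q powi (m - 2 * int k) *s y k" for k
  proof (induct k)
    case (Suc k)
    have "K *v y (Suc k) = (K ** F) *v y k" by (simp add: y_def matrix_vector_mul_assoc)
    also have "\<dots> = q powi (-2) *s (F *v (K *v y k))" by (simp add: KF mat_vec_simps)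
    also have "\<dots> = (q powi (-2) * q powi (m - 2 * int k)) *s y (Suc k)"
      using Suc by (simp add: y_def mat_vec_simps)
    also have "q powi (-2) * q powi (m - 2 * int k) = q powi (m - 2 * int (Suc k))"
      using q by (simp flip: power_int_add add: algebra_simps)
    finally show ?case .
  qed (use x y_def in simp)
  have K'y: "K' *v y k = q powi (- (m - 2 * int k)) *s y k" for k
  proof -
    have "K' *v (K *v y k) = y k" by (simp add: matrix_vector_mul_assoc inverse)
    then have "y k = q powi (m - 2 * int k) *s (K' *v y k)" by (simp add: Ky mat_vec_simps)
    then have "q powi (- (m - 2 * int k)) *s y k =
        (q powi (- (m - 2 * int k)) * q powi (m - 2 * int k)) *s (K' *v y k)"
      by (metis vec.scale_scale)
    then show ?thesis using q by (simp flip: power_int_add)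
  qed
  have rel: "E *v (F *v y k) = F *v (E *v y k) + qint q (m - 2 * int k) *s y k" for k
  proof -
    have "E *v (F *v y k) - F *v (E *v y k) = inverse (q - inverse q) *s (K *v y k - K' *v y k)"
      using arg_cong [OF EF, of "\<lambda>A. A *v y k"] by (simp add: mat_vec_simps)
    also have "\<dots> = qint q (m - 2 * int k) *s y k"
      by (simp add: Ky K'y qint_def vec_eq_iff divide_inverse algebra_simps)
    finally show ?thesis by (simp add: diff_eq_eq add.commute)
  qed
  define \<gamma> where "\<gamma> k = qint q (int k + 1) * qint q (m - int k)" for k
  have q2: "q - inverse q \<noteq> 0"
    using generic_powi_inject [OF q generic, of 1 "-1"] by (auto simp: power_int_minus)
  have \<gamma>: "\<gamma> k \<noteq> 0" for k unfolding \<gamma>_def using qint_nonzero [OF q generic] x(3) by simp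
  have ey: "E *v y (Suc k) = \<gamma> k *s y k" for k
  proof (rule vec.singular_string_step [where f = "(*v) F" and \<delta> = "\<lambda>k. qint q (m - 2 * int k)"])
    show "\<gamma> 0 = qint q (m - 2 * int 0)" using q2 by (simp add: \<gamma>_def qint_def power_int_minus)
    show "\<gamma> k + qint q (m - 2 * int (Suc k)) = \<gamma> (Suc k)" for k
      using qint_recursion [OF q q2, of k m] by (simp add: \<gamma>_def algebra_simps)
  qed (use x rel in \<open>simp_all add: y_def mat_vec_simps\<close>)
  have indep: "c k = 0" if "(\<Sum>k<n. c k *s y k) = 0" "k < n" for n c k
    by (rule vec.singular_string [where e = "(*v) E" and y = y and \<gamma> = \<gamma>, OF _ _ _ _ _ _ that])
      (use nz x ey \<gamma> in \<open>simp_all add: mat_vec_simps y_def\<close>)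
  obtain \<beta> where \<beta>: "y CARD('n) = (\<Sum>k<CARD('n). dot (\<beta> k) (y CARD('n)) *s y k)"
  proof (rule dual_basis_exists [of y])
    show "\<forall>k<CARD('n). c k = 0" if "(\<Sum>k<CARD('n). c k *s y k) = 0" for c
      using indep [OF that] by blast
  qed (use that in blast)
  let ?c = "\<lambda>k. if k = CARD('n) then - 1 else dot (\<beta> k) (y CARD('n))"
  have "(\<Sum>k<Suc CARD('n). ?c k *s y k) = (\<Sum>k<CARD('n). dot (\<beta> k) (y CARD('n)) *s y k) - y CARD('n)"
    by simp
  also have "\<dots> = 0" using \<beta> by simp
  finally show False using indep [of ?c "Suc CARD('n)" "CARD('n)"] by simp
qed

interpretation mat: vector_space "(*k) :: complex \<Rightarrow> complex^'n^'m \<Rightarrow> complex^'n^'m"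
  by unfold_locales (simp_all add: mat_scale_def vec_eq_iff algebra_simps)

text \<open>
  In finite-dimensional \<open>U\<^sub>q(sl\<^sub>2)\<close>-modules the operator \<open>F\<close> is determined by \<open>E\<close> and \<open>K\<close>. Indeed a
  linear map \<open>D\<close> that commutes with \<open>E\<close> and lowers weights by \<open>2\<close> gives, after multiplication by \<open>K\<close>, a
  singular vector of weight \<open>-2\<close> for the adjoint action \<open>y \<mapsto> E' y - K' y K\<^sup>-\<^sup>1 E\<close>,
  \<open>y \<mapsto> F' y K - y F K\<close>; were it nonzero, its string would never end, but weights are bounded.
\<close>

lemma commutes_E_lowers_weight_zero:
  fixes E F K Ki :: "complex^'m^'m" and E' F' K' Ki' :: "complex^'n^'n" and D :: "complex^'m^'n"
  assumes q: "q \<noteq> 0" and generic: "\<And>n::nat. n > 0 \<Longrightarrow> q ^ n \<noteq> 1"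
    and EF: "E ** F - F ** E = inverse (q - inverse q) *k (K - Ki)"
    and EF': "E' ** F' - F' ** E' = inverse (q - inverse q) *k (K' - Ki')"
    and inverse: "Ki ** K = mat 1" "Ki' ** K' = mat 1"
    and KE: "K ** E = (q powi 2) *k (E ** K)" and KF: "K ** F = (q powi (-2)) *k (F ** K)"
    and KE': "K' ** E' = (q powi 2) *k (E' ** K')" and KF': "K' ** F' = (q powi (-2)) *k (F' ** K')"
    and D: "E' ** D = D ** E" "K' ** D = (q powi (-2)) *k (D ** K)"
    and b: "\<And>x. x = (\<Sum>k\<in>I. g k x *s b k)" "\<And>k. k \<in> I \<Longrightarrow> K *v b k = q powi w k *s b k"
    and b': "\<And>x. x = (\<Sum>k\<in>I'. g' k x *s b' k)"
      "\<And>k x. k \<in> I' \<Longrightarrow> g' k (K' *v x) = q powi w' k * g' k x" "\<And>k a x. g' k (a *s x) = a * g' k x"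
    and bound: "\<And>k. k \<in> I \<Longrightarrow> w k \<le> int c" "\<And>k. k \<in> I' \<Longrightarrow> w' k \<ge> - int c"
  shows "D = 0"
proof (rule ccontr)
  assume D0: "D \<noteq> 0"
  have inverse2: "K ** Ki = mat 1" "K' ** Ki' = mat 1"
    using inverse matrix_left_right_inverse by blast+
  \<comment> \<open>The adjoint action and the string below \<open>D K\<close>. The factor \<open>K\<close> turns commutation with \<open>E\<close> into
    annihilation by \<open>e\<close>.\<close>
  define e where "e y = E' ** y - K' ** y ** Ki ** E" for y
  define f where "f y = F' ** y ** K - y ** F ** K" for y
  define y where "y k = (f ^^ k) (D ** K)" for k
  have qq: "q powi a * q powi b = q powi (a + b)" for a b using q by (simp add: power_int_add)
  have q2_cancel: "q\<^sup>2 * q powi (-2) = 1" "q powi (-2) * q\<^sup>2 = 1"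
    using qq [of 2 "-2"] by (simp_all add: mult.commute)
  have f_scale: "f (c *k x) = c *k f x" for c x
    by (simp add: f_def mat_scale_mult_left mat_scale_mult_right mat_scale_diff)
  have f_0: "f 0 = 0" by (simp add: f_def)
  have KFK: "K ** (F ** K) = (q powi (-2)) *k (F ** K ** K)"
    using arg_cong [OF KF, of "\<lambda>A. A ** K"] by (simp add: matrix_mul_assoc mat_scale_mult_left)
  have Ky: "K' ** y k = (q powi (- 2 - 2 * int k)) *k (y k ** K)" for k
  proof (induct k)
    case 0
    show ?case using arg_cong [OF D(2), of "\<lambda>A. A ** K"]
      by (simp add: y_def matrix_mul_assoc mat_scale_mult_left)
  next
    case (Suc k)
    have "K' ** y (Suc k) = K' ** F' ** y k ** K - K' ** y k ** F ** K"
      by (simp add: y_def f_def matrix_mul_assoc matrix_diff_distrib)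
    also have "K' ** F' ** y k ** K = (q powi (-2)) *k (F' ** (K' ** y k) ** K)"
      by (simp add: KF' mat_scale_mult_left matrix_mul_assoc)
    also have "\<dots> = (q powi (- 2 - 2 * int (Suc k))) *k (F' ** y k ** K ** K)"
      by (simp add: Suc mat_scale_mult_left mat_scale_mult_right mat_scale_scale qq matrix_mul_assoc algebra_simps)
    also have "K' ** y k ** F ** K = (q powi (- 2 - 2 * int k)) *k (y k ** (K ** (F ** K)))"
      by (simp add: Suc mat_scale_mult_left matrix_mul_assoc)
    also have "\<dots> = (q powi (- 2 - 2 * int (Suc k))) *k (y k ** F ** K ** K)"
      by (simp only: KFK mat_scale_mult_right mat_scale_scale qq) (simp add: matrix_mul_assoc)
    finally show ?case
      by (simp add: y_def f_def mat_scale_diff matrix_mul_assoc matrix_diff_distrib)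
  qed
  have KyKi: "K' ** y k ** Ki = (q powi (- 2 - 2 * int k)) *k y k" for k
    using inverse2 by (simp add: Ky mat_scale_mult_left flip: matrix_mul_assoc)
  have KiyK: "Ki' ** y k ** K = (q powi (- (- 2 - 2 * int k))) *k y k" for k
  proof -
    have "y k = Ki' ** (K' ** y k)" by (simp add: matrix_mul_assoc inverse)
    also have "\<dots> = (q powi (- 2 - 2 * int k)) *k (Ki' ** y k ** K)"
      by (simp add: Ky mat_scale_mult_right matrix_mul_assoc)
    finally show ?thesis
      by (metis (no_types, lifting) add.left_inverse mat_scale_one mat_scale_scale power_int_0_right qq)
  qed
  have KiEFK: "Ki ** E ** F ** K = E ** F"
  proof -
    have "E ** F ** K = E ** ((q powi 2) *k (K ** F))"
      using q by (simp add: KF mat_scale_scale q2_cancel flip: matrix_mul_assoc)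
    also have "\<dots> = ((q powi 2) *k (E ** K)) ** F" by (simp add: mat_scale_mult_left mat_scale_mult_right matrix_mul_assoc)
    also have "\<dots> = K ** E ** F" by (simp add: KE)
    finally have "Ki ** (E ** F ** K) = Ki ** (K ** E ** F)" by simp
    then show ?thesis by (simp add: matrix_mul_assoc inverse)
  qed
  have KiEK: "Ki ** E ** K = (q powi (-2)) *k E"
  proof -
    have "E ** K = (q powi (-2)) *k (K ** E)" using q by (simp add: KE mat_scale_scale q2_cancel)
    then have "Ki ** (E ** K) = (q powi (-2)) *k (Ki ** (K ** E))" by (simp add: mat_scale_mult_right)
    then show ?thesis by (simp add: matrix_mul_assoc inverse)
  qed
  have KiE: "K ** Ki ** E = E" "x ** K ** Ki = x" for x :: "complex^'m^'n"
    using inverse2 by (simp_all flip: matrix_mul_assoc)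
  have rel: "e (f (y k)) = f (e (y k)) + qint q (- 2 - 2 * int k) *k y k" for k
  proof -
    let ?y = "y k"
    have 1: "e (f ?y) = E' ** F' ** ?y ** K - E' ** ?y ** F ** K
        - K' ** F' ** ?y ** (K ** Ki ** E) + K' ** ?y ** F ** (K ** Ki ** E)"
      by (simp add: e_def f_def matrix_mul_assoc matrix_diff_distrib algebra_simps)
    have 2: "f (e ?y) = F' ** E' ** ?y ** K - F' ** K' ** ?y ** (Ki ** E ** K)
        - E' ** ?y ** F ** K + K' ** ?y ** (Ki ** E ** F ** K)"
      by (simp add: e_def f_def matrix_mul_assoc matrix_diff_distrib algebra_simps)
    have 3: "F' ** K' ** ?y ** (Ki ** E ** K) = K' ** F' ** ?y ** E"
      by (simp add: KiEK KF' mat_scale_mult_left mat_scale_mult_right)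
    have "e (f ?y) - f (e ?y) = (E' ** F' - F' ** E') ** ?y ** K - K' ** ?y ** (E ** F - F ** E)"
      unfolding 1 2 3 KiE KiEFK
      by (simp add: matrix_mul_assoc matrix_diff_distrib algebra_simps)
    also have "\<dots> = inverse (q - inverse q) *k (K' ** ?y ** Ki - Ki' ** ?y ** K)"
      unfolding EF EF'
      by (simp add: mat_scale_mult_left mat_scale_mult_right mat_scale_diff matrix_mul_assoc
          matrix_diff_distrib algebra_simps)
    also have "\<dots> = qint q (- 2 - 2 * int k) *k ?y"
      unfolding KyKi KiyK by (simp add: qint_def vec_eq_iff divide_inverse algebra_simps)
    finally show ?thesis by (simp add: diff_eq_eq add.commute)
  qed
  define \<gamma> where "\<gamma> k = qint q (int k + 1) * qint q (- 2 - int k)" for k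
  have q2: "q - inverse q \<noteq> 0"
    using generic_powi_inject [OF q generic, of 1 "-1"] by (auto simp: power_int_minus)
  have \<gamma>: "\<gamma> k \<noteq> 0" for k unfolding \<gamma>_def using qint_nonzero [OF q generic] by simp
  have y0: "y 0 \<noteq> 0"
  proof
    assume "y 0 = 0"
    then have "D ** K ** Ki = 0" by (simp add: y_def)
    with D0 KiE show False by simp
  qed
  have e0: "e (y 0) = 0"
  proof -
    have "e (y 0) = (E' ** D) ** K - (K' ** D) ** (K ** Ki) ** E"
      by (simp add: e_def y_def matrix_mul_assoc)
    also have "\<dots> = D ** E ** K - (q powi (-2)) *k (D ** (K ** E))"
      unfolding D inverse2 by (simp add: mat_scale_mult_left matrix_mul_assoc)
    also have "\<dots> = 0"
      using q by (simp add: KE mat_scale_mult_right mat_scale_scale q2_cancel matrix_mul_assoc)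
    finally show ?thesis .
  qed
  have ey: "e (y (Suc k)) = \<gamma> k *k y k" for k
  proof (rule mat.singular_string_step [where f = f and \<delta> = "\<lambda>k. qint q (- 2 - 2 * int k)"])
    show "\<gamma> 0 = qint q (- 2 - 2 * int 0)" using q2 by (simp add: \<gamma>_def qint_def power_int_minus)
    show "\<gamma> k + qint q (- 2 - 2 * int (Suc k)) = \<gamma> (Suc k)" for k
      using qint_recursion [OF q q2, of k "-2"] by (simp add: \<gamma>_def algebra_simps)
  qed (use rel f_scale f_0 e0 in \<open>simp_all add: y_def\<close>)
  have "y k \<noteq> 0" for k
  proof (induct k)
    case (Suc k)
    show ?case
    proof
      assume "y (Suc k) = 0"
      then have "\<gamma> k *k y k = 0" using ey [of k] by (simp add: e_def)
      with Suc \<gamma> show False by simp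
    qed
  qed (rule y0)
  moreover have "y c = 0"
  proof -
    have "y c *v b k = 0" if k: "k \<in> I" for k
    proof -
      let ?x = "y c *v b k"
      have K'x: "K' *v ?x = q powi (w k - 2 - 2 * int c) *s ?x"
        using arg_cong [OF Ky, of "\<lambda>A. A *v b k" c] k
        by (simp add: mat_vec_simps b(2) qq algebra_simps)
      have *: "q powi w' j * g' j ?x = q powi (w k - 2 - 2 * int c) * g' j ?x"
        if "j \<in> I'" for j using b'(2) [OF that, of ?x, symmetric] by (simp only: K'x b'(3))
      have "g' j ?x = 0" if "j \<in> I'" for j
      proof (rule ccontr)
        assume "g' j ?x \<noteq> 0"
        then have "w' j = w k - 2 - 2 * int c"
          using * [OF that] generic_powi_inject [OF q generic] by simp
        then show False using bound(1) [OF k] bound(2) [OF that] by linarith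
      qed
      then show "?x = 0" by (subst b'(1)) simp
    qed
    then have "y c *v x = 0" for x by (subst b(1)) (simp add: mult_vec_sum mult_vec_scale)
    then show ?thesis by (simp add: matrix_eq)
  qed
  ultimately show False by blast
qed

section \<open>The evaluation adjoint module in an explicit basis\<close>

text \<open>
  The defining relations without the Serre relations, with conjugations written as commutations.
\<close>

definition weight_relations :: "complex \<Rightarrow> ('n::finite, 'x) chevalley_scheme \<Rightarrow> bool" where
  "weight_relations q M \<longleftrightarrow>
     (\<forall>i. invertible (genK M i)) \<and>
     (\<forall>i j. genK M i ** genK M j = genK M j ** genK M i) \<and>
     genK M 0 ** genK M 1 ** genK M 2 = mat 1 \<and>
     (\<forall>i j. genK M i ** genE M j = (q powi cartan i j) *k (genE M j ** genK M i)) \<and>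
     (\<forall>i j. genK M i ** genF M j = (q powi (- cartan i j)) *k (genF M j ** genK M i)) \<and>
     (\<forall>i j. genE M i ** genF M j - genF M j ** genE M i =
        (if i = j then inverse (q - inverse q) *k (genK M i - matrix_inv (genK M i)) else 0))"

lemma conjugation_relation:
  assumes "invertible (A :: complex^'n^'n)" "A ** B ** matrix_inv A = c *k B"
  shows "A ** B = c *k (B ** A)"
proof -
  have "A ** B ** (matrix_inv A ** A) = (c *k B) ** A"
    by (simp add: matrix_mul_assoc assms)
  then show ?thesis by (simp add: mult_matrix_inv assms(1) mat_scale_mult_left)
qed

lemma chevalley_weight_relations:
  assumes "chevalley_relations q M" shows "weight_relations q M"
  using assms unfolding chevalley_relations_def weight_relations_def
  by (auto intro!: conjugation_relation simp: qcomm_def)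

text \<open>
  The basis to be used consists of \<open>v\<close> and the seven monomials \<open>F\<^sub>1 v\<close>, \<open>F\<^sub>2 v\<close>, \<open>F\<^sub>2 F\<^sub>1 v\<close>, \<open>F\<^sub>1 F\<^sub>2 v\<close>,
  \<open>F\<^sub>1 F\<^sub>2 F\<^sub>1 v\<close>, \<open>F\<^sub>2 F\<^sub>1 F\<^sub>2 v\<close>, \<open>F\<^sub>2 F\<^sub>1 F\<^sub>2 F\<^sub>1 v\<close>. Their weights are the roots and twice zero; \<open>wt i k\<close> is the
  exponent of \<open>q\<close> by which \<open>K\<^sub>i\<close> acts on the \<open>k\<close>-th of them. In the tables below, a pair \<open>(m, d)\<close> in the \<open>k\<close>-th
  entry is a term \<open>d b\<^sub>m\<close> of the image of \<open>b\<^sub>k\<close>. The branch of \<open>E_table\<close> for the remaining index is that of \<open>E\<^sub>0\<close>;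
  \<open>F_table\<close> is used for \<open>F\<^sub>1\<close> and \<open>F\<^sub>2\<close> only.
\<close>

definition wt :: "3 \<Rightarrow> nat \<Rightarrow> int" where
  "wt i k = (if i = 1 then [1, -1, 2, 0, 0, -2, 1, -1] ! k
     else if i = 2 then [1, 2, -1, 0, 0, 1, -2, -1] ! k
     else [-2, -1, -1, 0, 0, 1, 1, 2] ! k)"

definition E_table :: "complex \<Rightarrow> 3 \<Rightarrow> nat \<Rightarrow> (nat \<times> complex) list" where
  "E_table q i k =
    (if i = 1 then [[], [(0, 1)], [], [(2, 1)], [(2, q + inverse q)], [(4, 1)], [], [(6, 1)]] ! k
     else if i = 2 then [[], [], [(0, 1)], [(1, q + inverse q)], [(1, 1)], [], [(3, 1)], [(5, 1)]] ! k
     else [[(3, q), (4, - (q ^ 2))], [(5, - (q ^ 3))], [(6, 1)], [(7, - (q ^ 3))], [(7, 1)], [], [], []] ! k)"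

definition F_table :: "complex \<Rightarrow> 3 \<Rightarrow> nat \<Rightarrow> (nat \<times> complex) list" where
  "F_table q i k =
    (if i = 1 then [[(1, 1)], [], [(4, 1)], [(5, 1)], [(5, q + inverse q)], [], [(7, 1)], []] ! k
     else [[(2, 1)], [(3, 1)], [], [(6, q + inverse q)], [(6, 1)], [(7, 1)], [], []] ! k)"

text \<open>
  The first two coefficients of \<open>q (1 - c q\<^sup>-\<^sup>1 z) / (1 - c q z)\<close>.
\<close>

lemma lweight_plus_coeffs:
  assumes "c \<noteq> 0"
  shows "fps_nth (lweight_plus q [:1, - c:]) 0 = q"
    "fps_nth (lweight_plus q [:1, - c:]) 1 = q * c * (q - inverse q)"
proof -
  define f where "f = fps_of_poly [:1, - (inverse q * c):]"
  define g where "g = fps_of_poly [:1, - (q * c):]"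
  have nth: "fps_nth f 0 = 1" "fps_nth f (Suc 0) = - (inverse q * c)"
    "fps_nth g 0 = 1" "fps_nth g (Suc 0) = - (q * c)"
    by (simp_all add: f_def g_def)
  have l: "lweight_plus q [:1, - c:] = fps_const q * (f / g)"
    using assms by (simp add: lweight_plus_def f_def g_def pcompose_pCons mult.commute)
  define h where "h = f / g"
  have "h * g = f"
    unfolding h_def using nth(3) by (simp add: fps_divide_unit inverse_mult_eq_1 mult.assoc)
  then have fg: "fps_nth (h * g) n = fps_nth f n" for n by simp
  have 0: "fps_nth h 0 = 1" using fg [of 0] by (simp add: nth)
  have "fps_nth h (Suc 0) - q * c = - (inverse q * c)"
    using fg [of "Suc 0"] by (simp add: fps_mult_nth nth 0)
  then have 1: "fps_nth h (Suc 0) = c * (q - inverse q)" by (simp add: algebra_simps eq_diff_eq)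
  show "fps_nth (lweight_plus q [:1, - c:]) 0 = q"
    "fps_nth (lweight_plus q [:1, - c:]) 1 = q * c * (q - inverse q)"
    by (simp_all add: l 0 1 flip: h_def)
qed

lemma three_cases: "i = (0::3) \<or> i = 1 \<or> i = 2"
  using exhaust_3 [of i] by auto

lemma less8: "k < 8 \<Longrightarrow> k = 0 \<or> k = 1 \<or> k = 2 \<or> k = 3 \<or> k = 4 \<or> k = 5 \<or> k = 6 \<or> k = (7::nat)"
  by auto

lemma sum8: "(\<Sum>k<8. f (k :: nat)) = f 0 + f 1 + f 2 + f 3 + f 4 + f 5 + f 6 + (f 7 :: 'a::ab_group_add)"
proof -
  have "{..<8::nat} = {0, 1, 2, 3, 4, 5, 6, 7}" by auto
  then show ?thesis by (simp add: add.assoc)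
qed

locale adjoint_module =
  fixes q :: complex and V :: "'n::finite affine_rep" and v :: "complex^'n"
  assumes q_nonzero: "q \<noteq> 0"
    and q_generic: "\<And>n::nat. n > 0 \<Longrightarrow> q ^ n \<noteq> 1"
    and dim: "CARD('n) = 8"
    and V: "evaluation_adjoint q V v"
begin

\<comment> \<open>The indices 0 to 7 are to remain numerals.\<close>
declare One_nat_def [simp del]

lemma weight_rels: "weight_relations q V"
  using V by (auto simp: evaluation_adjoint_def affine_module_def intro: chevalley_weight_relations)

lemma q_pow_neq_1: "q ^ 2 \<noteq> 1" "q ^ 4 \<noteq> 1" "q ^ 6 \<noteq> 1" "q * q \<noteq> 1"
  using q_generic [of 2] q_generic [of 4] q_generic [of 6] by (simp_all add: power2_eq_square)

lemma q2: "q - inverse q \<noteq> 0"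
  using q_pow_neq_1 q_nonzero by (simp add: field_simps)

definition two :: complex where "two = q + inverse q"

lemma two_nonzero: "two \<noteq> 0"
  unfolding two_def
proof
  assume "q + inverse q = 0"
  then have "q * (q + inverse q) = 0" by simp
  then have "q ^ 2 + 1 = 0" using q_nonzero by (simp add: distrib_left power2_eq_square)
  then have "q ^ 2 = - 1" by (simp add: eq_neg_iff_add_eq_0)
  then have "q ^ 4 = 1" using power_mult [of q 2 2] by simp
  then show False using q_pow_neq_1 by simp
qed

lemma three_nonzero: "two * two - 1 \<noteq> 0"
  unfolding two_def
proof
  assume "(q + inverse q) * (q + inverse q) - 1 = 0"
  moreover have "q ^ 2 * ((q + inverse q) * (q + inverse q) - 1) = q ^ 4 + q ^ 2 + 1"
    using q_nonzero by (simp add: field_simps power2_eq_square power4_eq_xxxx)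
  ultimately have "q ^ 4 + q ^ 2 + 1 = 0" by simp
  then have "q ^ 6 = 1" by algebra
  then show False using q_pow_neq_1 by simp
qed

lemma qint_values: "qint q 0 = 0" "qint q 1 = 1" "qint q 2 = two" "qint q (- 1) = - 1"
proof -
  show "qint q 0 = 0" "qint q 1 = 1" using q2 by (simp_all add: qint_def power_int_minus)
  have "(q + inverse q) * (q - inverse q) = q powi 2 - q powi (- 2)"
    using q_nonzero by (simp add: power_int_minus field_simps power2_eq_square)
  then show "qint q 2 = two" unfolding qint_def two_def using q2 by (metis nonzero_mult_div_cancel_right)
  show "qint q (- 1) = - 1" using q2 by (simp add: qint_def power_int_minus field_simps)
qed

abbreviation "E \<equiv> genE V"
abbreviation "F \<equiv> genF V"
abbreviation "K \<equiv> genK V"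

lemma KF: "K i *v (F j *v x) = q powi (- cartan i j) *s (F j *v (K i *v x))"
proof -
  have "K i ** F j = (q powi (- cartan i j)) *k (F j ** K i)"
    using weight_rels unfolding weight_relations_def by blast
  then have "(K i ** F j) *v x = ((q powi (- cartan i j)) *k (F j ** K i)) *v x" by simp
  then show ?thesis by (simp add: mat_vec_simps)
qed

lemma EF_distinct: "i \<noteq> j \<Longrightarrow> E i *v (F j *v x) = F j *v (E i *v x)"
proof -
  assume "i \<noteq> j"
  then have "E i ** F j - F j ** E i = 0" using weight_rels by (auto simp: weight_relations_def)
  then have "(E i ** F j - F j ** E i) *v x = 0" by simp
  then show ?thesis by (simp add: mat_vec_simps)
qed

lemma EF_same:
  assumes "K i *v x = q powi a *s x"
  shows "E i *v (F i *v x) = F i *v (E i *v x) + qint q a *s x"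
proof -
  let ?J = "matrix_inv (K i)"
  have "?J *v (K i *v x) = x"
    using weight_rels by (simp add: weight_relations_def matrix_vector_mul_assoc mult_matrix_inv)
  then have "q powi (- a) *s x = (q powi (- a) * q powi a) *s (?J *v x)"
    by (metis assms mult_vec_scale vec.scale_scale)
  then have J: "?J *v x = q powi (- a) *s x" using q_nonzero by (simp add: power_int_minus)
  have "E i ** F i - F i ** E i = inverse (q - inverse q) *k (K i - ?J)"
    using weight_rels by (auto simp: weight_relations_def)
  then have "(E i ** F i - F i ** E i) *v x = (inverse (q - inverse q) *k (K i - ?J)) *v x" by simp
  then have "E i *v (F i *v x) - F i *v (E i *v x) = inverse (q - inverse q) *s (q powi a *s x - q powi (- a) *s x)"
    by (simp add: mat_vec_simps J assms)
  also have "\<dots> = qint q a *s x"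
    by (simp add: qint_def vec_eq_iff divide_inverse algebra_simps)
  finally show ?thesis by (simp add: diff_eq_eq add.commute)
qed

lemma drinfeld: "drinfeld_relations q V" "drinfeld_isomorphism q V"
  using V by (simp_all add: evaluation_adjoint_def affine_module_def)

lemma highest:
  "v \<noteq> 0" "i \<in> {1, 2} \<Longrightarrow> curXp V i n *v v = 0"
  "curPhip V 1 0 *v v = q *s v" "curPhip V 2 0 *v v = q *s v"
  "curPhip V 1 1 *v v = (q * (q - inverse q)) *s v"
  "curPhip V 2 1 *v v = (q * q ^ 3 * (q - inverse q)) *s v"
proof -
  have h: "highest_lweight_vector q (\<lambda>i. if i = 1 then [:1, - 1:] else [:1, - (q ^ 3):]) V v"
    using V by (simp add: evaluation_adjoint_def)
  then show "v \<noteq> 0" "i \<in> {1, 2} \<Longrightarrow> curXp V i n *v v = 0"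
    by (auto simp: highest_lweight_vector_def)
  have 1: "curPhip V 1 (int n) *v v = fps_nth (lweight_plus q [:1, - 1:]) n *s v"
    and 2: "curPhip V 2 (int n) *v v = fps_nth (lweight_plus q [:1, - (q ^ 3):]) n *s v" for n
    using h by (auto simp: highest_lweight_vector_def)
  show "curPhip V 1 0 *v v = q *s v" "curPhip V 2 0 *v v = q *s v"
  "curPhip V 1 1 *v v = (q * (q - inverse q)) *s v"
  "curPhip V 2 1 *v v = (q * q ^ 3 * (q - inverse q)) *s v"
    using 1 [of 0] 1 [of 1] 2 [of 0] 2 [of 1] lweight_plus_coeffs [of 1 q] lweight_plus_coeffs [of "q ^ 3" q]
      q_nonzero by simp_all
qed

lemma gens: "i \<in> {1, 2} \<Longrightarrow> E i = curXp V i 0" "i \<in> {1, 2} \<Longrightarrow> F i = curXm V i 0"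
  "i \<in> {1, 2} \<Longrightarrow> K i = curPhip V i 0"
  using drinfeld(2) by (auto simp: drinfeld_isomorphism_def)

definition b :: "nat \<Rightarrow> complex^'n" where
  "b k = [v, F 1 *v v, F 2 *v v, F 2 *v (F 1 *v v), F 1 *v (F 2 *v v),
    F 1 *v (F 2 *v (F 1 *v v)), F 2 *v (F 1 *v (F 2 *v v)),
    F 2 *v (F 1 *v (F 2 *v (F 1 *v v)))] ! k"

lemma b_rec: "b 0 = v" "b 1 = F 1 *v b 0" "b 2 = F 2 *v b 0" "b 3 = F 2 *v b 1" "b 4 = F 1 *v b 2"
  "b 5 = F 1 *v b 3" "b 6 = F 2 *v b 4" "b 7 = F 2 *v b 5"
  by (simp_all add: b_def)

lemma cartan_values: "cartan 1 1 = 2" "cartan 2 2 = 2" "cartan 1 2 = - 1" "cartan 2 1 = - 1"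
  "cartan 0 1 = - 1" "cartan 0 2 = - 1" "cartan 1 0 = - 1" "cartan 2 0 = - 1" "cartan 0 0 = 2"
  by (simp_all add: cartan_def)

lemma K_b0: "K 0 *v b 0 = q powi (- 2) *s b 0" "K 1 *v b 0 = q *s b 0" "K 2 *v b 0 = q *s b 0"
proof -
  show K: "K 1 *v b 0 = q *s b 0" "K 2 *v b 0 = q *s b 0"
    using highest gens by (simp_all add: b_rec)
  have "K 0 ** K 1 ** K 2 = mat 1" using weight_rels unfolding weight_relations_def by blast
  then have "(K 0 ** K 1 ** K 2) *v b 0 = b 0" by (simp only: matrix_vector_mul_lid)
  then have "(q * q) *s (K 0 *v b 0) = b 0" by (simp add: mat_vec_simps K)
  then have "inverse (q * q) *s b 0 = (inverse (q * q) * (q * q)) *s (K 0 *v b 0)"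
    by (metis vec.scale_scale)
  moreover have "inverse (q * q) * (q * q) = 1" "q powi (- 2) = inverse (q * q)"
    using q_nonzero by (simp_all add: power_int_minus power2_eq_square field_simps)
  ultimately show "K 0 *v b 0 = q powi (- 2) *s b 0" by (metis vec.scale_one)
qed

lemma q_powi_add: "q powi i * q powi j = q powi (i + j)"
  using q_nonzero by (simp add: power_int_add)

lemma K_lower: "K i *v x = q powi a *s x \<Longrightarrow> K i *v (F j *v x) = q powi (a - cartan i j) *s (F j *v x)"
  by (simp add: KF mat_vec_simps q_powi_add)

lemma K_b: "k < 8 \<Longrightarrow> K i *v b k = q powi wt i k *s b k"
proof -
  have 0: "K i *v b 0 = q powi wt i 0 *s b 0" for i
    using three_cases [of i] K_b0 by (auto simp: wt_def)
  have 1: "K i *v b 1 = q powi wt i 1 *s b 1" "K i *v b 2 = q powi wt i 2 *s b 2" for i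
    unfolding b_rec(2,3) using three_cases [of i] K_lower [OF 0, of i 1] K_lower [OF 0, of i 2]
    by (auto simp: wt_def cartan_def)
  have 2: "K i *v b 3 = q powi wt i 3 *s b 3" "K i *v b 4 = q powi wt i 4 *s b 4" for i
    unfolding b_rec(4,5) using three_cases [of i] K_lower [OF 1(1), of i 2] K_lower [OF 1(2), of i 1]
    by (auto simp: wt_def cartan_def)
  have 3: "K i *v b 5 = q powi wt i 5 *s b 5" "K i *v b 6 = q powi wt i 6 *s b 6" for i
    unfolding b_rec(6,7) using three_cases [of i] K_lower [OF 2(1), of i 1] K_lower [OF 2(2), of i 2]
    by (auto simp: wt_def cartan_def)
  have 4: "K i *v b 7 = q powi wt i 7 *s b 7" for i
    unfolding b_rec(8) using three_cases [of i] K_lower [OF 3(1), of i 2]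
    by (auto simp: wt_def cartan_def)
  assume "k < 8"
  then have "k \<in> {0, 1, 2, 3, 4, 5, 6, 7}" by auto
  with 0 1 2 3 4 show ?thesis by (elim insertE) simp_all
qed

text \<open>
  The vector \<open>F\<^sub>i\<^sup>2 v\<close> is singular of weight \<open>-3\<close> for the \<open>i\<close>-th subalgebra \<open>U\<^sub>q(sl\<^sub>2)\<close>.
\<close>

lemma FF_b0: assumes "i \<in> {1, 2}" shows "F i *v (F i *v b 0) = 0"
proof (rule singular_negative_weight_zero [OF q_nonzero q_generic])
  have i: "wt i 0 = 1" "cartan i i = 2" using assms by (auto simp: wt_def cartan_def)
  have K0: "K i *v b 0 = q powi 1 *s b 0" using K_b [of 0 i] i by simp
  have K1: "K i *v (F i *v b 0) = q powi (- 1) *s (F i *v b 0)" using K_lower [OF K0, of i] i by simp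
  show "E i ** F i - F i ** E i = inverse (q - inverse q) *k (K i - matrix_inv (K i))"
    using weight_rels by (auto simp: weight_relations_def)
  show "matrix_inv (K i) ** K i = mat 1"
    using weight_rels by (simp add: weight_relations_def mult_matrix_inv)
  show "K i ** F i = q powi - 2 *k (F i ** K i)"
    using weight_rels i by (auto simp: weight_relations_def)
  have "E i *v b 0 = 0" using highest assms by (auto simp: gens b_rec)
  then show "E i *v (F i *v (F i *v b 0)) = 0"
    using EF_same [OF K0] EF_same [OF K1] by (simp add: qint_values mat_vec_simps)
  show "K i *v (F i *v (F i *v b 0)) = q powi (- 3) *s (F i *v (F i *v b 0))"
    using K_lower [OF K1, of i] i by simp
qed simp_all

lemma F_serre:
  assumes "i \<in> {1, 2}" "j \<in> {1, 2}" "i \<noteq> j"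
  shows "F i *v (F i *v (F j *v x)) = two *s (F i *v (F j *v (F i *v x))) - F j *v (F i *v (F i *v x))"
proof -
  have "q_serre q (F i) (F j)"
    using V assms by (auto simp: evaluation_adjoint_def affine_module_def chevalley_relations_def)
  then have "(F i ** F i ** F j - two *k (F i ** F j ** F i) + F j ** F i ** F i) *v x = 0"
    unfolding q_serre_def two_def by (metis matrix_vector_mult_0)
  then show ?thesis by (simp add: mat_vec_simps) (simp add: vec_eq_iff algebra_simps)
qed

text \<open>
  Beyond the definitions, everything follows from \<open>F\<^sub>i\<^sup>2 v = 0\<close> and the Serre relations. For \<open>F\<^sub>i b\<^sub>7\<close> they yield
  \<open>F\<^sub>i b\<^sub>7 = [2]\<^sup>2 F\<^sub>i b\<^sub>7\<close>, hence \<open>F\<^sub>i b\<^sub>7 = 0\<close> as \<open>[2]\<^sup>2 - 1 = [3] \<noteq> 0\<close>.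
\<close>

lemma F_b:
  "F 1 *v b 0 = b 1" "F 1 *v b 1 = 0" "F 1 *v b 2 = b 4" "F 1 *v b 3 = b 5"
  "F 1 *v b 4 = two *s b 5" "F 1 *v b 5 = 0" "F 1 *v b 6 = b 7" "F 1 *v b 7 = 0"
  "F 2 *v b 0 = b 2" "F 2 *v b 1 = b 3" "F 2 *v b 2 = 0" "F 2 *v b 3 = two *s b 6"
  "F 2 *v b 4 = b 6" "F 2 *v b 5 = b 7" "F 2 *v b 6 = 0" "F 2 *v b 7 = 0"
proof -
  show r: "F 1 *v b 0 = b 1" "F 1 *v b 2 = b 4" "F 1 *v b 3 = b 5"
    "F 2 *v b 0 = b 2" "F 2 *v b 1 = b 3" "F 2 *v b 4 = b 6" "F 2 *v b 5 = b 7"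
    by (simp_all add: b_rec)
  show z: "F 1 *v b 1 = 0" "F 2 *v b 2 = 0" using FF_b0 [of 1] FF_b0 [of 2] by (simp_all add: r)
  note s12 = F_serre [of 1 2, simplified] and s21 = F_serre [of 2 1, simplified]
  show 4: "F 1 *v b 4 = two *s b 5" using s12 [of "b 0"] by (simp add: r z)
  show 3: "F 2 *v b 3 = two *s b 6" using s21 [of "b 0"] by (simp add: r z)
  show 5: "F 1 *v b 5 = 0" using s12 [of "b 1"] by (simp add: r z)
  show 6: "F 2 *v b 6 = 0" using s21 [of "b 2"] by (simp add: r z)
  have "two *s (F 1 *v b 6) = two *s b 7" using s12 [of "b 2"] by (simp add: r z 4 mat_vec_simps)
  then show 16: "F 1 *v b 6 = b 7" using two_nonzero by (simp add: vec_eq_iff)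
  have "F 1 *v b 7 = (two * two) *s (F 1 *v b 7)"
    using s12 [of "b 4"] by (simp add: r z 4 5 16 mat_vec_simps)
  then have "(two * two - 1) *s (F 1 *v b 7) = 0"
    by (simp only: vec.scale_left_diff_distrib vec.scale_one) simp
  then show "F 1 *v b 7 = 0" using three_nonzero by (simp only: vec.scale_eq_0_iff) simp
  have "F 2 *v b 7 = (two * two) *s (F 2 *v b 7)"
    using s21 [of "b 3"] by (simp add: r z 3 6 16 mat_vec_simps)
  then have "(two * two - 1) *s (F 2 *v b 7) = 0"
    by (simp only: vec.scale_left_diff_distrib vec.scale_one) simp
  then show "F 2 *v b 7 = 0" using three_nonzero by (simp only: vec.scale_eq_0_iff) simp
qed

lemma E_b:
  "E 1 *v b 0 = 0" "E 1 *v b 1 = b 0" "E 1 *v b 2 = 0" "E 1 *v b 3 = b 2"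
  "E 1 *v b 4 = two *s b 2" "E 1 *v b 5 = b 4" "E 1 *v b 6 = 0" "E 1 *v b 7 = b 6"
  "E 2 *v b 0 = 0" "E 2 *v b 1 = 0" "E 2 *v b 2 = b 0" "E 2 *v b 3 = two *s b 1"
  "E 2 *v b 4 = b 1" "E 2 *v b 5 = 0" "E 2 *v b 6 = b 3" "E 2 *v b 7 = b 5"
proof -
  have same: "E i *v (F i *v b k) = F i *v (E i *v b k) + qint q (wt i k) *s b k" if "k < 8" for i k
    using EF_same [OF K_b [OF that]] .
  have dist: "E 1 *v (F 2 *v x) = F 2 *v (E 1 *v x)" "E 2 *v (F 1 *v x) = F 1 *v (E 2 *v x)" for x
    by (simp_all add: EF_distinct)
  show 0: "E 1 *v b 0 = 0" "E 2 *v b 0 = 0" using highest by (auto simp: gens b_rec(1))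
  show 1: "E 1 *v b 1 = b 0" "E 2 *v b 1 = 0"
    using same [of 0 1] dist(2) [of "b 0"] by (simp_all add: 0 F_b wt_def qint_values)
  show 2: "E 1 *v b 2 = 0" "E 2 *v b 2 = b 0"
    using same [of 0 2] dist(1) [of "b 0"] by (simp_all add: 0 F_b wt_def qint_values)
  show 3: "E 1 *v b 3 = b 2" "E 2 *v b 3 = two *s b 1"
    using same [of 1 2] dist(1) [of "b 1"] by (simp_all add: 1 F_b wt_def qint_values)
  show 4: "E 1 *v b 4 = two *s b 2" "E 2 *v b 4 = b 1"
    using same [of 2 1] dist(2) [of "b 2"] by (simp_all add: 2 F_b wt_def qint_values)
  show 5: "E 1 *v b 5 = b 4" "E 2 *v b 5 = 0"
    using same [of 3 1] dist(2) [of "b 3"] by (simp_all add: 3 F_b wt_def qint_values mat_vec_simps)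
  show 6: "E 1 *v b 6 = 0" "E 2 *v b 6 = b 3"
    using same [of 4 2] dist(1) [of "b 4"] by (simp_all add: 4 F_b wt_def qint_values mat_vec_simps)
  show "E 2 *v b 7 = b 5" "E 1 *v b 7 = b 6"
    using same [of 5 2] same [of 6 1] by (simp_all add: 5 6 F_b wt_def qint_values)
qed

lemma b_independent:
  assumes "(\<Sum>k<8. c k *s b k) = 0" shows "\<forall>k<8. c k = 0"
proof -
  have s: "c 0 *s b 0 + c 1 *s b 1 + c 2 *s b 2 + c 3 *s b 3 + c 4 *s b 4 + c 5 *s b 5 + c 6 *s b 6 + c 7 *s b 7 = 0"
    using assms by (simp only: sum8)
  note ap = mat_vec_simps E_b
  have b0: "b 0 \<noteq> 0" using highest by (simp add: b_rec)
  \<comment> \<open>Monomials in \<open>E\<^sub>1, E\<^sub>2\<close> that take one basis vector to a multiple of \<open>v\<close> and kill the vectors above it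
    isolate the coefficients from the bottom upwards.\<close>
  have "E 2 *v (E 1 *v (E 1 *v (E 2 *v 0))) = (c 7 * two) *s b 0" unfolding s [symmetric] by (simp add: ap)
  then have c7: "c 7 = 0" using b0 two_nonzero by simp
  have "E 2 *v (E 1 *v (E 1 *v 0)) = (c 5 * two) *s b 0" unfolding s [symmetric] by (simp add: ap c7)
  then have c5: "c 5 = 0" using b0 two_nonzero by simp
  have "E 1 *v (E 2 *v (E 2 *v 0)) = (c 6 * two) *s b 0" unfolding s [symmetric] by (simp add: ap c7)
  then have c6: "c 6 = 0" using b0 two_nonzero by simp
  have "E 2 *v (E 1 *v 0) = (c 3 + c 4 * two) *s b 0"
    unfolding s [symmetric] by (simp add: ap c7 c5 c6 vec.scale_left_distrib algebra_simps)
  then have c34: "c 3 + c 4 * two = 0" by (metis b0 matrix_vector_mult_0_right vec.scale_eq_0_iff)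
  have "E 1 *v (E 2 *v 0) = (c 3 * two + c 4) *s b 0"
    unfolding s [symmetric] by (simp add: ap c7 c5 c6 vec.scale_left_distrib algebra_simps)
  then have c43: "c 3 * two + c 4 = 0" by (metis b0 matrix_vector_mult_0_right vec.scale_eq_0_iff)
  have "c 4 * (two * two - 1) = 0" using c34 c43 by algebra
  then have c4: "c 4 = 0" using three_nonzero by simp
  then have c3: "c 3 = 0" using c34 by simp
  have "E 1 *v 0 = c 1 *s b 0" unfolding s [symmetric] by (simp add: ap c7 c5 c6 c3 c4)
  then have c1: "c 1 = 0" using b0 by simp
  have "E 2 *v 0 = c 2 *s b 0" unfolding s [symmetric] by (simp add: ap c7 c5 c6 c3 c4)
  then have c2: "c 2 = 0" using b0 by simp
  have "c 0 = 0" using s b0 by (simp add: c1 c2 c3 c4 c5 c6 c7)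
  with c1 c2 c3 c4 c5 c6 c7 show ?thesis using less8 by metis
qed

definition \<beta> :: "nat \<Rightarrow> complex^'n" where
  "\<beta> = (SOME \<beta>. (\<forall>j<8. \<forall>k<8. dot (\<beta> j) (b k) = (if j = k then 1 else 0)) \<and>
    (\<forall>x. x = (\<Sum>k<8. dot (\<beta> k) x *s b k)))"

lemma \<beta>_exists: "\<exists>\<beta>. (\<forall>j<8. \<forall>k<8. dot (\<beta> j) (b k) = (if j = k then 1 else 0)) \<and>
    (\<forall>x. x = (\<Sum>k<8. dot (\<beta> k) x *s b k))"
proof (rule dual_basis_exists [of b])
  show "\<forall>k<CARD('n). c k = 0" if "(\<Sum>k<CARD('n). c k *s b k) = 0" for c
    using b_independent that unfolding dim by blast
next
  fix \<beta> :: "nat \<Rightarrow> complex^'n"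
  assume "\<And>j k. j < CARD('n) \<Longrightarrow> k < CARD('n) \<Longrightarrow> dot (\<beta> j) (b k) = (if j = k then 1 else 0)"
    and "\<And>x. x = (\<Sum>k<CARD('n). dot (\<beta> k) x *s b k)"
  then show ?thesis unfolding dim by (intro exI [of _ \<beta>]) blast
qed

lemma \<beta>_properties: "(\<forall>j<8. \<forall>k<8. dot (\<beta> j) (b k) = (if j = k then 1 else 0)) \<and>
    (\<forall>x. x = (\<Sum>k<8. dot (\<beta> k) x *s b k))"
  using \<beta>_exists unfolding \<beta>_def by (rule someI_ex)

lemma \<beta>_b: "j < 8 \<Longrightarrow> k < 8 \<Longrightarrow> dot (\<beta> j) (b k) = (if j = k then 1 else 0)"
  using \<beta>_properties by blast

lemma expand: "x = (\<Sum>k<8. dot (\<beta> k) x *s b k)"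
  using \<beta>_properties by blast

lemma \<beta>_K: assumes "k < 8" shows "dot (\<beta> k) (K i *v x) = q powi wt i k * dot (\<beta> k) x"
proof -
  have "K i *v x = (\<Sum>j<8. dot (\<beta> j) x *s (K i *v b j))"
    by (subst expand [of x]) (simp only: mult_vec_sum mult_vec_scale)
  also have "\<dots> = (\<Sum>j<8. dot (\<beta> j) x *s (q powi wt i j *s b j))"
    by (rule sum.cong) (simp_all add: K_b)
  finally have "dot (\<beta> k) (K i *v x) = (\<Sum>j<8. dot (\<beta> j) x * (q powi wt i j * dot (\<beta> k) (b j)))"
    by (simp only: dot_sum dot_linear)
  also have "\<dots> = (\<Sum>j<8. if j = k then q powi wt i k * dot (\<beta> k) x else 0)"
    by (rule sum.cong) (use assms in \<open>auto simp: \<beta>_b\<close>)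
  finally show ?thesis using assms by simp
qed

lemma weight_components:
  assumes "K 1 *v x = q powi a1 *s x" "K 2 *v x = q powi a2 *s x" "k < 8" "wt 1 k \<noteq> a1 \<or> wt 2 k \<noteq> a2"
  shows "dot (\<beta> k) x = 0"
proof (rule ccontr)
  assume nz: "dot (\<beta> k) x \<noteq> 0"
  have "q powi a1 = q powi wt 1 k" "q powi a2 = q powi wt 2 k"
    using \<beta>_K [OF assms(3), of 1 x] \<beta>_K [OF assms(3), of 2 x] nz by (simp_all add: assms dot_linear)
  then show False using assms(4) generic_powi_inject [OF q_nonzero q_generic] by metis
qed

lemma expand8: "x = dot (\<beta> 0) x *s b 0 + dot (\<beta> 1) x *s b 1 + dot (\<beta> 2) x *s b 2 + dot (\<beta> 3) x *s b 3
  + dot (\<beta> 4) x *s b 4 + dot (\<beta> 5) x *s b 5 + dot (\<beta> 6) x *s b 6 + dot (\<beta> 7) x *s b 7"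
  by (subst expand) (simp only: sum8)

lemma KX:
  assumes "i \<in> {1, 2}" "j \<in> {1, 2}"
  shows "K i *v (curXm V j n *v x) = q powi (- cartan i j) *s (curXm V j n *v (K i *v x))"
proof -
  have "half_current_relations (inverse q) (curXm V) (curPhip V) (curPhim V)"
    using drinfeld(1) unfolding drinfeld_relations_def by (elim conjE)
  moreover have 0: "curPhip V i (- 1) = 0"
    using drinfeld(1) [unfolded drinfeld_relations_def, THEN conjunct1] assms by auto
  ultimately have "curPhip V i (- 1 + 1) ** curXm V j n - (inverse q powi cartan i j) *k (curPhip V i (- 1) ** curXm V j (n + 1)) =
        (inverse q powi cartan i j) *k (curXm V j n ** curPhip V i (- 1 + 1)) - curXm V j (n + 1) ** curPhip V i (- 1)"
    using assms unfolding half_current_relations_def by blast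
  then have "K i ** curXm V j n = (q powi (- cartan i j)) *k (curXm V j n ** K i)"
    by (simp add: 0 gens(3) [OF assms(1)] power_int_inverse power_int_minus)
  then have "(K i ** curXm V j n) *v x = ((q powi (- cartan i j)) *k (curXm V j n ** K i)) *v x" by simp
  then show ?thesis by (simp add: mat_vec_simps)
qed

lemma EX:
  assumes "i \<in> {1, 2}" "j \<in> {1, 2}"
  shows "E i *v (curXm V j 1 *v x) = curXm V j 1 *v (E i *v x) +
    (if i = j then inverse (q - inverse q) *s (curPhip V i 1 *v x) else 0)"
proof -
  have "\<forall>i \<in> {1, 2}. \<forall>j \<in> {1, 2}. \<forall>m n. qcomm 1 (curXp V i m) (curXm V j n) =
    (if i = j then inverse (q - inverse q) *k (curPhip V i (m + n) - curPhim V i (m + n)) else 0)"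
    using drinfeld(1) unfolding drinfeld_relations_def by (elim conjE)
  then have "qcomm 1 (curXp V i 0) (curXm V j 1) =
    (if i = j then inverse (q - inverse q) *k (curPhip V i (0 + 1) - curPhim V i (0 + 1)) else 0)"
    using assms by blast
  moreover have "curPhim V i 1 = 0"
    using drinfeld(1) [unfolded drinfeld_relations_def, THEN conjunct1] assms by auto
  ultimately have "E i ** curXm V j 1 - curXm V j 1 ** E i =
    (if i = j then inverse (q - inverse q) *k curPhip V i 1 else 0)"
    unfolding gens(1) [OF assms(1)] by (cases "i = j") (simp_all add: qcomm_def)
  then have "(E i ** curXm V j 1 - curXm V j 1 ** E i) *v x =
    (if i = j then inverse (q - inverse q) *k curPhip V i 1 else 0) *v x" by simp
  then show ?thesis by (auto simp: mat_vec_simps diff_eq_eq add.commute)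
qed

lemma Phi_b0: "curPhip V 1 1 *v b 0 = (q * (q - inverse q)) *s b 0"
  "curPhip V 2 1 *v b 0 = (q ^ 4 * (q - inverse q)) *s b 0"
  using highest(5,6) by (simp_all add: b_rec(1) power_numeral_reduce)

lemma cancel_q2: "inverse (q - inverse q) * (c * (q - inverse q)) = c"
  "inverse (q - inverse q) * ((q - inverse q) * c) = c" "inverse q * inverse q * (q * q) = 1"
  using q2 q_nonzero by (simp_all add: mult.left_commute mult.assoc)

text \<open>
  The vectors \<open>X\<^sup>-\<^bsub>j,1\<^esub> v\<close> and \<open>X\<^sup>-\<^bsub>1,1\<^esub> F\<^sub>2 v\<close> are known up to coefficients by their weights. The coefficients are found
  by applying \<open>E\<^sub>1\<close> and \<open>E\<^sub>2\<close>, whose commutators with \<open>X\<^sup>-\<^bsub>j,1\<^esub>\<close> are given by \<open>\<Phi>\<^sup>+\<^bsub>j,1\<^esub>\<close>.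
\<close>

lemma X11_b0: "curXm V 1 1 *v b 0 = q *s b 1"
proof -
  let ?x = "curXm V 1 1 *v b 0"
  have K: "K 1 *v ?x = q powi (- 1) *s ?x" "K 2 *v ?x = q powi 2 *s ?x"
    using q_nonzero by (simp_all add: KX K_b0 mat_vec_simps cartan_values power_int_minus power2_eq_square)
  have x: "?x = dot (\<beta> 1) ?x *s b 1"
    by (subst (1) expand8 [of ?x]) (simp add: weight_components [OF K] wt_def)
  have "E 1 *v ?x = q *s b 0"
    by (simp add: EX E_b Phi_b0 cancel_q2)
  moreover have "E 1 *v ?x = dot (\<beta> 1) ?x *s b 0" by (subst x) (simp add: mat_vec_simps E_b)
  ultimately have "dot (\<beta> 1) ?x = q" using highest(1) by (simp add: b_rec(1))
  with x show ?thesis by simp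
qed

lemma X21_b0: "curXm V 2 1 *v b 0 = q ^ 4 *s b 2"
proof -
  let ?x = "curXm V 2 1 *v b 0"
  have K: "K 1 *v ?x = q powi 2 *s ?x" "K 2 *v ?x = q powi (- 1) *s ?x"
    using q_nonzero by (simp_all add: KX K_b0 mat_vec_simps cartan_values power_int_minus power2_eq_square)
  have x: "?x = dot (\<beta> 2) ?x *s b 2"
    by (subst (1) expand8 [of ?x]) (simp add: weight_components [OF K] wt_def)
  have "E 2 *v ?x = q ^ 4 *s b 0"
    by (simp add: EX E_b Phi_b0 cancel_q2)
  moreover have "E 2 *v ?x = dot (\<beta> 2) ?x *s b 0" by (subst x) (simp add: mat_vec_simps E_b)
  ultimately have "dot (\<beta> 2) ?x = q ^ 4" using highest(1) by (simp add: b_rec(1))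
  with x show ?thesis by simp
qed

lemma Phi11_b2: "curPhip V 1 1 *v b 2 = ((q - inverse q) * (q ^ 6 + q ^ 2)) *s b 2"
proof -
  have "half_current_relations (inverse q) (curXm V) (curPhip V) (curPhim V)"
    using drinfeld(1) unfolding drinfeld_relations_def by (elim conjE)
  then have "curPhip V 1 (0 + 1) ** curXm V 2 0 - (inverse q powi cartan 1 2) *k (curPhip V 1 0 ** curXm V 2 (0 + 1)) =
        (inverse q powi cartan 1 2) *k (curXm V 2 0 ** curPhip V 1 (0 + 1)) - curXm V 2 (0 + 1) ** curPhip V 1 0"
    unfolding half_current_relations_def by blast
  then have "(curPhip V 1 1 ** F 2 - q *k (K 1 ** curXm V 2 1)) *v b 0 =
      (q *k (F 2 ** curPhip V 1 1) - curXm V 2 1 ** K 1) *v b 0"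
    by (simp add: gens cartan_values power_int_minus)
  then have "curPhip V 1 1 *v b 2 - q *s (q ^ 4 *s (q ^ 2 *s b 2)) =
    q *s ((q * (q - inverse q)) *s b 2) - q *s (q ^ 4 *s b 2)"
    using K_b [of 2 1] by (simp add: mat_vec_simps K_b0 X21_b0 F_b wt_def Phi_b0)
  then have "curPhip V 1 1 *v b 2 = q *s (q ^ 4 *s (q ^ 2 *s b 2)) + q *s ((q * (q - inverse q)) *s b 2) - q *s (q ^ 4 *s b 2)"
    by (simp add: algebra_simps)
  also have "\<dots> = (q * q ^ 4 * q ^ 2 + q * (q * (q - inverse q)) - q * q ^ 4) *s b 2"
    by (simp add: vec.scale_left_distrib vec.scale_left_diff_distrib mult.assoc)
  also have "q * q ^ 4 * q ^ 2 + q * (q * (q - inverse q)) - q * q ^ 4 = (q - inverse q) * (q ^ 6 + q ^ 2)"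
    using q_nonzero by (simp add: field_simps power_numeral_reduce)
  finally show ?thesis .
qed

lemma X11_b2: "curXm V 1 1 *v b 2 = (q ^ 2 - q ^ 4) *s b 3 + q ^ 5 *s b 4"
proof -
  let ?x = "curXm V 1 1 *v b 2" let ?a = "dot (\<beta> 3) ?x" let ?c = "dot (\<beta> 4) ?x"
  have K: "K 1 *v ?x = q powi 0 *s ?x" "K 2 *v ?x = q powi 0 *s ?x"
    using q_nonzero K_b [of 2 1] K_b [of 2 2]
    by (simp_all add: KX mat_vec_simps cartan_values wt_def power_int_minus power2_eq_square cancel_q2)
  have x: "?x = ?a *s b 3 + ?c *s b 4"
    by (subst (1) expand8 [of ?x]) (simp add: weight_components [OF K] wt_def)
  have nz: "b 1 \<noteq> 0" "b 2 \<noteq> 0"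
    using E_b(2,11) highest(1) by (auto simp: b_rec(1))
  have "E 1 *v ?x = (q ^ 6 + q ^ 2) *s b 2" "E 2 *v ?x = q *s b 1"
    by (simp_all add: EX E_b Phi11_b2 X11_b0 cancel_q2)
  moreover have "E 1 *v ?x = (?a + ?c * two) *s b 2" "E 2 *v ?x = (?a * two + ?c) *s b 1"
    by (subst x, simp add: mat_vec_simps E_b vec.scale_left_distrib)+
  ultimately have 1: "?a + ?c * two = q ^ 6 + q ^ 2" "?a * two + ?c = q"
    by (metis nz(2) vec.scale_cancel_right, metis nz(1) vec.scale_cancel_right)
  have "?c * (two * two - 1) = q ^ 5 * (two * two - 1)"
  proof -
    have "?c * (two * two - 1) = (q ^ 6 + q ^ 2) * two - q" using 1 by algebra
    also have "\<dots> = q ^ 5 * (two * two - 1)" using q_nonzero by (simp add: two_def field_simps power_numeral_reduce)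
    finally show ?thesis .
  qed
  then have c: "?c = q ^ 5" using three_nonzero by simp
  have "?a = q ^ 6 + q ^ 2 - q ^ 5 * two" using 1(1) c by (simp add: algebra_simps)
  also have "\<dots> = q ^ 2 - q ^ 4" using q_nonzero by (simp add: two_def field_simps power_numeral_reduce)
  finally show ?thesis using x c by simp
qed

lemma E0_b0: "E 0 *v b 0 = q *s b 3 - q ^ 2 *s b 4"
proof -
  have "E 0 = qcomm (inverse q) (curXm V 2 0) (curXm V 1 1) ** K 0"
    using drinfeld(2) by (simp add: drinfeld_isomorphism_def)
  then have "E 0 *v b 0 = q powi (- 2) *s (F 2 *v (curXm V 1 1 *v b 0) - inverse q *s (curXm V 1 1 *v (F 2 *v b 0)))"
    by (simp add: qcomm_def mat_vec_simps K_b0 gens)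
  also have "\<dots> = q powi (- 2) *s (q *s b 3 - inverse q *s ((q ^ 2 - q ^ 4) *s b 3 + q ^ 5 *s b 4))"
    by (simp add: F_b X11_b0 X11_b2 mat_vec_simps)
  also have "\<dots> = q *s b 3 - q ^ 2 *s b 4"
    using q_nonzero by (simp add: vec_eq_iff power_int_minus field_simps power_numeral_reduce)
  finally show ?thesis .
qed

text \<open>
  \<open>E\<^sub>0\<close> commutes with \<open>F\<^sub>1\<close> and \<open>F\<^sub>2\<close>, so \<open>E\<^sub>0 v\<close> determines it.
\<close>

lemma E0_b:
  "E 0 *v b 1 = (- (q ^ 3)) *s b 5" "E 0 *v b 2 = b 6" "E 0 *v b 3 = (- (q ^ 3)) *s b 7" "E 0 *v b 4 = b 7"
  "E 0 *v b 5 = 0" "E 0 *v b 6 = 0" "E 0 *v b 7 = 0"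
proof -
  have dist: "E 0 *v (F 1 *v x) = F 1 *v (E 0 *v x)" "E 0 *v (F 2 *v x) = F 2 *v (E 0 *v x)" for x
    by (simp_all add: EF_distinct)
  show 1: "E 0 *v b 1 = (- (q ^ 3)) *s b 5"
    using dist(1) [of "b 0"] q_nonzero
    by (simp add: E0_b0 mat_vec_simps F_b two_def) (simp add: vec_eq_iff field_simps power_numeral_reduce)
  show 2: "E 0 *v b 2 = b 6"
    using dist(2) [of "b 0"] q_nonzero
    by (simp add: E0_b0 mat_vec_simps F_b two_def) (simp add: vec_eq_iff field_simps power_numeral_reduce)
  show 3: "E 0 *v b 3 = (- (q ^ 3)) *s b 7" using dist(2) [of "b 1"] by (simp add: 1 mat_vec_simps F_b)
  show 4: "E 0 *v b 4 = b 7" using dist(1) [of "b 2"] by (simp add: 2 mat_vec_simps F_b)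
  show 5: "E 0 *v b 5 = 0" using dist(1) [of "b 3"] by (simp add: 3 mat_vec_simps F_b)
  show "E 0 *v b 6 = 0" using dist(2) [of "b 4"] by (simp add: 4 mat_vec_simps F_b)
  show "E 0 *v b 7 = 0" using dist(2) [of "b 5"] by (simp add: 5 mat_vec_simps F_b)
qed

lemma E_table: "k < 8 \<Longrightarrow> E i *v b k = (\<Sum>(m, d) \<leftarrow> E_table q i k. d *s b m)"
  using less8 [of k] three_cases [of i]
  by (auto simp: E_table_def E_b E0_b0 E0_b two_def)

lemma F_table: "i \<in> {1, 2} \<Longrightarrow> k < 8 \<Longrightarrow> F i *v b k = (\<Sum>(m, d) \<leftarrow> F_table q i k. d *s b m)"
  using less8 [of k]
  by (auto simp: F_table_def F_b two_def)

end

section \<open>Tensor products\<close>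

text \<open>
  \<open>S i\<close> is the operator \<open>K\<^sub>i\<^bsup>1/2\<^esup>\<close> and behaves like the square root of \<open>K\<^sub>i\<close> in the commutation relations.
\<close>

definition half_cartan ::
  "complex \<Rightarrow> complex \<Rightarrow> ('n::finite, 'x) chevalley_scheme \<Rightarrow> (3 \<Rightarrow> complex^'n^'n) \<Rightarrow> bool" where
  "half_cartan q s M S \<longleftrightarrow>
     (\<forall>i. half_K s M i = S i \<and> invertible (S i) \<and> S i ** S i = genK M i) \<and>
     (\<forall>i j. S i ** S j = S j ** S i) \<and>
     (\<forall>i j. S i ** genE M j = (s powi cartan i j) *k (genE M j ** S i)) \<and>
     (\<forall>i j. S i ** genF M j = (s powi (- cartan i j)) *k (genF M j ** S i))"

lemma inverse_commute:
  assumes "invertible (S :: complex^'n^'n)" "S ** A = c *k (A ** S)"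
  shows "A ** matrix_inv S = c *k (matrix_inv S ** A)"
proof -
  have "A ** matrix_inv S = matrix_inv S ** (S ** A) ** matrix_inv S"
    using mult_matrix_inv [OF assms(1)] by (simp add: matrix_mul_assoc)
  also have "\<dots> = c *k (matrix_inv S ** A ** (S ** matrix_inv S))"
    by (simp add: assms(2) mat_scale_mult_left mat_scale_mult_right matrix_mul_assoc)
  finally show ?thesis using mult_matrix_inv [OF assms(1)] by simp
qed

lemma matrix_add_rdistrib: "((B + C) :: complex^'l^'n) ** A = B ** A + C ** A"
  by (simp add: matrix_matrix_mult_def vec_eq_iff algebra_simps sum.distrib)

lemma cartan_sym: "cartan i j = cartan j i"
  by (simp add: cartan_def)

text \<open>
  The mixed terms of the commutator of \<open>\<Delta> E\<^sub>i\<close> and \<open>\<Delta> F\<^sub>j\<close> cancel, since the scalars from moving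
  \<open>K\<^sup>1\<^sup>/\<^sup>2\<close> past \<open>E\<close> and past \<open>F\<close> are inverse to each other.
\<close>

lemma tensor_weight_relations:
  assumes s: "s \<noteq> 0" and M: "weight_relations q M" "half_cartan q s M S"
    and N: "weight_relations q N" "half_cartan q s N S'"
  shows "weight_relations q (tensor_module s M N)"
proof -
  let ?T = "tensor_module s M N"
  let ?J = "\<lambda>i. matrix_inv (S i)"
  note M1 = M(1) [unfolded weight_relations_def] and N1 = N(1) [unfolded weight_relations_def]
  have S: "half_K s M i = S i" "invertible (S i)" "S i ** S i = genK M i"
      "S i ** genE M j = (s powi cartan i j) *k (genE M j ** S i)"
      "S i ** genF M j = (s powi (- cartan i j)) *k (genF M j ** S i)"
      "S i ** S j = S j ** S i" for i j
    using M(2) unfolding half_cartan_def by blast+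
  have S': "half_K s N i = S' i" "invertible (S' i)" "S' i ** S' i = genK N i"
      "S' i ** genE N j = (s powi cartan i j) *k (genE N j ** S' i)"
      "S' i ** genF N j = (s powi (- cartan i j)) *k (genF N j ** S' i)"
      "S' i ** S' j = S' j ** S' i" for i j
    using N(2) unfolding half_cartan_def by blast+
  have ss: "s powi a * s powi b = s powi (a + b)" for a b using s by (simp add: power_int_add)
  have K: "genK ?T i = kron (genK M i) (genK N i)"
    and E: "genE ?T i = kron (genE M i) (S' i) + kron (?J i) (genE N i)"
    and F: "genF ?T i = kron (genF M i) (S' i) + kron (?J i) (genF N i)" for i
    by (simp_all add: tensor_module_def S S')
  have KS: "genK M i ** ?J j = ?J j ** genK M i" "genK N i ** S' j = S' j ** genK N i" for i j
  proof -
    have "S j ** genK M i = 1 *k (genK M i ** S j)"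
      using S(3,6) by (metis mat_scale_one matrix_mul_assoc)
    from inverse_commute [OF S(2) this] show "genK M i ** ?J j = ?J j ** genK M i" by simp
    show "genK N i ** S' j = S' j ** genK N i" using S'(3,6) by (metis matrix_mul_assoc)
  qed
  have inv: "matrix_inv (genK ?T i) = kron (matrix_inv (genK M i)) (matrix_inv (genK N i))" for i
    using M1 N1 by (intro matrix_inv_eqI) (simp add: K kron_mult_kron mult_matrix_inv kron_mat_1)
  have invertible: "invertible (genK ?T i)" for i
    unfolding invertible_def
    using M1 N1 by (intro exI [of _ "kron (matrix_inv (genK M i)) (matrix_inv (genK N i))"])
      (simp add: K kron_mult_kron mult_matrix_inv kron_mat_1)
  have JJ: "?J i ** ?J i = matrix_inv (genK M i)" for i
  proof -
    have "genK M i ** (?J i ** ?J i) = S i ** (S i ** ?J i) ** ?J i"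
      by (simp add: S(3) [symmetric] matrix_mul_assoc)
    also have "\<dots> = mat 1" using mult_matrix_inv [OF S(2)] by simp
    finally show ?thesis by (metis matrix_inv_eqI)
  qed
  have EF: "genE ?T i ** genF ?T j - genF ?T j ** genE ?T i =
    (if i = j then inverse (q - inverse q) *k (genK ?T i - matrix_inv (genK ?T i)) else 0)" for i j
  proof -
    have J: "genE M i ** ?J j = (s powi cartan j i) *k (?J j ** genE M i)"
      "genF M j ** ?J i = (s powi (- cartan i j)) *k (?J i ** genF M j)"
      using inverse_commute [OF S(2) S(4)] inverse_commute [OF S(2) S(5)] by blast+
    have mixed: "kron (genE M i ** ?J j) (S' i ** genF N j) = kron (?J j ** genE M i) (genF N j ** S' i)"
      unfolding J S'(5) by (simp add: kron_scale mat_scale_scale ss cartan_sym [of j i])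
    have mixed': "kron (genF M j ** ?J i) (S' j ** genE N i) = kron (?J i ** genF M j) (genE N i ** S' j)"
      unfolding J S'(4) by (simp add: kron_scale mat_scale_scale ss cartan_sym [of j i])
    have JJ': "?J j ** ?J i = ?J i ** ?J j"
    proof -
      have "?J i ** S j = 1 *k (S j ** ?J i)"
        using inverse_commute [OF S(2), of i "S j" 1] S(6) by simp
      then have "S j ** ?J i = 1 *k (?J i ** S j)" by simp
      from inverse_commute [OF S(2) this] show ?thesis by simp
    qed
    have "genE ?T i ** genF ?T j - genF ?T j ** genE ?T i =
      kron (genE M i ** genF M j) (S' i ** S' j) - kron (genF M j ** genE M i) (S' j ** S' i)
      + (kron (?J i ** ?J j) (genE N i ** genF N j) - kron (?J j ** ?J i) (genF N j ** genE N i))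
      + (kron (genE M i ** ?J j) (S' i ** genF N j) - kron (?J j ** genE M i) (genF N j ** S' i))
      + (kron (?J i ** genF M j) (genE N i ** S' j) - kron (genF M j ** ?J i) (S' j ** genE N i))"
      unfolding E F by (simp add: matrix_add_ldistrib matrix_add_rdistrib kron_mult_kron)
    also have "\<dots> = kron (genE M i ** genF M j - genF M j ** genE M i) (S' i ** S' j)
      + kron (?J i ** ?J j) (genE N i ** genF N j - genF N j ** genE N i)"
      unfolding mixed mixed' by (simp add: kron_diff JJ' S'(6) [of j i])
    also have "\<dots> = (if i = j then inverse (q - inverse q) *k (genK ?T i - matrix_inv (genK ?T i)) else 0)"
    proof (cases "i = j")
      case True
      have e: "genE M i ** genF M j - genF M j ** genE M i = inverse (q - inverse q) *k (genK M i - matrix_inv (genK M i))"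
        "genE N i ** genF N j - genF N j ** genE N i = inverse (q - inverse q) *k (genK N i - matrix_inv (genK N i))"
        using True M1 N1 by simp_all
      show ?thesis unfolding e unfolding True inv unfolding K
        by (simp add: S'(3) JJ kron_scale kron_diff mat_scale_diff)
    qed (use M1 N1 in simp)
    finally show ?thesis .
  qed
  have KE: "genK ?T i ** genE ?T j = (q powi cartan i j) *k (genE ?T j ** genK ?T i)" for i j
  proof -
    have "genK M i ** genE M j = (q powi cartan i j) *k (genE M j ** genK M i)"
      "genK N i ** genE N j = (q powi cartan i j) *k (genE N j ** genK N i)"
      using M1 N1 by blast+
    then show ?thesis
      by (simp add: E K matrix_add_ldistrib matrix_add_rdistrib kron_mult_kron KS kron_scale mat_scale_add)
  qed
  have KF: "genK ?T i ** genF ?T j = (q powi (- cartan i j)) *k (genF ?T j ** genK ?T i)" for i j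
  proof -
    have "genK M i ** genF M j = (q powi (- cartan i j)) *k (genF M j ** genK M i)"
      "genK N i ** genF N j = (q powi (- cartan i j)) *k (genF N j ** genK N i)"
      using M1 N1 by blast+
    then show ?thesis
      by (simp add: F K matrix_add_ldistrib matrix_add_rdistrib kron_mult_kron KS kron_scale mat_scale_add)
  qed
  have KK: "genK ?T i ** genK ?T j = genK ?T j ** genK ?T i" for i j
  proof -
    have "genK M i ** genK M j = genK M j ** genK M i" "genK N i ** genK N j = genK N j ** genK N i"
      using M1 N1 by blast+
    then show ?thesis by (simp add: K kron_mult_kron)
  qed
  have "genK M 0 ** genK M 1 ** genK M 2 = mat 1" "genK N 0 ** genK N 1 ** genK N 2 = mat 1"
    using M1 N1 by blast+
  then have K012: "genK ?T 0 ** genK ?T 1 ** genK ?T 2 = mat 1"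
    by (simp add: K kron_mult_kron kron_mat_1)
  show ?thesis
    unfolding weight_relations_def using invertible KK K012 KE KF EF by blast
qed

lemma shift_weight_relations:
  assumes "weight_relations q V" "z \<noteq> 0"
  shows "weight_relations q (shift_module z V)"
proof -
  note V = assms(1) [unfolded weight_relations_def]
  have E: "genE (shift_module z V) i = (if i = 0 then z else 1) *k genE V i"
    and F: "genF (shift_module z V) i = inverse (if i = 0 then z else 1) *k genF V i"
    and K: "genK (shift_module z V) = genK V" for i
    by (simp_all add: shift_module_def)
  define c where "c i = (if i = (0::3) then z else 1)" for i
  have c: "c i \<noteq> 0" for i using assms(2) by (simp add: c_def)
  show ?thesis
    unfolding weight_relations_def K E F c_def [symmetric]
  proof (intro conjI allI)
    fix i j
    have "genK V i ** genE V j = (q powi cartan i j) *k (genE V j ** genK V i)" using V by blast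
    then show "genK V i ** (c j *k genE V j) = q powi cartan i j *k (c j *k genE V j ** genK V i)"
      by (simp add: mat_scale_mult_left mat_scale_mult_right mat_scale_scale mult.commute)
    have "genK V i ** genF V j = (q powi (- cartan i j)) *k (genF V j ** genK V i)" using V by blast
    then show "genK V i ** (inverse (c j) *k genF V j) = q powi - cartan i j *k (inverse (c j) *k genF V j ** genK V i)"
      by (simp add: mat_scale_mult_left mat_scale_mult_right mat_scale_scale mult.commute)
    have "genE V i ** genF V j - genF V j ** genE V i =
      (if i = j then inverse (q - inverse q) *k (genK V i - matrix_inv (genK V i)) else 0)" using V by blast
    then have "(c i * inverse (c j)) *k (genE V i ** genF V j - genF V j ** genE V i) =
      (if i = j then inverse (q - inverse q) *k (genK V i - matrix_inv (genK V i)) else 0)"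
      using c by auto
    then show "c i *k genE V i ** (inverse (c j) *k genF V j) - inverse (c j) *k genF V j ** (c i *k genE V i) =
      (if i = j then inverse (q - inverse q) *k (genK V i - matrix_inv (genK V i)) else 0)"
      by (simp add: mat_scale_mult_left mat_scale_mult_right mat_scale_scale mat_scale_diff mult.commute)
  qed (use V in blast)+
qed

text \<open>
  The weight of \<open>b\<^sub>k\<close> is \<open>root_coord 1 k \<alpha>\<^sub>1 + root_coord 2 k \<alpha>\<^sub>2\<close>, and \<open>root_pairing\<close> is the invariant inner
  product of two such weights.
\<close>

definition root_coord :: "3 \<Rightarrow> nat \<Rightarrow> int" where
  "root_coord i k = (if i = 1 then [1, 0, 1, 0, 0, -1, 0, -1] ! k else [1, 1, 0, 0, 0, 0, -1, -1] ! k)"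

definition root_pairing :: "nat \<Rightarrow> nat \<Rightarrow> int" where
  "root_pairing m n = wt 1 m * root_coord 1 n + wt 2 m * root_coord 2 n"

lemma root_pairing_sym: assumes "m < 8" "n < 8" shows "root_pairing m n = root_pairing n m"
  using less8 [OF assms(1)] less8 [OF assms(2)]
  by (elim disjE) (simp_all add: root_pairing_def root_coord_def wt_def)

lemma wt_0: assumes "n < 8" shows "wt 0 n = - wt 1 n - wt 2 n"
  using less8 [OF assms] by (elim disjE) (simp_all add: wt_def)

lemma E_table_weights:
  assumes "k < 8" "(m, d) \<in> set (E_table q i k)"
  shows "m < 8" "n < 8 \<Longrightarrow> root_pairing n m = root_pairing n k + wt i n"
proof -
  have *: "m < 8 \<and> root_coord 1 m = root_coord 1 k + (if i = 1 then 1 else if i = 0 then -1 else 0) \<and>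
    root_coord 2 m = root_coord 2 k + (if i = 2 then 1 else if i = 0 then -1 else 0)"
    using less8 [OF assms(1)] three_cases [of i] assms(2)
    by (elim disjE) (auto simp: E_table_def root_coord_def)
  then show "m < 8" by blast
  show "root_pairing n m = root_pairing n k + wt i n" if "n < 8"
    using * three_cases [of i] wt_0 [OF that] by (auto simp: root_pairing_def algebra_simps)
qed

lemma F_table_weights:
  assumes "k < 8" "i \<in> {1, 2}" "(m, d) \<in> set (F_table q i k)"
  shows "m < 8" "n < 8 \<Longrightarrow> root_pairing n m = root_pairing n k - wt i n"
proof -
  have *: "m < 8 \<and> root_coord 1 k = root_coord 1 m + (if i = 1 then 1 else 0) \<and>
    root_coord 2 k = root_coord 2 m + (if i = 2 then 1 else 0)"
    using less8 [OF assms(1)] assms(2,3)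
    by (elim disjE insertE) (auto simp: F_table_def root_coord_def)
  then show "m < 8" by blast
  show "root_pairing n m = root_pairing n k - wt i n" if "n < 8"
    using * assms(2) by (auto simp: root_pairing_def algebra_simps)
qed

text \<open>
  Vectors of \<open>V \<otimes> V\<close> are written as lists of triples: \<open>(m, n, c)\<close> is the term \<open>c t m n\<close>, where \<open>t m n\<close> is the
  rescaled basis introduced below. Terms may repeat; \<open>coef\<close> collects them. Operators
  \<open>X \<otimes> K\<close> and \<open>K \<otimes> X\<close> act on such lists by \<open>lift_left\<close> and \<open>lift_right\<close>, from the table \<open>T\<close> of \<open>X\<close> and the
  eigenvalues \<open>w\<close> of \<open>K\<close>, so that identities between vectors are checked by rewriting.
\<close>

type_synonym terms = "(nat \<times> nat \<times> complex) list"

definition lift_left :: "(nat \<Rightarrow> (nat \<times> complex) list) \<Rightarrow> (nat \<Rightarrow> complex) \<Rightarrow> terms \<Rightarrow> terms" where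
  "lift_left T w xs = concat (map (\<lambda>(m, n, c). map (\<lambda>(m', d). (m', n, c * d * w n)) (T m)) xs)"

definition lift_right :: "(nat \<Rightarrow> (nat \<times> complex) list) \<Rightarrow> (nat \<Rightarrow> complex) \<Rightarrow> terms \<Rightarrow> terms" where
  "lift_right T w xs = concat (map (\<lambda>(m, n, c). map (\<lambda>(n', d). (m, n', c * d * w m)) (T n)) xs)"

definition coef :: "terms \<Rightarrow> nat \<Rightarrow> nat \<Rightarrow> complex" where
  "coef xs m n = (\<Sum>(m', n', c) \<leftarrow> xs. if m' = m \<and> n' = n then c else 0)"

definition valid :: "terms \<Rightarrow> bool" where
  "valid xs \<longleftrightarrow> (\<forall>x \<in> set xs. fst x < 8 \<and> fst (snd x) < 8)"

lemma coef_simps [simp]: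
  "coef [] m n = 0"
  "coef ((m', n', c) # xs) m n = (if m' = m \<and> n' = n then c + coef xs m n else coef xs m n)"
  "coef (xs @ ys) m n = coef xs m n + coef ys m n"
  by (simp_all add: coef_def)

lemma valid_simps [simp]:
  "valid []" "valid ((m, n, c) # xs) \<longleftrightarrow> m < 8 \<and> n < 8 \<and> valid xs"
  "valid (xs @ ys) \<longleftrightarrow> valid xs \<and> valid ys"
  by (auto simp: valid_def)

lemma lift_simps [simp]:
  "lift_left T w [] = []"
  "lift_left T w ((m, n, c) # xs) = map (\<lambda>(m', d). (m', n, c * d * w n)) (T m) @ lift_left T w xs"
  "lift_right T w [] = []"
  "lift_right T w ((m, n, c) # xs) = map (\<lambda>(n', d). (m, n', c * d * w m)) (T n) @ lift_right T w xs"
  by (simp_all add: lift_left_def lift_right_def)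

locale adjoint_square = adjoint_module q V v
  for q :: complex and V :: "'n::finite affine_rep" and v :: "complex^'n" +
  fixes s :: complex
  assumes s_sqrt: "s\<^sup>2 = q"
begin

lemma s_nonzero: "s \<noteq> 0"
  using s_sqrt q_nonzero by auto

lemma s_powi_add: "s powi i * s powi j = s powi (i + j)"
  using s_nonzero by (simp add: power_int_add)

lemma s_powi_double: "s powi (2 * i) = q powi i"
  by (simp add: power_int_mult flip: s_sqrt)

definition diagonal :: "(nat \<Rightarrow> complex) \<Rightarrow> complex^'n^'n" where
  "diagonal f = (\<chi> (r :: 'n) (c :: 'n). \<Sum>k<8. f k * \<beta> k $ c * b k $ r)"

lemma diagonal_b: "k < 8 \<Longrightarrow> diagonal f *v b k = f k *s b k"
proof -
  assume k: "k < 8"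
  have "(diagonal f *v b k) $ r = (\<Sum>c\<in>UNIV. \<Sum>j<8. f j * (\<beta> j $ c * b k $ c) * b j $ r)" for r
    by (simp add: diagonal_def matrix_vector_mult_def sum_distrib_left sum_distrib_right ac_simps)
  also have "\<dots> r = (\<Sum>j<8. f j * dot (\<beta> j) (b k) * b j $ r)" for r
    by (subst sum.swap) (simp add: dot_def sum_distrib_left sum_distrib_right)
  also have "\<dots> r = (\<Sum>j<8. if j = k then f k * b k $ r else 0)" for r
    by (rule sum.cong) (use k in \<open>auto simp: \<beta>_b\<close>)
  finally show ?thesis using k by (simp add: vec_eq_iff)
qed

definition S :: "3 \<Rightarrow> complex^'n^'n" where
  "S i = diagonal (\<lambda>k. s powi wt i k)"

definition Sinv :: "3 \<Rightarrow> complex^'n^'n" where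
  "Sinv i = diagonal (\<lambda>k. s powi (- wt i k))"

lemma S_b: "k < 8 \<Longrightarrow> S i *v b k = s powi wt i k *s b k"
  "k < 8 \<Longrightarrow> Sinv i *v b k = s powi (- wt i k) *s b k"
  by (simp_all add: S_def Sinv_def diagonal_b)

lemma S_eigenvector:
  assumes "K i *v x = q powi a *s x" shows "S i *v x = s powi a *s x"
proof -
  have 0: "dot (\<beta> k) x = 0" if "k < 8" "wt i k \<noteq> a" for k
  proof (rule ccontr)
    assume nz: "dot (\<beta> k) x \<noteq> 0"
    have "q powi a * dot (\<beta> k) x = q powi wt i k * dot (\<beta> k) x"
      using \<beta>_K [OF that(1), of i x] by (simp add: assms dot_linear)
    then show False using nz that(2) generic_powi_inject [OF q_nonzero q_generic] by (metis mult_right_cancel)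
  qed
  have "S i *v x = (\<Sum>k<8. dot (\<beta> k) x *s (s powi wt i k *s b k))"
    by (subst expand [of x]) (simp add: mult_vec_sum mult_vec_scale S_b cong: sum.cong_simp)
  also have "\<dots> = (\<Sum>k<8. s powi a *s (dot (\<beta> k) x *s b k))"
    by (rule sum.cong) (use 0 in \<open>auto simp: mult.commute\<close>)
  also have "\<dots> = s powi a *s x" by (subst (2) expand [of x]) (simp only: vec.scale_sum_right)
  finally show ?thesis .
qed

lemma half_K_eq: "half_K s V i = S i"
  unfolding half_K_def s_sqrt
proof (rule the_equality)
  show "\<forall>k x. K i *v x = q powi k *s x \<longrightarrow> S i *v x = s powi k *s x" using S_eigenvector by blast
next
  fix S' assume S': "\<forall>k x. K i *v x = q powi k *s x \<longrightarrow> S' *v x = s powi k *s x"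
  show "S' = S i"
  proof (rule mat_eq_on_basis [OF expand])
    fix k :: nat assume "k < 8"
    then show "S' *v b k = S i *v b k" using S' K_b S_b by metis
  qed
qed

lemma matrix_inv_S: "matrix_inv (S i) = Sinv i"
proof (rule matrix_inv_eqI, rule mat_eq_on_basis [OF expand])
  fix k :: nat assume "k < 8"
  then show "(S i ** Sinv i) *v b k = mat 1 *v b k"
    by (simp add: mat_vec_simps S_b s_powi_add)
qed

lemma S_invertible: "invertible (S i)"
proof -
  have "S i ** Sinv i = mat 1"
  proof (rule mat_eq_on_basis [OF expand])
    fix k :: nat assume "k < 8"
    then show "(S i ** Sinv i) *v b k = mat 1 *v b k"
      by (simp add: mat_vec_simps S_b s_powi_add)
  qed
  then show ?thesis unfolding invertible_right_inverse by blast
qed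

lemma half_cartan_V: "half_cartan q s V S"
  unfolding half_cartan_def
proof (intro conjI allI)
  fix i j
  show "half_K s V i = S i" by (rule half_K_eq)
  show "invertible (S i)" by (rule S_invertible)
  show "S i ** S i = K i"
  proof (rule mat_eq_on_basis [OF expand])
    fix k :: nat assume "k < 8"
    then show "(S i ** S i) *v b k = K i *v b k"
      by (simp add: mat_vec_simps S_b K_b s_powi_add flip: s_powi_double)
  qed
  show "S i ** S j = S j ** S i"
  proof (rule mat_eq_on_basis [OF expand])
    fix k :: nat assume "k < 8"
    then show "(S i ** S j) *v b k = (S j ** S i) *v b k"
      by (simp add: mat_vec_simps S_b mult.commute)
  qed
  show "S i ** E j = (s powi cartan i j) *k (E j ** S i)"
  proof (rule mat_eq_on_basis [OF expand])
    fix k :: nat assume k: "k < 8"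
    have "K i ** E j = (q powi cartan i j) *k (E j ** K i)"
      using weight_rels unfolding weight_relations_def by blast
    then have "(K i ** E j) *v b k = ((q powi cartan i j) *k (E j ** K i)) *v b k" by simp
    then have "K i *v (E j *v b k) = q powi (cartan i j + wt i k) *s (E j *v b k)"
      using k by (simp add: mat_vec_simps K_b q_powi_add)
    then show "(S i ** E j) *v b k = ((s powi cartan i j) *k (E j ** S i)) *v b k"
      using k by (simp add: mat_vec_simps S_b S_eigenvector s_powi_add)
  qed
  show "S i ** F j = (s powi (- cartan i j)) *k (F j ** S i)"
  proof (rule mat_eq_on_basis [OF expand])
    fix k :: nat assume k: "k < 8"
    have "K i *v (F j *v b k) = q powi (- cartan i j + wt i k) *s (F j *v b k)"
      using k by (simp add: KF mat_vec_simps K_b q_powi_add)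
    then show "(S i ** F j) *v b k = ((s powi (- cartan i j)) *k (F j ** S i)) *v b k"
      using k by (simp add: mat_vec_simps S_b S_eigenvector s_powi_add)
  qed
qed

lemma half_cartan_shift: "half_cartan q s (shift_module z V) S"
proof -
  have K: "genK (shift_module z V) = genK V" by (simp add: shift_module_def)
  have h: "half_K s (shift_module z V) = half_K s V" by (simp add: half_K_def K fun_eq_iff)
  have E: "genE (shift_module z V) i = (if i = 0 then z else 1) *k genE V i"
    and F: "genF (shift_module z V) i = inverse (if i = 0 then z else 1) *k genF V i" for i
    by (simp_all add: shift_module_def)
  show ?thesis
    using half_cartan_V unfolding half_cartan_def h K E F
    by (simp add: mat_scale_mult_left mat_scale_mult_right mat_scale_scale mult.commute)
qed

abbreviation T0 :: "('n \<times> 'n) chevalley" where "T0 \<equiv> tensor_module s V V"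
abbreviation TL :: "complex \<Rightarrow> ('n \<times> 'n) chevalley" where "TL z \<equiv> tensor_module s (shift_module z V) V"
abbreviation TR :: "complex \<Rightarrow> ('n \<times> 'n) chevalley" where "TR z \<equiv> tensor_module s V (shift_module z V)"

lemma tensor_relations: "weight_relations q T0"
  "z \<noteq> 0 \<Longrightarrow> weight_relations q (TL z)" "z \<noteq> 0 \<Longrightarrow> weight_relations q (TR z)"
  using tensor_weight_relations [OF s_nonzero] weight_rels half_cartan_V half_cartan_shift
    shift_weight_relations by blast+

definition EA :: "3 \<Rightarrow> complex^('n \<times> 'n)^('n \<times> 'n)" where "EA i = kron (E i) (S i)"
definition EB :: "3 \<Rightarrow> complex^('n \<times> 'n)^('n \<times> 'n)" where "EB i = kron (Sinv i) (E i)"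
definition FA :: "3 \<Rightarrow> complex^('n \<times> 'n)^('n \<times> 'n)" where "FA i = kron (F i) (S i)"
definition FB :: "3 \<Rightarrow> complex^('n \<times> 'n)^('n \<times> 'n)" where "FB i = kron (Sinv i) (F i)"

lemma tensor_gens:
  "genE T0 i = EA i + EB i" "genF T0 i = FA i + FB i"
  "genE (TL z) i = (if i = 0 then z *k EA i + EB i else EA i + EB i)"
  "genE (TR z) i = (if i = 0 then EA i + z *k EB i else EA i + EB i)"
  "i \<noteq> 0 \<Longrightarrow> genF (TL z) i = FA i + FB i" "i \<noteq> 0 \<Longrightarrow> genF (TR z) i = FA i + FB i"
  "genK (TL z) = genK T0" "genK (TR z) = genK T0"
proof -
  have "half_K s (shift_module z V) i = S i" for i
    using half_cartan_shift unfolding half_cartan_def by blast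
  then show "genE T0 i = EA i + EB i" "genF T0 i = FA i + FB i"
  "genE (TL z) i = (if i = 0 then z *k EA i + EB i else EA i + EB i)"
  "genE (TR z) i = (if i = 0 then EA i + z *k EB i else EA i + EB i)"
  "i \<noteq> 0 \<Longrightarrow> genF (TL z) i = FA i + FB i" "i \<noteq> 0 \<Longrightarrow> genF (TR z) i = FA i + FB i"
  "genK (TL z) = genK T0" "genK (TR z) = genK T0"
    by (simp_all add: tensor_module_def half_K_eq matrix_inv_S EA_def EB_def FA_def FB_def
        shift_module_def kron_scale)
qed

text \<open>
  The rescaling by \<open>s\<^sup>-\<^sup>(\<^sup>\<lambda>\<^sup>,\<^sup>\<mu>\<^sup>)\<close>, for weights \<open>\<lambda>\<close>, \<open>\<mu>\<close> of the two factors, turns the symmetric coproduct into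
  \<open>E \<mapsto> E \<otimes> K + 1 \<otimes> E\<close>, \<open>F \<mapsto> F \<otimes> 1 + K\<^sup>-\<^sup>1 \<otimes> F\<close>, so that the square root of \<open>q\<close> disappears.
\<close>

definition t :: "nat \<Rightarrow> nat \<Rightarrow> complex^('n \<times> 'n)" where
  "t m n = s powi (- root_pairing m n) *s tensor_vec (b m) (b n)"

definition crd :: "nat \<Rightarrow> nat \<Rightarrow> complex^('n \<times> 'n) \<Rightarrow> complex" where
  "crd m n x = s powi (root_pairing m n) * dot (tensor_vec (\<beta> m) (\<beta> n)) x"

lemma tensor_vec_sum:
  "tensor_vec (sum_list (map f xs)) y = (\<Sum>x\<leftarrow>xs. tensor_vec (f x) y)"
  "tensor_vec y (sum_list (map f xs)) = (\<Sum>x\<leftarrow>xs. tensor_vec y (f x))"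
  by (induct xs) (simp_all add: tensor_vec_linear)

lemma scale_sum_list: "c *s (\<Sum>x\<leftarrow>xs. f x) = (\<Sum>x\<leftarrow>xs. c *s (f x :: complex^'m))"
  by (induct xs) (simp_all add: vec.scale_right_distrib)

text \<open>
  Here \<open>c\<close> is the change of the inner product when the weight of the factor on which \<open>X\<close> acts is shifted
  by the weight of \<open>X\<close>; it equals \<open>\<plusminus> wt i n\<close> (or \<open>\<plusminus> wt i m\<close>), so the exponent of \<open>s\<close> is always even.
\<close>

lemma kron_t:
  assumes mn: "m < 8" "n < 8"
  shows "X *v b m = (\<Sum>(m', d) \<leftarrow> T. d *s b m') \<Longrightarrow>
      (\<And>m' d. (m', d) \<in> set T \<Longrightarrow> root_pairing m' n = root_pairing m n + c) \<Longrightarrow>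
      kron X (S i) *v t m n = (\<Sum>(m', d) \<leftarrow> T. (d * s powi (wt i n + c)) *s t m' n)"
    and "X *v b n = (\<Sum>(n', d) \<leftarrow> T. d *s b n') \<Longrightarrow>
      (\<And>n' d. (n', d) \<in> set T \<Longrightarrow> root_pairing m n' = root_pairing m n + c) \<Longrightarrow>
      kron (Sinv i) X *v t m n = (\<Sum>(n', d) \<leftarrow> T. (d * s powi (c - wt i m)) *s t m n')"
proof -
  assume X: "X *v b m = (\<Sum>(m', d) \<leftarrow> T. d *s b m')"
    and c: "\<And>m' d. (m', d) \<in> set T \<Longrightarrow> root_pairing m' n = root_pairing m n + c"
  have "kron X (S i) *v t m n = (\<Sum>(m', d) \<leftarrow> T.
      (s powi (- root_pairing m n) * s powi wt i n * d) *s tensor_vec (b m') (b n))"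
    by (simp add: t_def mult_vec_scale kron_mult_tensor_vec S_b mn X tensor_vec_linear
        tensor_vec_sum scale_sum_list split_def mult.assoc)
  also have "\<dots> = (\<Sum>(m', d) \<leftarrow> T. (d * s powi (wt i n + c)) *s t m' n)"
    by (intro arg_cong [where f = sum_list] map_cong refl, clarify)
      (simp add: t_def c s_powi_add ac_simps)
  finally show "kron X (S i) *v t m n = (\<Sum>(m', d) \<leftarrow> T. (d * s powi (wt i n + c)) *s t m' n)" .
next
  assume X: "X *v b n = (\<Sum>(n', d) \<leftarrow> T. d *s b n')"
    and c: "\<And>n' d. (n', d) \<in> set T \<Longrightarrow> root_pairing m n' = root_pairing m n + c"
  have "kron (Sinv i) X *v t m n = (\<Sum>(n', d) \<leftarrow> T.
      (s powi (- root_pairing m n) * d * s powi (- wt i m)) *s tensor_vec (b m) (b n'))"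
    by (simp add: t_def mult_vec_scale kron_mult_tensor_vec S_b mn X tensor_vec_linear
        tensor_vec_sum scale_sum_list split_def mult.assoc)
  also have "\<dots> = (\<Sum>(n', d) \<leftarrow> T. (d * s powi (c - wt i m)) *s t m n')"
    by (intro arg_cong [where f = sum_list] map_cong refl, clarify)
      (simp add: t_def c s_powi_add ac_simps)
  finally show "kron (Sinv i) X *v t m n = (\<Sum>(n', d) \<leftarrow> T. (d * s powi (c - wt i m)) *s t m n')" .
qed

lemma t_ops:
  assumes mn: "m < 8" "n < 8"
  shows "EA i *v t m n = (\<Sum>(m', d) \<leftarrow> E_table q i m. (d * q powi wt i n) *s t m' n)"
    "EB i *v t m n = (\<Sum>(n', d) \<leftarrow> E_table q i n. d *s t m n')"
    "i \<in> {1, 2} \<Longrightarrow> FA i *v t m n = (\<Sum>(m', d) \<leftarrow> F_table q i m. d *s t m' n)"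
    "i \<in> {1, 2} \<Longrightarrow> FB i *v t m n = (\<Sum>(n', d) \<leftarrow> F_table q i n. (d * q powi (- wt i m)) *s t m n')"
    "genK T0 i *v t m n = q powi (wt i m + wt i n) *s t m n"
proof -
  have double: "s powi (a + a) = q powi a" for a using s_powi_double [of a] by simp
  have E: "root_pairing m' n = root_pairing m n + wt i n" if "(m', d) \<in> set (E_table q i m)" for m' d
    using E_table_weights [OF mn(1) that] mn root_pairing_sym by metis
  show "EA i *v t m n = (\<Sum>(m', d) \<leftarrow> E_table q i m. (d * q powi wt i n) *s t m' n)"
    unfolding EA_def double [symmetric] by (rule kron_t(1) [OF mn E_table [OF mn(1)] E])
  show "EB i *v t m n = (\<Sum>(n', d) \<leftarrow> E_table q i n. d *s t m n')"
    using kron_t(2) [OF mn E_table [OF mn(2)] E_table_weights(2) [OF mn(2) _ mn(1)]]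
    by (simp add: EB_def)
  assume i: "i \<in> {1, 2}"
  have F: "root_pairing m' n = root_pairing m n + - wt i n" if "(m', d) \<in> set (F_table q i m)" for m' d
    using F_table_weights [OF mn(1) i that] mn root_pairing_sym by (metis uminus_add_conv_diff add.commute)
  show "FA i *v t m n = (\<Sum>(m', d) \<leftarrow> F_table q i m. d *s t m' n)"
    using kron_t(1) [OF mn F_table [OF i mn(1)] F] by (simp add: FA_def)
  have F: "root_pairing m n' = root_pairing m n + - wt i m" if "(n', d) \<in> set (F_table q i n)" for n' d
    using F_table_weights(2) [OF mn(2) i that mn(1)] by simp
  show "FB i *v t m n = (\<Sum>(n', d) \<leftarrow> F_table q i n. (d * q powi (- wt i m)) *s t m n')"
    using kron_t(2) [OF mn F_table [OF i mn(2)] F] double [of "- wt i m"] by (simp add: FB_def)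
next
  show "genK T0 i *v t m n = q powi (wt i m + wt i n) *s t m n"
    by (simp add: tensor_module_def t_def mult_vec_scale kron_mult_tensor_vec K_b mn tensor_vec_linear
        ac_simps flip: q_powi_add)
qed

lemma crd_linear: "crd m n (x + y) = crd m n x + crd m n y" "crd m n (c *s x) = c * crd m n x"
  "crd m n 0 = 0"
  by (simp_all add: crd_def dot_linear algebra_simps)

lemma crd_sum: "crd m n (\<Sum>i\<in>I. f i) = (\<Sum>i\<in>I. crd m n (f i))"
  by (induct I rule: infinite_finite_induct) (simp_all add: crd_linear)

lemma crd_t:
  assumes "m < 8" "n < 8" "m' < 8" "n' < 8"
  shows "crd m n (t m' n') = (if m' = m \<and> n' = n then 1 else 0)"
  using assms by (auto simp: crd_def t_def dot_linear dot_tensor_vec \<beta>_b s_powi_add)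

lemma t_expand: "x = (\<Sum>m<8. \<Sum>n<8. crd m n x *s t m n)"
proof -
  have \<beta>b: "(\<Sum>k<8. \<beta> k $ c * b k $ r) = (if c = r then 1 else 0)" for c r
  proof -
    have "(\<Sum>k<8. dot (\<beta> k) (axis c 1) *s b k) $ r = (if c = r then 1 else 0)"
      unfolding expand [of "axis c 1", symmetric] by (auto simp: axis_def)
    moreover have "dot (\<beta> j) (axis c 1) = \<beta> j $ c" for j
      by (simp add: dot_def axis_def if_distrib cong: if_cong)
    ultimately show ?thesis by simp
  qed
  have "(\<Sum>m<8. \<Sum>n<8. crd m n x *s t m n) = (\<Sum>m<8. \<Sum>n<8. dot (tensor_vec (\<beta> m) (\<beta> n)) x *s tensor_vec (b m) (b n))"
  proof (intro sum.cong refl)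
    fix m n
    have "s powi p * D * s powi (- p) = D" for p D
      using s_nonzero by (simp add: power_int_minus)
    then show "crd m n x *s t m n = dot (tensor_vec (\<beta> m) (\<beta> n)) x *s tensor_vec (b m) (b n)"
      by (simp add: crd_def t_def)
  qed
  also have "\<dots> = x"
  proof -
    have "(\<Sum>m<8. \<Sum>n<8. dot (tensor_vec (\<beta> m) (\<beta> n)) x *s tensor_vec (b m) (b n)) $ (r1, r2) = x $ (r1, r2)" for r1 r2
    proof -
      have "(\<Sum>m<8. \<Sum>n<8. dot (tensor_vec (\<beta> m) (\<beta> n)) x *s tensor_vec (b m) (b n)) $ (r1, r2) =
        (\<Sum>m<8. \<Sum>n<8. \<Sum>c\<in>UNIV. x $ c * ((\<beta> m $ fst c * b m $ r1) * (\<beta> n $ snd c * b n $ r2)))"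
        by (simp add: dot_def tensor_vec_def sum_distrib_left sum_distrib_right ac_simps)
      also have "\<dots> = (\<Sum>c\<in>UNIV. \<Sum>m<8. \<Sum>n<8. x $ c * ((\<beta> m $ fst c * b m $ r1) * (\<beta> n $ snd c * b n $ r2)))"
        by (subst (2) sum.swap, subst sum.swap) (rule refl)
      also have "\<dots> = (\<Sum>c\<in>UNIV. x $ c * ((if fst c = r1 then 1 else 0) * (if snd c = r2 then 1 else 0)))"
        unfolding \<beta>b [symmetric] sum_product by (simp only: sum_distrib_left)
      also have "\<dots> = (\<Sum>c\<in>UNIV. if c = (r1, r2) then x $ c else 0)"
        by (rule sum.cong) auto
      finally show ?thesis by simp
    qed
    then show ?thesis by (simp add: vec_eq_iff)
  qed
  finally show ?thesis by simp
qed

definition vl :: "terms \<Rightarrow> complex^('n \<times> 'n)" where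
  "vl xs = (\<Sum>(m, n, c) \<leftarrow> xs. c *s t m n)"

lemma vl_simps: "vl [] = 0" "vl ((m, n, c) # xs) = c *s t m n + vl xs" "vl (xs @ ys) = vl xs + vl ys"
  by (simp_all add: vl_def)

lemma vl_scale: "c *s vl xs = vl (map (\<lambda>(m, n, d). (m, n, c * d)) xs)"
  by (induct xs) (auto simp: vl_simps vec.scale_right_distrib)

lemma crd_vl: "valid xs \<Longrightarrow> m < 8 \<Longrightarrow> n < 8 \<Longrightarrow> crd m n (vl xs) = coef xs m n"
  by (induct xs) (auto simp: vl_simps crd_linear crd_t)

lemma coef_eq_0: "(\<forall>c. (m, n, c) \<notin> set xs) \<Longrightarrow> coef xs m n = 0"
  by (induct xs) auto

lemma vl_eqI:
  assumes "valid xs" "valid ys"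
    and "list_all (\<lambda>(m, n, c). coef xs m n = coef ys m n) (xs @ ys)"
  shows "vl xs = vl ys"
proof -
  have "coef xs m n = coef ys m n" for m n
  proof (cases "\<exists>c. (m, n, c) \<in> set (xs @ ys)")
    case True
    then show ?thesis using assms(3) unfolding list_all_iff by blast
  next
    case False
    then show ?thesis using coef_eq_0 [of m n xs] coef_eq_0 [of m n ys] by simp
  qed
  then show ?thesis
    using assms(1,2) by (subst (1 2) t_expand) (simp add: crd_vl cong: sum.cong_simp)
qed

lemma vl_ops:
  assumes "valid xs"
  shows "EA i *v vl xs = vl (lift_left (E_table q i) (\<lambda>n. q powi wt i n) xs)"
    "EB i *v vl xs = vl (lift_right (E_table q i) (\<lambda>m. 1) xs)"
    "i \<in> {1, 2} \<Longrightarrow> FA i *v vl xs = vl (lift_left (F_table q i) (\<lambda>n. 1) xs)"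
    "i \<in> {1, 2} \<Longrightarrow> FB i *v vl xs = vl (lift_right (F_table q i) (\<lambda>m. q powi (- wt i m)) xs)"
proof -
  have l: "vl (map (\<lambda>(m', d). (m', n, c * d * w)) ys) = c *s (\<Sum>(m', d)\<leftarrow>ys. (d * w) *s t m' n)" for ys n c w
    by (induct ys) (auto simp: vl_simps vec.scale_right_distrib mult.assoc)
  have r: "vl (map (\<lambda>(n', d). (m, n', c * d * w)) ys) = c *s (\<Sum>(n', d)\<leftarrow>ys. (d * w) *s t m n')" for ys m c w
    by (induct ys) (auto simp: vl_simps vec.scale_right_distrib mult.assoc)
  show "EA i *v vl xs = vl (lift_left (E_table q i) (\<lambda>n. q powi wt i n) xs)"
    "EB i *v vl xs = vl (lift_right (E_table q i) (\<lambda>m. 1) xs)"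
    using assms by (induct xs) (auto simp: vl_simps l r mult_vec_add mult_vec_scale t_ops r [where w = 1, simplified])
  show "FA i *v vl xs = vl (lift_left (F_table q i) (\<lambda>n. 1) xs)"
    "FB i *v vl xs = vl (lift_right (F_table q i) (\<lambda>m. q powi (- wt i m)) xs)" if "i \<in> {1, 2}"
    using assms t_ops(3,4) [OF _ _ that]
    by (induct xs) (auto simp: vl_simps l r mult_vec_add mult_vec_scale l [where w = 1, simplified])
qed

end

section \<open>Singular vectors of the tensor square\<close>

text \<open>
  Explicit singular vectors. The scalar in front of \<open>b\<^sub>7 \<otimes> b\<^sub>0\<close> in the invariant vector clears denominators.
  The two vectors of weight \<open>\<omega>\<^sub>1 + \<omega>\<^sub>2\<close>, at positions 3 and 4, are normalized so that the intertwiner is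
  given by the matrix \<open>f\<close> in this basis, in this order.
\<close>

definition U :: "complex \<Rightarrow> nat \<Rightarrow> terms" where
  "U q k = [
    [(0, 0, 1)],
    [(2, 0, 1), (0, 2, - q)],
    [(1, 0, 1), (0, 1, - q)],
    [(4, 0, 1), (0, 3, q ^ 3), (1, 2, - q), (2, 1, - (1 + q ^ 2))],
    [(3, 0, 1), (0, 4, q ^ 3), (1, 2, - (1 + q ^ 2)), (2, 1, - q)],
    [(7, 0, 1 + q ^ 2 + q ^ 4), (0, 7, q ^ 4 * (1 + q ^ 2 + q ^ 4)),
     (1, 6, - (q ^ 3 * (1 + q ^ 2 + q ^ 4))), (2, 5, - (q ^ 3 * (1 + q ^ 2 + q ^ 4))),
     (3, 3, q ^ 4 * (1 + q ^ 2)), (3, 4, - (q ^ 5)), (4, 3, - (q ^ 5)), (4, 4, q ^ 4 * (1 + q ^ 2)),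
     (5, 2, - (q * (1 + q ^ 2 + q ^ 4))), (6, 1, - (q * (1 + q ^ 2 + q ^ 4)))]] ! k"

definition L :: "nat \<Rightarrow> nat \<times> nat" where
  "L k = [(2, 2), (3, 0), (0, 3), (1, 1), (1, 1), (0, 0)] ! k"

lemma less6: "k < 6 \<Longrightarrow> k = 0 \<or> k = 1 \<or> k = 2 \<or> k = 3 \<or> k = 4 \<or> k = (5::nat)"
  by auto

context adjoint_square
begin

lemma three_sum_nonzero: "1 + q ^ 2 + q ^ 4 \<noteq> 0"
proof
  assume "1 + q ^ 2 + q ^ 4 = 0"
  then have "q ^ 6 = 1" by algebra
  then show False using q_generic [of 6] by simp
qed

lemma two_sum_nonzero: "1 + q ^ 2 \<noteq> 0"
proof
  assume "1 + q ^ 2 = 0"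
  then have "q ^ 4 = 1" by algebra
  then show False using q_generic [of 4] by simp
qed

lemma four_sum_nonzero: "1 + q ^ 4 \<noteq> 0"
proof
  assume "1 + q ^ 4 = 0"
  then have "q ^ 8 = 1" by algebra
  then show False using q_generic [of 8] by simp
qed

lemma five_sum_nonzero: "1 + q ^ 2 + q ^ 4 + q ^ 6 + q ^ 8 \<noteq> 0"
proof
  assume "1 + q ^ 2 + q ^ 4 + q ^ 6 + q ^ 8 = 0"
  then have "q ^ 10 = 1" by algebra
  then show False using q_generic [of 10] by simp
qed

definition u :: "nat \<Rightarrow> complex^('n \<times> 'n)" where
  "u k = vl (U q k)"

lemma valid_U: "k < 6 \<Longrightarrow> valid (U q k)"
  using less6 [of k] by (auto simp: U_def)

lemma E_u: "k < 6 \<Longrightarrow> i \<in> {1, 2} \<Longrightarrow> genE T0 i *v u k = 0"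
proof -
  assume k: "k < 6" and i: "i \<in> {1, 2}"
  let ?xs = "lift_left (E_table q i) (\<lambda>n. q powi wt i n) (U q k) @ lift_right (E_table q i) (\<lambda>m. 1) (U q k)"
  have "genE T0 i *v u k = vl ?xs"
    by (simp add: tensor_gens mat_vec_simps u_def vl_ops valid_U k vl_simps)
  also have "\<dots> = vl []"
  proof (rule vl_eqI)
    show "valid ?xs"
      using less6 [OF k] i by (elim disjE insertE) (simp_all add: U_def E_table_def)
    show "list_all (\<lambda>(m, n, c). coef ?xs m n = coef [] m n) (?xs @ [])"
      using less6 [OF k] i q_nonzero
      by (elim disjE insertE) (simp_all add: U_def E_table_def wt_def power_int_minus field_simps power_numeral_reduce)
  qed simp
  finally show ?thesis by (simp add: vl_simps)
qed

lemma K_vl: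
  assumes "valid xs" "\<forall>(m, n, c) \<in> set xs. wt i m + wt i n = a"
  shows "genK T0 i *v vl xs = q powi a *s vl xs"
  using assms by (induct xs) (auto simp: vl_simps mat_vec_simps t_ops vec.scale_right_distrib mult.commute)

lemma K_u: "k < 6 \<Longrightarrow> i \<in> {1, 2} \<Longrightarrow> genK T0 i *v u k = q ^ (if i = 1 then fst (L k) else snd (L k)) *s u k"
proof -
  assume k: "k < 6" and i: "i \<in> {1, 2}"
  have "genK T0 i *v u k = q powi (int (if i = 1 then fst (L k) else snd (L k))) *s u k"
    unfolding u_def
  proof (rule K_vl [OF valid_U [OF k]])
    show "\<forall>(m, n, c)\<in>set (U q k). wt i m + wt i n = int (if i = 1 then fst (L k) else snd (L k))"
      using less6 [OF k] i by (elim disjE insertE) (simp_all add: U_def L_def wt_def)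
  qed
  then show ?thesis by (simp only: power_int_of_nat)
qed

lemma u_singular: "k < 6 \<Longrightarrow> u k \<in> singular_space q T0 (L k)"
  using E_u [of k 1] E_u [of k 2] K_u [of k 1] K_u [of k 2] by (simp add: singular_space_def)

text \<open>
  The \<open>m\<close>-th coordinate of \<open>E\<^sub>i\<close> applied to the vector of \<open>V\<close> with coordinates \<open>f\<close>.
\<close>

definition row :: "3 \<Rightarrow> (nat \<Rightarrow> complex) \<Rightarrow> nat \<Rightarrow> complex" where
  "row i f m = (\<Sum>m'<8. (\<Sum>(a, d) \<leftarrow> E_table q i m'. if a = m then d else 0) * f m')"

lemma crd_sum_list: "crd m n (\<Sum>x\<leftarrow>xs. f x) = (\<Sum>x\<leftarrow>xs. crd m n (f x))"
  by (induct xs) (simp_all add: crd_linear)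

lemma crd_E:
  assumes "m < 8" "n < 8"
  shows "crd m n (genE T0 i *v x) = q powi wt i n * row i (\<lambda>m'. crd m' n x) m + row i (\<lambda>n'. crd m n' x) n"
proof -
  have A: "crd m n (EA i *v t m' n') = (if n' = n then q powi wt i n * (\<Sum>(a, d) \<leftarrow> E_table q i m'. if a = m then d else 0) else 0)"
    if "m' < 8" "n' < 8" for m' n'
  proof -
    have "crd m n (EA i *v t m' n') = (\<Sum>(a, d) \<leftarrow> E_table q i m'. (d * q powi wt i n') * crd m n (t a n'))"
      by (simp add: t_ops that crd_sum_list crd_linear split_def)
    also have "\<dots> = (\<Sum>(a, d) \<leftarrow> E_table q i m'. (if n' = n then q powi wt i n else 0) * (if a = m then d else 0))"
    proof (intro arg_cong [where f = sum_list] map_cong refl, clarify)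
      fix a d assume "(a, d) \<in> set (E_table q i m')"
      then have "a < 8" using E_table_weights that by blast
      then show "(d * q powi wt i n') * crd m n (t a n') = (if n' = n then q powi wt i n else 0) * (if a = m then d else 0)"
        by (simp add: crd_t assms that)
    qed
    finally show ?thesis by (simp add: split_def sum_list_const_mult)
  qed
  have B: "crd m n (EB i *v t m' n') = (if m' = m then (\<Sum>(a, d) \<leftarrow> E_table q i n'. if a = n then d else 0) else 0)"
    if "m' < 8" "n' < 8" for m' n'
  proof -
    have "crd m n (EB i *v t m' n') = (\<Sum>(a, d) \<leftarrow> E_table q i n'. d * crd m n (t m' a))"
      by (simp add: t_ops that crd_sum_list crd_linear split_def)
    also have "\<dots> = (\<Sum>(a, d) \<leftarrow> E_table q i n'. (if m' = m then 1 else 0) * (if a = n then d else 0))"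
    proof (intro arg_cong [where f = sum_list] map_cong refl, clarify)
      fix a d assume "(a, d) \<in> set (E_table q i n')"
      then have "a < 8" using E_table_weights that by blast
      then show "d * crd m n (t m' a) = (if m' = m then 1 else 0) * (if a = n then d else 0)"
        by (simp add: crd_t assms that)
    qed
    finally show ?thesis by (simp add: split_def sum_list_const_mult)
  qed
  have "crd m n (EA i *v x) = (\<Sum>m'<8. \<Sum>n'<8. crd m' n' x * crd m n (EA i *v t m' n'))"
    by (subst t_expand [of x]) (simp add: mult_vec_sum mult_vec_scale crd_sum crd_linear)
  also have "\<dots> = (\<Sum>m'<8. \<Sum>n'<8. if n' = n then q powi wt i n * ((\<Sum>(a, d) \<leftarrow> E_table q i m'. if a = m then d else 0) * crd m' n x) else 0)"
    by (intro sum.cong refl) (simp add: A)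
  also have "\<dots> = q powi wt i n * row i (\<lambda>m'. crd m' n x) m"
    using assms by (simp add: row_def sum_distrib_left)
  finally have 1: "crd m n (EA i *v x) = q powi wt i n * row i (\<lambda>m'. crd m' n x) m" .
  have "crd m n (EB i *v x) = (\<Sum>m'<8. \<Sum>n'<8. crd m' n' x * crd m n (EB i *v t m' n'))"
    by (subst t_expand [of x]) (simp add: mult_vec_sum mult_vec_scale crd_sum crd_linear)
  also have "\<dots> = (\<Sum>m'<8. if m' = m then \<Sum>n'<8. (\<Sum>(a, d) \<leftarrow> E_table q i n'. if a = n then d else 0) * crd m n' x else 0)"
    by (intro sum.cong refl) (simp add: B if_distrib mult.commute)
  also have "\<dots> = row i (\<lambda>n'. crd m n' x) n"
    using assms by (simp add: row_def)
  finally show ?thesis using 1 by (simp add: tensor_gens mat_vec_simps crd_linear)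
qed

lemma row_values:
  "row 1 f 0 = f 1" "row 1 f 1 = 0" "row 1 f 2 = f 3 + two * f 4" "row 1 f 3 = 0" "row 1 f 4 = f 5"
  "row 1 f 5 = 0" "row 1 f 6 = f 7" "row 1 f 7 = 0"
  "row 2 f 0 = f 2" "row 2 f 1 = two * f 3 + f 4" "row 2 f 2 = 0" "row 2 f 3 = f 6" "row 2 f 4 = 0"
  "row 2 f 5 = f 7" "row 2 f 6 = 0" "row 2 f 7 = 0"
  by (simp_all add: row_def sum8 E_table_def two_def)

lemma row_zero: "(\<And>m. m < 8 \<Longrightarrow> f m = 0) \<Longrightarrow> row i f m = 0"
  by (simp add: row_def)

lemma singular_equations:
  assumes "genE T0 1 *v x = 0" "genE T0 2 *v x = 0" "m < 8" "n < 8"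
  shows "q powi wt 1 n * row 1 (\<lambda>m'. crd m' n x) m + row 1 (\<lambda>n'. crd m n' x) n = 0"
    "q powi wt 2 n * row 2 (\<lambda>m'. crd m' n x) m + row 2 (\<lambda>n'. crd m n' x) n = 0"
  using crd_E [OF assms(3,4), of 1 x] crd_E [OF assms(3,4), of 2 x] assms(1,2) by (simp_all add: crd_linear)

text \<open>A singular vector is determined by its component in \<open>V \<otimes> b\<^sub>0\<close>.\<close>

lemma singular_eq_0:
  assumes x: "genE T0 1 *v x = 0" "genE T0 2 *v x = 0" and 0: "\<And>m. m < 8 \<Longrightarrow> crd m 0 x = 0"
  shows "x = 0"
proof -
  note eq = singular_equations [OF x]
  have 1: "crd m 1 x = 0" if "m < 8" for m
    using eq(1) [OF that, of 0] row_zero [of "\<lambda>m'. crd m' 0 x" 1 m] 0 by (simp add: row_values)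
  have 2: "crd m 2 x = 0" if "m < 8" for m
    using eq(2) [OF that, of 0] row_zero [of "\<lambda>m'. crd m' 0 x" 2 m] 0 by (simp add: row_values)
  have 34: "crd m 3 x = 0 \<and> crd m 4 x = 0" if "m < 8" for m
  proof -
    have a: "crd m 3 x + two * crd m 4 x = 0"
      using eq(1) [OF that, of 2] row_zero [of "\<lambda>m'. crd m' 2 x" 1 m] 2 by (simp add: row_values)
    have c: "two * crd m 3 x + crd m 4 x = 0"
      using eq(2) [OF that, of 1] row_zero [of "\<lambda>m'. crd m' 1 x" 2 m] 1 by (simp add: row_values)
    have "(two * two - 1) * crd m 4 x = 0" using a c by algebra
    then show ?thesis using three_nonzero a by simp
  qed
  have 5: "crd m 5 x = 0" if "m < 8" for m
    using eq(1) [OF that, of 4] row_zero [of "\<lambda>m'. crd m' 4 x" 1 m] 34 by (simp add: row_values)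
  have 6: "crd m 6 x = 0" if "m < 8" for m
    using eq(2) [OF that, of 3] row_zero [of "\<lambda>m'. crd m' 3 x" 2 m] 34 by (simp add: row_values)
  have 7: "crd m 7 x = 0" if "m < 8" for m
    using eq(1) [OF that, of 6] row_zero [of "\<lambda>m'. crd m' 6 x" 1 m] 6 by (simp add: row_values)
  have "crd m n x = 0" if "m < 8" "n < 8" for m n
    using 0 1 2 34 5 6 7 that less8 [of n] by metis
  then show ?thesis by (subst t_expand) simp
qed

text \<open>
  The component \<open>w\<close> in \<open>V \<otimes> b\<^sub>0\<close> of a singular vector satisfies \<open>E\<^sub>1\<^sup>2 w = E\<^sub>2\<^sup>2 w = 0\<close>, which excludes \<open>b\<^sub>5\<close> and \<open>b\<^sub>6\<close>.
  The other six basis vectors do occur as such components, namely for the vectors \<open>u k\<close>.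
\<close>

lemma singular_top_components:
  assumes x: "genE T0 1 *v x = 0" "genE T0 2 *v x = 0"
  shows "crd 5 0 x = 0" "crd 6 0 x = 0"
proof -
  note eq = singular_equations [OF x]
  have 1: "crd 3 1 x = 0" using eq(1) [of 3 0] by (simp add: row_values)
  have 2: "crd 4 1 x = 0"
    using eq(1) [of 2 1] 1 q_nonzero two_nonzero by (simp add: row_values wt_def)
  show "crd 5 0 x = 0" using eq(1) [of 4 0] 2 q_nonzero by (simp add: row_values wt_def)
  have 3: "crd 4 2 x = 0" using eq(2) [of 4 0] by (simp add: row_values)
  have 4: "crd 3 2 x = 0"
    using eq(2) [of 1 2] 3 q_nonzero two_nonzero by (simp add: row_values wt_def)
  show "crd 6 0 x = 0" using eq(2) [of 3 0] 4 q_nonzero by (simp add: row_values wt_def)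
qed

definition \<phi> :: "nat \<Rightarrow> complex^('n \<times> 'n) \<Rightarrow> complex" where
  "\<phi> k x = (if k < 6 then crd ([0, 2, 1, 4, 3, 7] ! k) 0 x / (if k = 5 then 1 + q ^ 2 + q ^ 4 else 1) else 0)"

lemma \<phi>_linear: "\<phi> k (x + y) = \<phi> k x + \<phi> k y" "\<phi> k (c *s x) = c * \<phi> k x"
  by (simp_all add: \<phi>_def crd_linear add_divide_distrib)

lemma \<phi>_u: assumes "j < 6" "k < 6" shows "\<phi> k (u j) = (if j = k then 1 else 0)"
  using less6 [OF assms(1)] less6 [OF assms(2)] three_sum_nonzero
  by (elim disjE) (simp_all add: \<phi>_def u_def crd_vl U_def)

lemma sum6: "(\<Sum>k<6. f (k :: nat)) = f 0 + f 1 + f 2 + f 3 + f 4 + (f 5 :: 'a::ab_group_add)"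
proof -
  have "{..<6::nat} = {0, 1, 2, 3, 4, 5}" by auto
  then show ?thesis by (simp add: add.assoc)
qed

lemma singular_expand:
  assumes x: "genE T0 1 *v x = 0" "genE T0 2 *v x = 0"
  shows "x = (\<Sum>k<6. \<phi> k x *s u k)"
proof -
  define y where "y = x - (\<Sum>k<6. \<phi> k x *s u k)"
  have y: "genE T0 1 *v y = 0" "genE T0 2 *v y = 0"
    unfolding y_def using x by (simp_all add: mult_vec_diff mult_vec_sum mult_vec_scale E_u)
  have crd_diff: "crd m n (a - c) = crd m n a - crd m n c" for m n a c
    by (simp add: crd_def dot_linear algebra_simps)
  have \<phi>y: "\<phi> k y = 0" if "k < 6" for k
  proof -
    have "\<phi> k y = \<phi> k x - (\<Sum>j<6. \<phi> j x * \<phi> k (u j))"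
      using that by (simp add: y_def \<phi>_def crd_diff crd_sum crd_linear diff_divide_distrib sum_divide_distrib)
    also have "(\<Sum>j<6. \<phi> j x * \<phi> k (u j)) = (\<Sum>j<6. if j = k then \<phi> k x else 0)"
      by (rule sum.cong) (auto simp: \<phi>_u that)
    finally show ?thesis using that by simp
  qed
  have "crd m 0 y = 0" if "m < 8" for m
    using \<phi>y [of 0] \<phi>y [of 1] \<phi>y [of 2] \<phi>y [of 3] \<phi>y [of 4] \<phi>y [of 5] singular_top_components [OF y]
      less8 [OF that] three_sum_nonzero by (elim disjE) (simp_all add: \<phi>_def)
  then have "y = 0" using singular_eq_0 y by blast
  then show ?thesis by (simp add: y_def)
qed

subsection \<open>The contravariant form\<close>

text \<open>
  The Gram matrix of the contravariant form on \<open>V\<close> with \<open>(v, v) = 1\<close>, for which \<open>E\<^sub>i\<close> and \<open>F\<^sub>i\<close> are adjoint to each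
  other for \<open>i = 1, 2\<close>. Since the coproducts of \<open>E\<^sub>i\<close> and \<open>F\<^sub>i\<close> have the same shape, the product form on
  \<open>V \<otimes> V\<close> is contravariant too.
\<close>

definition gram :: "nat \<Rightarrow> nat \<Rightarrow> complex" where
  "gram k l = (if k \<in> {3, 4} then if k = l then two else if l \<in> {3, 4} then 1 else 0
     else if k = l then 1 else 0)"

definition G :: "complex^'n^'n" where
  "G = (\<chi> a c. \<Sum>k<8. \<Sum>l<8. gram k l * \<beta> k $ a * \<beta> l $ c)"

lemma G_b: assumes "m < 8" "n < 8" shows "dot (b m) (G *v b n) = gram m n"
proof -
  have "dot (b m) (G *v b n) = (\<Sum>a\<in>UNIV. \<Sum>c\<in>UNIV. \<Sum>k<8. \<Sum>l<8. gram k l * ((\<beta> k $ a * b m $ a) * (\<beta> l $ c * b n $ c)))"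
    by (simp add: dot_def G_def matrix_vector_mult_def sum_distrib_left sum_distrib_right ac_simps)
  also have "\<dots> = (\<Sum>a\<in>UNIV. \<Sum>k<8. \<Sum>l<8. gram k l * (\<beta> k $ a * b m $ a) * dot (\<beta> l) (b n))"
  proof (rule sum.cong [OF refl])
    fix a
    have "(\<Sum>c\<in>UNIV. \<Sum>k<8. \<Sum>l<8. gram k l * ((\<beta> k $ a * b m $ a) * (\<beta> l $ c * b n $ c))) =
      (\<Sum>k<8. \<Sum>l<8. \<Sum>c\<in>UNIV. gram k l * ((\<beta> k $ a * b m $ a) * (\<beta> l $ c * b n $ c)))"
      by (subst sum.swap, subst (2) sum.swap) (rule refl)
    then show "(\<Sum>c\<in>UNIV. \<Sum>k<8. \<Sum>l<8. gram k l * ((\<beta> k $ a * b m $ a) * (\<beta> l $ c * b n $ c))) =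
      (\<Sum>k<8. \<Sum>l<8. gram k l * (\<beta> k $ a * b m $ a) * dot (\<beta> l) (b n))"
      by (simp add: dot_def sum_distrib_left ac_simps)
  qed
  also have "\<dots> = (\<Sum>k<8. \<Sum>l<8. \<Sum>a\<in>UNIV. gram k l * (\<beta> k $ a * b m $ a) * dot (\<beta> l) (b n))"
    by (subst sum.swap, subst (2) sum.swap) (rule refl)
  also have "\<dots> = (\<Sum>k<8. \<Sum>l<8. gram k l * dot (\<beta> k) (b m) * dot (\<beta> l) (b n))"
    by (simp add: dot_def sum_distrib_left sum_distrib_right ac_simps)
  also have "\<dots> = (\<Sum>k<8. \<Sum>l<8. if l = n then if k = m then gram m n else 0 else 0)"
    by (intro sum.cong refl) (use assms in \<open>auto simp: \<beta>_b\<close>)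
  finally show ?thesis using assms by simp
qed

lemma dot_sum_left: "dot (\<Sum>i\<in>I. f i) x = (\<Sum>i\<in>I. dot (f i) x)"
  by (simp add: dot_commute [of _ x] dot_sum)

lemma bilinear_eqI:
  assumes "\<And>m n. m < 8 \<Longrightarrow> n < 8 \<Longrightarrow> dot (b m) (A *v b n) = dot (b m) (B *v b n)"
  shows "A = B"
proof -
  have "dot x (A *v y) = dot x (B *v y)" for x y
    by (subst (1 2) expand [of x], subst (1 2) expand [of y])
      (simp add: mult_vec_sum mult_vec_scale dot_sum dot_linear dot_sum_left assms cong: sum.cong_simp)
  then have "dot x ((A - B) *v y) = 0" for x y by (simp add: mat_vec_simps dot_linear)
  then have "(A - B) *v y = 0" for y using dot_eq_0I [of "(A - B) *v y"] by (simp add: dot_commute)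
  then show ?thesis by (simp add: mat_vec_simps matrix_eq)
qed

lemma gram_contravariant:
  assumes "m < 8" "n < 8" "i \<in> {1, 2}"
  shows "dot (E i *v b m) (G *v b n) = dot (b m) (G *v (F i *v b n))"
  using less8 [OF assms(1)] less8 [OF assms(2)] assms(3)
  by (elim disjE insertE; simp add: E_b F_b mat_vec_simps dot_linear G_b gram_def; fail)

lemma gram_weights: "m < 8 \<Longrightarrow> n < 8 \<Longrightarrow> gram m n \<noteq> 0 \<Longrightarrow> wt i m = wt i n \<and> root_coord i m = root_coord i n"
  by (auto simp: gram_def wt_def root_coord_def split: if_splits)

lemma contravariant_matrices:
  assumes "i \<in> {1, 2}"
  shows "transpose (E i) ** G = G ** F i" "transpose (S i) ** G = G ** S i" "transpose (Sinv i) ** G = G ** Sinv i"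
proof -
  have 1: "dot x ((transpose A ** G) *v y) = dot (A *v x) (G *v y)" for A x y
    by (simp add: dot_mult_vec mat_vec_simps)
  show "transpose (E i) ** G = G ** F i"
    by (rule bilinear_eqI) (simp add: 1, simp add: gram_contravariant [OF _ _ assms] mat_vec_simps)
  have "s powi wt i m * gram m n = s powi wt i n * gram m n" "s powi (- wt i m) * gram m n = s powi (- wt i n) * gram m n"
    if "m < 8" "n < 8" for m n using gram_weights [OF that, of i] by (cases "gram m n = 0"; simp)+
  then show "transpose (S i) ** G = G ** S i" "transpose (Sinv i) ** G = G ** Sinv i"
    by (intro bilinear_eqI; simp add: 1; simp add: S_b dot_linear mat_vec_simps G_b)+
qed

definition form :: "complex^('n \<times> 'n) \<Rightarrow> complex^('n \<times> 'n) \<Rightarrow> complex" where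
  "form x y = dot x (kron G G *v y)"

lemma form_contravariant:
  assumes "i \<in> {1, 2}" shows "form (genE T0 i *v x) y = form x (genF T0 i *v y)"
proof -
  have tr_add: "transpose (A + B) = transpose A + transpose B" for A B :: "complex^('n \<times> 'n)^('n \<times> 'n)"
    by (simp add: transpose_def vec_eq_iff)
  have "transpose (genE T0 i) ** kron G G = kron G G ** genF T0 i"
    by (simp add: tensor_gens EA_def EB_def FA_def FB_def tr_add transpose_kron matrix_add_rdistrib
        matrix_add_ldistrib kron_mult_kron contravariant_matrices [OF assms])
  then show ?thesis unfolding form_def dot_mult_vec by (simp only: matrix_vector_mul_assoc)
qed

lemma form_linear:
  "form (x + y) z = form x z + form y z" "form z (x + y) = form z x + form z y"
  "form (c *s x) z = c * form x z" "form z (c *s x) = c * form z x" "form 0 z = 0" "form z 0 = 0"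
  by (simp_all add: form_def dot_linear mat_vec_simps)

lemma form_t:
  assumes "m < 8" "n < 8" "k < 8" "l < 8"
  shows "form (t m n) (t k l) = gram m k * gram n l * q powi (- root_pairing m n)"
proof (cases "gram m k * gram n l = 0")
  case True
  then show ?thesis by (auto simp: form_def t_def dot_linear mat_vec_simps kron_mult_tensor_vec dot_tensor_vec G_b assms)
next
  case False
  then have "root_pairing k l = root_pairing m n"
    using gram_weights [of m k] gram_weights [of n l] assms by (simp add: root_pairing_def)
  then show ?thesis
    by (simp add: form_def t_def dot_linear mat_vec_simps kron_mult_tensor_vec dot_tensor_vec G_b assms s_powi_add
        mult.assoc [symmetric] flip: s_powi_double)
qed

lemma form_vl:
  assumes "valid xs" "valid ys"
  shows "form (vl xs) (vl ys) = (\<Sum>(m, n, c)\<leftarrow>xs. \<Sum>(k, l, d)\<leftarrow>ys. c * d * (gram m k * gram n l * q powi (- root_pairing m n)))"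
proof -
  have *: "form (t m n) (vl ys) = (\<Sum>(k, l, d)\<leftarrow>ys. d * (gram m k * gram n l * q powi (- root_pairing m n)))"
    if "m < 8" "n < 8" for m n
    using assms(2) by (induct ys) (auto simp: vl_simps form_linear form_t that)
  show ?thesis
    using assms(1) by (induct xs) (auto simp: vl_simps form_linear * split_def mult.assoc simp flip: sum_list_const_mult)
qed


lemma form_u_distinct:
  assumes "j < 6" "k < 6" "L j \<noteq> L k"
  shows "form (u j) (u k) = 0"
  using less6 [OF assms(1)] less6 [OF assms(2)] assms(3)
  by (elim disjE; simp add: u_def form_vl valid_U L_def; simp add: U_def gram_def)

lemma two_eq: "two = (1 + q ^ 2) / q"
  using q_nonzero by (simp add: two_def field_simps power2_eq_square)

lemma form_u_same:
  "form (u 0) (u 0) = q powi (- 2)" "form (u 1) (u 1) = (1 + q ^ 2) / q" "form (u 2) (u 2) = (1 + q ^ 2) / q"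
  "form (u 3) (u 3) = (1 + q ^ 2 + q ^ 4) ^ 2 / q" "form (u 4) (u 4) = (1 + q ^ 2 + q ^ 4) ^ 2 / q"
  "form (u 3) (u 4) = (1 + q ^ 2 + q ^ 4) * (1 + q ^ 2)" "form (u 4) (u 3) = (1 + q ^ 2 + q ^ 4) * (1 + q ^ 2)"
proof -
  show "form (u 0) (u 0) = q powi (- 2)" "form (u 1) (u 1) = (1 + q ^ 2) / q" "form (u 2) (u 2) = (1 + q ^ 2) / q"
  "form (u 3) (u 3) = (1 + q ^ 2 + q ^ 4) ^ 2 / q" "form (u 4) (u 4) = (1 + q ^ 2 + q ^ 4) ^ 2 / q"
  "form (u 3) (u 4) = (1 + q ^ 2 + q ^ 4) * (1 + q ^ 2)" "form (u 4) (u 3) = (1 + q ^ 2 + q ^ 4) * (1 + q ^ 2)"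
    using q_nonzero
    by (simp_all add: u_def form_vl valid_U; simp add: U_def gram_def root_pairing_def wt_def root_coord_def
        two_eq power_int_minus divide_simps; algebra)+
qed

lemma form_u_5: "form (u 5) (u 5) = q ^ 2 * (1 + q ^ 2 + q ^ 4) ^ 2 * (1 + q ^ 2) ^ 2 * (1 + q ^ 4)"
    using q_nonzero
    apply (simp add: u_def form_vl valid_U)
    apply (simp add: U_def gram_def root_pairing_def wt_def root_coord_def
        two_eq power_int_minus divide_simps)
    apply algebra
    done

text \<open>
  Distinct weights are orthogonal. The block of weight \<open>\<omega>\<^sub>1 + \<omega>\<^sub>2\<close> has determinant \<open>[3]\<^sup>2 [5]\<close> up to a power
  of \<open>q\<close>, and the other entries are products of factors \<open>1 + q\<^sup>2\<close>, \<open>1 + q\<^sup>4\<close>, \<open>1 + q\<^sup>2 + q\<^sup>4\<close>; none of them vanishes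
  since \<open>q\<close> is not a root of unity.
\<close>

lemma form_nondegenerate_singular:
  assumes "\<And>j. j < 6 \<Longrightarrow> form (u j) (\<Sum>k<6. c k *s u k) = 0" "k < 6"
  shows "c k = 0"
proof -
  let ?N = "1 + q ^ 2 + q ^ 4" and ?P = "1 + q ^ 2"
  have f: "form (u j) (\<Sum>k<6. c k *s u k) = (\<Sum>k<6. c k * form (u j) (u k))" for j
    by (simp add: sum6 form_linear)
  have e: "(\<Sum>k<6. c k * form (u j) (u k)) = 0" if "j < 6" for j using assms(1) [OF that] f by simp
  have 0: "c 0 = 0" using e [of 0] q_nonzero by (simp add: sum6 form_u_same form_u_distinct L_def)
  have 1: "c 1 = 0" using e [of 1] q_nonzero two_sum_nonzero by (simp add: sum6 form_u_same form_u_5 form_u_distinct L_def)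
  have 2: "c 2 = 0" using e [of 2] q_nonzero two_sum_nonzero by (simp add: sum6 form_u_same form_u_5 form_u_distinct L_def)
  have 5: "c 5 = 0" using e [of 5] q_nonzero two_sum_nonzero three_sum_nonzero four_sum_nonzero
    by (simp add: sum6 form_u_same form_u_5 form_u_distinct L_def)
  have "c 3 * (?N ^ 2 / q) + c 4 * (?N * ?P) = 0" "c 3 * (?N * ?P) + c 4 * (?N ^ 2 / q) = 0"
    using e [of 3] e [of 4] by (simp_all add: sum6 form_u_same form_u_5 form_u_distinct L_def)
  then have "?N * (c 3 * ?N + c 4 * (?P * q)) = 0" "?N * (c 3 * (?P * q) + c 4 * ?N) = 0"
    using q_nonzero by (simp_all add: field_simps power2_eq_square)
  then have 34: "c 3 * ?N + c 4 * (?P * q) = 0" "c 3 * (?P * q) + c 4 * ?N = 0"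
    using three_sum_nonzero by simp_all
  have "c 4 * (1 + q ^ 2 + q ^ 4 + q ^ 6 + q ^ 8) = 0" using 34 by algebra
  then have 4: "c 4 = 0" using five_sum_nonzero by simp
  then have 3: "c 3 = 0" using 34(1) three_sum_nonzero by simp
  show ?thesis using 0 1 2 3 4 5 less6 [OF assms(2)] by metis
qed

lemma form_u_sym: "j < 6 \<Longrightarrow> k < 6 \<Longrightarrow> form (u j) (u k) = form (u k) (u j)"
  using less6 [of j] less6 [of k] by (cases "L j = L k") (auto simp: form_u_distinct form_u_same L_def)

lemma G_injective: "G *v y = 0 \<Longrightarrow> y = 0"
proof -
  assume y: "G *v y = 0"
  have e0: "dot (b m) (G *v (\<Sum>n<8. dot (\<beta> n) y *s b n)) = 0" for m
    using y expand [of y] by (simp add: dot_linear)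
  have e: "(\<Sum>n<8. dot (\<beta> n) y * gram m n) = 0" if "m < 8" for m
    using that e0 [of m] by (simp add: mult_vec_sum mult_vec_scale dot_sum dot_linear G_b cong: sum.cong_simp)
  have 3: "dot (\<beta> 3) y * two + dot (\<beta> 4) y = 0" and 4: "dot (\<beta> 3) y + dot (\<beta> 4) y * two = 0"
    using e [of 3] e [of 4] by (simp_all add: sum8 gram_def)
  then have "dot (\<beta> 3) y * (two * two - 1) = 0" by algebra
  then have "dot (\<beta> 3) y = 0" using three_nonzero by simp
  moreover from this have "dot (\<beta> 4) y = 0" using 3 by simp
  moreover have "dot (\<beta> 0) y = 0" "dot (\<beta> 1) y = 0" "dot (\<beta> 2) y = 0" "dot (\<beta> 5) y = 0"
    "dot (\<beta> 6) y = 0" "dot (\<beta> 7) y = 0"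
    using e [of 0] e [of 1] e [of 2] e [of 5] e [of 6] e [of 7] by (simp_all add: sum8 gram_def)
  ultimately show "y = 0" by (subst expand8 [of y]) simp
qed

lemma form_representation:
  obtains B where "\<And>x y. form (B *v y) x = dot y x" "\<And>w. (\<forall>z. form w z = 0) \<Longrightarrow> w = 0"
proof -
  obtain C where C: "C ** G = mat 1"
    using matrix_left_invertible_ker [of G] G_injective by blast
  have CG: "kron C C ** kron G G = mat 1" by (simp add: kron_mult_kron C kron_mat_1)
  then have GC: "kron G G ** kron C C = mat 1" using matrix_left_right_inverse by blast
  show thesis
  proof
    show "form (transpose (kron C C) *v y) x = dot y x" for x y
      unfolding form_def dot_mult_vec by (simp add: matrix_vector_mul_assoc CG)
    fix w assume "\<forall>z. form w z = 0"
    then have "dot w (kron G G *v (kron C C *v z)) = 0" for z by (simp add: form_def)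
    then have "dot w z = 0" for z by (simp add: matrix_vector_mul_assoc GC)
    then show "w = 0" by (rule dot_eq_0I)
  qed
qed

definition height :: "nat \<Rightarrow> int" where
  "height k = root_coord 1 k + root_coord 2 k"

lemma row_height_zero:
  assumes "i \<in> {1, 2}" "\<And>m'. m' < 8 \<Longrightarrow> height m' = height m - 1 \<Longrightarrow> f m' = 0"
  shows "row i f m = 0"
proof -
  have 1: "(if a = m then d else 0) * f m' = 0" if "m' < 8" "(a, d) \<in> set (E_table q i m')" for a d m'
  proof (cases "a = m")
    case True
    have "height a = height m' + 1"
      using less8 [OF that(1)] assms(1) that(2)
      by (elim disjE insertE) (auto simp: E_table_def height_def root_coord_def)
    then show ?thesis using assms(2) [OF that(1)] True by simp
  qed simp
  have 2: "(\<Sum>x\<leftarrow>xs. h x) * c = 0" if "\<And>x. x \<in> set xs \<Longrightarrow> h x * c = 0" for xs :: "'a list" and h and c :: complex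
    using that by (induct xs) (auto simp: distrib_right)
  have "(\<Sum>(a, d) \<leftarrow> E_table q i m'. if a = m then d else 0) * f m' = 0" if "m' < 8" for m'
    unfolding split_def by (rule 2, rule 1 [OF that]) simp
  then show ?thesis unfolding row_def by (intro sum.neutral ballI) simp
qed

text \<open>
  The height of a weight grows by one under \<open>E\<^sub>1\<close> and \<open>E\<^sub>2\<close>, and the heights in \<open>V \<otimes> V\<close> range from \<open>-4\<close> to \<open>4\<close>.
\<close>

lemma raising_nilpotent:
  assumes Y: "\<And>i y. i \<in> {1, 2} \<Longrightarrow> y \<in> Y \<Longrightarrow> genE T0 i *v y \<in> Y" and x: "x \<in> Y" "x \<noteq> 0"
  shows "\<exists>y\<in>Y. y \<noteq> 0 \<and> genE T0 1 *v y = 0 \<and> genE T0 2 *v y = 0"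
proof -
  have "\<exists>y\<in>Y. y \<noteq> 0 \<and> genE T0 1 *v y = 0 \<and> genE T0 2 *v y = 0"
    if "x \<in> Y" "x \<noteq> 0" "\<And>m n. m < 8 \<Longrightarrow> n < 8 \<Longrightarrow> height m + height n < 5 - int j \<Longrightarrow> crd m n x = 0" for x j
    using that
  proof (induct j arbitrary: x)
    case 0
    have "crd m n x = 0" if "m < 8" "n < 8" for m n
      using 0(3) [OF that] less8 [OF that(1)] less8 [OF that(2)]
      by (elim disjE) (simp_all add: height_def root_coord_def)
    then have "x = 0" by (subst t_expand) simp
    with 0 show ?case by simp
  next
    case (Suc j)
    show ?case
    proof (cases "genE T0 1 *v x = 0 \<and> genE T0 2 *v x = 0")
      case False
      then obtain i where i: "i \<in> {1, 2}" "genE T0 i *v x \<noteq> 0" by blast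
      show ?thesis
      proof (rule Suc(1) [OF Y [OF i(1) Suc(2)] i(2)])
        fix m n assume mn: "m < 8" "n < 8" "height m + height n < 5 - int j"
        have "row i (\<lambda>m'. crd m' n x) m = 0" "row i (\<lambda>n'. crd m n' x) n = 0"
          using Suc(4) mn by (auto intro!: row_height_zero i(1))
        then show "crd m n (genE T0 i *v x) = 0" by (simp add: crd_E mn)
      qed
    qed (use Suc in blast)
  qed
  note * = this
  show ?thesis
  proof (rule * [OF x, of 9])
    fix m n :: nat assume mn: "m < 8" "n < 8" "height m + height n < 5 - int 9"
    then show "crd m n x = 0"
      using less8 [OF mn(1)] less8 [OF mn(2)] by (elim disjE) (simp_all add: height_def root_coord_def)
  qed
qed

lemma singular_not_lowered:
  assumes x: "genE T0 1 *v x = 0" "genE T0 2 *v x = 0" "x = genF T0 1 *v a + genF T0 2 *v c"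
  shows "x = 0"
proof -
  have "form (u j) x = 0" if "j < 6" for j
    unfolding x(3) using that by (simp add: form_linear E_u flip: form_contravariant)
  then have "\<phi> k x = 0" if "k < 6" for k
    using form_nondegenerate_singular [of "\<lambda>k. \<phi> k x", OF _ that] singular_expand [OF x(1,2)] by simp
  then show ?thesis by (subst singular_expand [OF x(1,2)]) simp
qed

text \<open>
  Complete reducibility in the form needed here. The orthogonal complement of a proper submodule that
  contains all singular vectors would be stable under the raising operators, hence contain a singular
  vector orthogonal to all singular vectors; but the form is nondegenerate on singular vectors.
\<close>

lemma generated_by_singular:
  assumes Y: "vec.subspace Y" "\<And>i x. i \<in> {1, 2} \<Longrightarrow> x \<in> Y \<Longrightarrow> genF T0 i *v x \<in> Y"
    and sing: "\<And>x. genE T0 1 *v x = 0 \<Longrightarrow> genE T0 2 *v x = 0 \<Longrightarrow> x \<in> Y"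
  shows "Y = UNIV"
proof (rule ccontr)
  assume "Y \<noteq> UNIV"
  then obtain a where a: "a \<noteq> 0" "\<And>x. x \<in> Y \<Longrightarrow> dot a x = 0"
    using proper_subspace_annihilator [OF Y(1)] by blast
  obtain B where B: "\<And>x y. form (B *v y) x = dot y x" by (rule form_representation) blast
  let ?O = "{y. \<forall>x\<in>Y. form y x = 0}"
  have "B *v a \<noteq> 0"
  proof
    assume "B *v a = 0"
    then have "dot a x = 0" for x using B [of a x] by (simp add: form_linear)
    then show False using a(1) dot_eq_0I by blast
  qed
  moreover have "B *v a \<in> ?O" using a(2) B by simp
  moreover have "genE T0 i *v y \<in> ?O" if "i \<in> {1, 2}" "y \<in> ?O" for i y
    using that Y(2) by (auto simp: form_contravariant)
  ultimately obtain y where y: "y \<in> ?O" "y \<noteq> 0" "genE T0 1 *v y = 0" "genE T0 2 *v y = 0"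
    using raising_nilpotent [of ?O "B *v a"] by blast
  have "form (\<Sum>k<6. \<phi> k y *s u k) (u j) = 0" if "j < 6" for j
    using y(1) sing [OF E_u E_u] that singular_expand [OF y(3,4)] by auto
  then have "form (u j) (\<Sum>k<6. \<phi> k y *s u k) = 0" if "j < 6" for j
    using that by (simp add: sum6 form_linear form_u_sym [OF that])
  then have "\<phi> k y = 0" if "k < 6" for k
    using form_nondegenerate_singular [of "\<lambda>k. \<phi> k y", OF _ that] by simp
  then have "y = 0" by (subst singular_expand [OF y(3,4)]) simp
  with y(2) show False ..
qed

sublocale split: split_module q T0 6 u L \<phi>
proof
  have rel: "\<forall>i. invertible (genK T0 i)"
    "\<forall>i j. genK T0 i ** genE T0 j = (q powi cartan i j) *k (genE T0 j ** genK T0 i)"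
    "\<forall>i j. genK T0 i ** genF T0 j = (q powi (- cartan i j)) *k (genF T0 j ** genK T0 i)"
    "\<forall>i j. genE T0 i ** genF T0 j - genF T0 j ** genE T0 i =
        (if i = j then inverse (q - inverse q) *k (genK T0 i - matrix_inv (genK T0 i)) else 0)"
    using tensor_relations(1) unfolding weight_relations_def by blast+
  fix i j :: 3
  show "invertible (genK T0 i)"
    "genK T0 i ** genE T0 j = (q powi cartan i j) *k (genE T0 j ** genK T0 i)"
    "genK T0 i ** genF T0 j = (q powi (- cartan i j)) *k (genF T0 j ** genK T0 i)"
    "genE T0 i ** genF T0 j - genF T0 j ** genE T0 i =
        (if i = j then inverse (q - inverse q) *k (genK T0 i - matrix_inv (genK T0 i)) else 0)"
    using rel by blast+
qed (fact q_nonzero q_generic u_singular \<phi>_u \<phi>_linear singular_expand singular_not_lowered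
    generated_by_singular raising_nilpotent)+

end

section \<open>The affine raising operator on singular vectors\<close>

definition F_lift :: "complex \<Rightarrow> 3 \<Rightarrow> terms \<Rightarrow> terms" where
  "F_lift q i xs = lift_left (F_table q i) (\<lambda>n. 1) xs @ lift_right (F_table q i) (\<lambda>m. q powi (- wt i m)) xs"

context adjoint_square
begin

abbreviation "F1 x \<equiv> genF T0 1 *v x"
abbreviation "F2 x \<equiv> genF T0 2 *v x"

lemma valid_lift_table:
  assumes T: "\<And>k m d. k < 8 \<Longrightarrow> (m, d) \<in> set (T k) \<Longrightarrow> m < 8"
  shows "valid xs \<Longrightarrow> valid (lift_left T f xs)" "valid xs \<Longrightarrow> valid (lift_right T f xs)"
proof -
  have *: "valid (map (\<lambda>(m', d). (m', n, c * d * w)) (T m))" "valid (map (\<lambda>(n', d). (n, n', c * d * w)) (T m))"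
    if "m < 8" "n < 8" for m n c w
    using T [OF that(1)] that by (auto simp: valid_def)
  show "valid xs \<Longrightarrow> valid (lift_left T f xs)" "valid xs \<Longrightarrow> valid (lift_right T f xs)"
    by (induct xs) (auto simp: *)
qed

lemma valid_lift:
  "valid xs \<Longrightarrow> i \<in> {1, 2} \<Longrightarrow> valid (F_lift q i xs)"
  "valid xs \<Longrightarrow> valid (lift_left (E_table q j) f xs)"
  "valid xs \<Longrightarrow> valid (lift_right (E_table q j) f xs)"
  unfolding F_lift_def
  using valid_lift_table [of "F_table q i"] F_table_weights(1) [of _ i]
    valid_lift_table [of "E_table q j"] E_table_weights(1) [of _ _ _ q j]
  by (meson valid_simps(3))+

lemma F_step:
  assumes "i \<in> {1, 2}" "valid xs" "valid ys"
    and "list_all (\<lambda>(m, n, c). coef (F_lift q i xs) m n = coef ys m n) (F_lift q i xs @ ys)"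
  shows "genF T0 i *v vl xs = vl ys"
proof -
  have "genF T0 i *v vl xs = vl (F_lift q i xs)"
    using assms(1,2) by (simp add: tensor_gens mat_vec_simps vl_ops vl_simps F_lift_def)
  also have "\<dots> = vl ys" using assms by (intro vl_eqI valid_lift)
  finally show ?thesis .
qed

text \<open>
  The monomials in \<open>F\<^sub>1, F\<^sub>2\<close> that are needed to express \<open>E\<^sub>0\<close> on singular vectors. Each is computed from
  a shorter one.
\<close>

lemma words_0_1:
  "F2 (u 0) = vl [(2, 0, 1), (0, 2, 1 / q)]"
  "F1 (u 0) = vl [(1, 0, 1), (0, 1, 1 / q)]"
  unfolding u_def by (rule F_step; simp add: U_def F_table_def wt_def F_lift_def power_int_minus q_nonzero divide_simps; algebra?)+

lemma words_0_2:
  "F1 (F2 (u 0)) = vl [(4, 0, 1), (2, 1, 1 / q ^ 2), (1, 2, 1 / q), (0, 4, 1 / q ^ 2)]"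
  "F2 (F1 (u 0)) = vl [(3, 0, 1), (2, 1, 1 / q), (1, 2, 1 / q ^ 2), (0, 3, 1 / q ^ 2)]"
  "F2 (F2 (u 0)) = vl [(2, 2, (1 + q ^ 2) / q)]"
  "F1 (F1 (u 0)) = vl [(1, 1, (1 + q ^ 2) / q)]"
  unfolding words_0_1 by (rule F_step; simp add: F_table_def wt_def F_lift_def power_int_minus q_nonzero divide_simps; algebra?)+

lemma words_0_3:
  "F1 (F2 (F2 (u 0))) = vl [(4, 2, (1 + q ^ 2) / q), (2, 4, (1 + q ^ 2) / q ^ 3)]"
  "F2 (F2 (F1 (u 0))) = vl [(6, 0, (1 + q ^ 2) / q), (3, 2, (1 + q ^ 2) / q ^ 2), (2, 3, (1 + q ^ 2) / q ^ 2), (0, 6, (1 + q ^ 2) / q ^ 4)]"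
  "F2 (F1 (F1 (u 0))) = vl [(3, 1, (1 + q ^ 2) / q), (1, 3, (1 + q ^ 2) / q ^ 3)]"
  "F1 (F1 (F2 (u 0))) = vl [(5, 0, (1 + q ^ 2) / q), (4, 1, (1 + q ^ 2) / q ^ 2), (1, 4, (1 + q ^ 2) / q ^ 2), (0, 5, (1 + q ^ 2) / q ^ 4)]"
  unfolding words_0_2 by (rule F_step; simp add: F_table_def wt_def F_lift_def power_int_minus q_nonzero divide_simps; algebra?)+

lemma words_0_4:
  "F1 (F2 (F2 (F1 (u 0)))) = vl [(7, 0, (1 + q ^ 2) / q), (6, 1, (1 + q ^ 2) / q ^ 2), (5, 2, (1 + q ^ 2) / q ^ 2), (4, 3, (1 + q ^ 2) / q ^ 2), (3, 4, (1 + q ^ 2) / q ^ 2), (2, 5, (1 + q ^ 2) / q ^ 4), (1, 6, (1 + q ^ 2) / q ^ 4), (0, 7, (1 + q ^ 2) / q ^ 5)]"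
  "F1 (F1 (F2 (F2 (u 0)))) = vl [(5, 2, (1 + 2 * q ^ 2 + q ^ 4) / q ^ 2), (4, 4, (1 + 2 * q ^ 2 + q ^ 4) / q ^ 3), (2, 5, (1 + 2 * q ^ 2 + q ^ 4) / q ^ 6)]"
  "F2 (F2 (F1 (F1 (u 0)))) = vl [(6, 1, (1 + 2 * q ^ 2 + q ^ 4) / q ^ 2), (3, 3, (1 + 2 * q ^ 2 + q ^ 4) / q ^ 3), (1, 6, (1 + 2 * q ^ 2 + q ^ 4) / q ^ 6)]"
  unfolding words_0_3 by (rule F_step; simp add: F_table_def wt_def F_lift_def power_int_minus q_nonzero divide_simps; algebra?)+

lemma words_1_1:
  "F1 (u 1) = vl [(4, 0, 1), (2, 1, 1 / q ^ 2), (1, 2, - q), (0, 4, - 1)]"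
  unfolding u_def by (rule F_step; simp add: U_def F_table_def wt_def F_lift_def power_int_minus q_nonzero divide_simps; algebra?)+

lemma words_1_2:
  "F2 (F1 (u 1)) = vl [(6, 0, 1), (4, 2, 1), (3, 2, - q), (2, 4, - 1), (2, 3, 1 / q), (0, 6, (- 1) / q)]"
  unfolding words_1_1 by (rule F_step; simp add: F_table_def wt_def F_lift_def power_int_minus q_nonzero divide_simps; algebra?)+

lemma words_1_3:
  "F1 (F2 (F1 (u 1))) = vl [(7, 0, 1), (6, 1, 1 / q), (5, 2, 1 / q), (4, 3, 1 / q), (3, 4, - q), (2, 5, (- 1) / q), (1, 6, (- 1) / q), (0, 7, (- 1) / q ^ 2)]"
  unfolding words_1_2 by (rule F_step; simp add: F_table_def wt_def F_lift_def power_int_minus q_nonzero divide_simps; algebra?)+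

lemma words_2_1:
  "F2 (u 2) = vl [(3, 0, 1), (2, 1, - q), (1, 2, 1 / q ^ 2), (0, 3, - 1)]"
  unfolding u_def by (rule F_step; simp add: U_def F_table_def wt_def F_lift_def power_int_minus q_nonzero divide_simps; algebra?)+

lemma words_2_2:
  "F1 (F2 (u 2)) = vl [(5, 0, 1), (4, 1, - q), (3, 1, 1), (1, 3, - 1), (1, 4, 1 / q), (0, 5, (- 1) / q)]"
  unfolding words_2_1 by (rule F_step; simp add: F_table_def wt_def F_lift_def power_int_minus q_nonzero divide_simps; algebra?)+

lemma words_2_3:
  "F2 (F1 (F2 (u 2))) = vl [(7, 0, 1), (6, 1, 1 / q), (5, 2, 1 / q), (4, 3, - q), (3, 4, 1 / q), (2, 5, (- 1) / q), (1, 6, (- 1) / q), (0, 7, (- 1) / q ^ 2)]"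
  unfolding words_2_2 by (rule F_step; simp add: F_table_def wt_def F_lift_def power_int_minus q_nonzero divide_simps; algebra?)+

lemma words_3_1:
  "F2 (u 3) = vl [(6, 0, 1), (4, 2, 1), (3, 2, - q), (2, 3, - q), (0, 6, q + q ^ 3)]"
  "F1 (u 3) = vl [(5, 0, (1 + q ^ 2) / q), (4, 1, - (q ^ 2)), (1, 3, q ^ 3), (1, 4, - (q ^ 2)), (0, 5, q ^ 2)]"
  unfolding u_def by (rule F_step; simp add: U_def F_table_def wt_def F_lift_def power_int_minus q_nonzero divide_simps; algebra?)+

lemma words_3_2:
  "F1 (F2 (u 3)) = vl [(7, 0, 1), (6, 1, 1 / q), (5, 2, 1 / q), (4, 3, - q), (4, 4, 1), (3, 4, - q), (2, 5, (- 1) / q), (1, 6, q + q ^ 3), (0, 7, 1 + q ^ 2)]"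
  "F2 (F1 (u 3)) = vl [(7, 0, (1 + q ^ 2) / q), (6, 1, - (q ^ 2)), (5, 2, (1 + q ^ 2) / q ^ 2), (4, 3, - (q ^ 2)), (3, 3, q ^ 3), (3, 4, - (q ^ 2)), (2, 5, q ^ 2), (1, 6, q ^ 2), (0, 7, q)]"
  unfolding words_3_1 by (rule F_step; simp add: F_table_def wt_def F_lift_def power_int_minus q_nonzero divide_simps; algebra?)+

lemma words_3_3:
  "F2 (F2 (F1 (u 3))) = vl [(7, 2, (1 + 2 * q ^ 2 + q ^ 4) / q ^ 2), (6, 4, - q - q ^ 3), (4, 6, - q - q ^ 3), (3, 6, q ^ 2 + q ^ 4), (2, 7, q + q ^ 3)]"
  unfolding words_3_2 by (rule F_step; simp add: F_table_def wt_def F_lift_def power_int_minus q_nonzero divide_simps; algebra?)+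

lemma words_3_4:
  "F1 (F2 (F2 (F1 (u 3)))) = vl [(7, 4, (1 + q ^ 2) / q), (6, 5, (- 1 - 2 * q ^ 2 - q ^ 4) / q), (5, 6, - 1 - q ^ 2), (3, 7, q ^ 2 + q ^ 4)]"
  unfolding words_3_3 by (rule F_step; simp add: F_table_def wt_def F_lift_def power_int_minus q_nonzero divide_simps; algebra?)+

lemma words_4_1:
  "F2 (u 4) = vl [(6, 0, (1 + q ^ 2) / q), (3, 2, - (q ^ 2)), (2, 4, q ^ 3), (2, 3, - (q ^ 2)), (0, 6, q ^ 2)]"
  "F1 (u 4) = vl [(5, 0, 1), (4, 1, - q), (3, 1, 1), (1, 4, - q), (0, 5, q + q ^ 3)]"
  unfolding u_def by (rule F_step; simp add: U_def F_table_def wt_def F_lift_def power_int_minus q_nonzero divide_simps; algebra?)+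

lemma words_4_2:
  "F1 (F2 (u 4)) = vl [(7, 0, (1 + q ^ 2) / q), (6, 1, (1 + q ^ 2) / q ^ 2), (5, 2, - (q ^ 2)), (4, 4, q ^ 3), (4, 3, - (q ^ 2)), (3, 4, - (q ^ 2)), (2, 5, q ^ 2), (1, 6, q ^ 2), (0, 7, q)]"
  "F2 (F1 (u 4)) = vl [(7, 0, 1), (6, 1, 1 / q), (5, 2, 1 / q), (4, 3, - q), (3, 4, - q), (3, 3, 1), (2, 5, q + q ^ 3), (1, 6, (- 1) / q), (0, 7, 1 + q ^ 2)]"
  unfolding words_4_1 by (rule F_step; simp add: F_table_def wt_def F_lift_def power_int_minus q_nonzero divide_simps; algebra?)+

lemma words_4_3:
  "F2 (F2 (F1 (u 4))) = vl [(7, 2, (1 + q ^ 2) / q), (6, 4, - 1 - q ^ 2), (6, 3, (1 + q ^ 2) / q), (4, 6, - 1 - q ^ 2), (2, 7, 1 + 2 * q ^ 2 + q ^ 4)]"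
  unfolding words_4_2 by (rule F_step; simp add: F_table_def wt_def F_lift_def power_int_minus q_nonzero divide_simps; algebra?)+

lemma words_4_4:
  "F1 (F2 (F2 (F1 (u 4)))) = vl [(7, 3, (1 + q ^ 2) / q), (6, 5, - 1 - q ^ 2), (5, 6, (- 1 - 2 * q ^ 2 - q ^ 4) / q), (4, 7, q ^ 2 + q ^ 4)]"
  unfolding words_4_3 by (rule F_step; simp add: F_table_def wt_def F_lift_def power_int_minus q_nonzero divide_simps; algebra?)+

text \<open>
  Up to powers of \<open>q\<close>, \<open>P2\<close>, \<open>P3\<close>, \<open>P5\<close> are the quantum integers \<open>[2]\<close>, \<open>[3]\<close>, \<open>[5]\<close>, and \<open>Q4\<close> is \<open>[4] / [2]\<close>. These are
  the denominators that occur when vectors are decomposed into isotypic components.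
\<close>

abbreviation "P2 \<equiv> 1 + q ^ 2"
abbreviation "P3 \<equiv> 1 + q ^ 2 + q ^ 4"
abbreviation "P5 \<equiv> 1 + q ^ 2 + q ^ 4 + q ^ 6 + q ^ 8"
abbreviation "Q4 \<equiv> 1 + q ^ 4"
abbreviation "pe \<equiv> 1 + q ^ 2 + 2 * q ^ 4 + q ^ 6"
abbreviation "ph \<equiv> 1 + 2 * q ^ 2 + q ^ 4 + q ^ 6"
abbreviation "a12 \<equiv> 1 + q ^ 4 + q ^ 6 + q ^ 8"
abbreviation "a21 \<equiv> 1 + q ^ 2 + q ^ 4 + q ^ 8"
abbreviation "C3 \<equiv> q ^ 3 * P2 ^ 3 * Q4"

text \<open>
  The components of \<open>A u\<^sub>k\<close> and \<open>B u\<^sub>k\<close> in the isotypic component of \<open>u\<^sub>0\<close> are proportional, and likewise for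
  \<open>u\<^sub>1\<close> and \<open>u\<^sub>2\<close>; for \<open>k = 3, 4\<close> they are even proportional to a common vector. The vectors \<open>Y\<close> span these
  lines for \<open>u\<^sub>0\<close> (with \<open>Y3\<close> serving both \<open>k = 3, 4\<close>), the vectors \<open>X\<close> those for \<open>u\<^sub>1\<close> and \<open>u\<^sub>2\<close>, scaled such that
  the remaining coefficients in the expansions below are short.
\<close>

definition Y0 :: "complex^('n \<times> 'n)" where
  "Y0 = (- (P3 * q ^ 5 * ph)) *s (F1 (F2 (u 0))) + (P3 * q ^ 4 * pe) *s (F2 (F1 (u 0)))"

definition Y1 :: "complex^('n \<times> 'n)" where
  "Y1 = (q ^ 8 * P3) *s (F1 (F2 (F2 (u 0)))) + (- (q ^ 10)) *s (F2 (F2 (F1 (u 0))))"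

definition Y2 :: "complex^('n \<times> 'n)" where
  "Y2 = (q ^ 4 * P3) *s (F2 (F1 (F1 (u 0)))) + (- (q ^ 6)) *s (F1 (F1 (F2 (u 0))))"

definition Y3 :: "complex^('n \<times> 'n)" where
  "Y3 = (q ^ 8 * (1 + q ^ 2 + 3 * q ^ 4 + q ^ 6 + q ^ 8)) *s (F1 (F2 (F2 (F1 (u 0))))) + (- (q ^ 10 * P3)) *s (F1 (F1 (F2 (F2 (u 0))))) + (- (q ^ 10 * P3)) *s (F2 (F2 (F1 (F1 (u 0)))))"

definition X01 :: "complex^('n \<times> 'n)" where
  "X01 = (q ^ 5 * P5) *s (F1 (u 1))"

definition X02 :: "complex^('n \<times> 'n)" where
  "X02 = (q ^ 2 * P5) *s (F2 (u 2))"

definition X11 :: "complex^('n \<times> 'n)" where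
  "X11 = (q ^ 3 * P2 * P5) *s (F2 (F1 (u 1)))"

definition X22 :: "complex^('n \<times> 'n)" where
  "X22 = (- (q ^ 3 * P2 * P5)) *s (F1 (F2 (u 2)))"

definition X31 :: "complex^('n \<times> 'n)" where
  "X31 = (q ^ 5 * P2 * Q4 * P5) *s (F1 (F2 (F1 (u 1))))"

definition X32 :: "complex^('n \<times> 'n)" where
  "X32 = (q ^ 7 * P2 * Q4 * P5) *s (F2 (F1 (F2 (u 2))))"

lemmas atom_defs = Y0_def Y1_def Y2_def Y3_def X01_def X02_def X11_def X22_def X31_def X32_def

lemma numeral_less6: "(0::nat) < 6" "(1::nat) < 6" "(2::nat) < 6" "(3::nat) < 6" "(4::nat) < 6" "(5::nat) < 6"
  by simp_all

lemma vl_eqI_keys: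
  assumes "valid xs" "valid ys" "list_all (\<lambda>(m, n, c). (m, n) \<in> set ks) (xs @ ys)"
    and "list_all (\<lambda>(m, n). coef xs m n = coef ys m n) ks"
  shows "vl xs = vl ys"
  using assms by (intro vl_eqI) (fastforce simp: list_all_iff)+

text \<open>
  The expansions of \<open>A u\<^sub>k\<close> and \<open>B u\<^sub>k\<close>, multiplied by common denominators. They are obtained by
  solving linear equations in the weight spaces and are verified here by comparing coordinates.
\<close>

lemma EA_u0: "(q * P2 * P3 * P5) *s (EA 0 *v u 0) =
    (1) *s Y0 + (- 1) *s X01 + (1) *s X02 + (- (P2 * q * ph)) *s u 3 + (P2 * pe) *s u 4"
  unfolding atom_defs words_0_2 words_1_1 words_2_1
  unfolding u_def vl_ops(1,2) [OF valid_U, OF numeral_less6(1)] vl_scale vl_simps(3) [symmetric]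
  by (rule vl_eqI_keys [where ks = "[(0, 3), (0, 4), (1, 2), (2, 1), (3, 0), (4, 0)]"]; simp add: U_def E_table_def wt_def power_int_minus q_nonzero divide_simps; algebra?)

lemma EB_u0: "(q * P2 * P3 * P5) *s (EB 0 *v u 0) =
    (1) *s Y0 + (q ^ 2) *s X01 + (- (q ^ 2)) *s X02 + (P2 * q ^ 5 * pe) *s u 3 + (- (P2 * q ^ 6 * ph)) *s u 4"
  unfolding atom_defs words_0_2 words_1_1 words_2_1
  unfolding u_def vl_ops(1,2) [OF valid_U, OF numeral_less6(1)] vl_scale vl_simps(3) [symmetric]
  by (rule vl_eqI_keys [where ks = "[(0, 3), (0, 4), (1, 2), (2, 1), (3, 0), (4, 0)]"]; simp add: U_def E_table_def wt_def power_int_minus q_nonzero divide_simps; algebra?)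

lemma EA_u1: "(q * P2 ^ 2 * P5) *s (EA 0 *v u 1) =
    (q ^ 2) *s Y1 + (1) *s X11 + (P2 ^ 2 * q ^ 5) *s (F2 (u 3)) + (P2 ^ 2) *s (F2 (u 4))"
  unfolding atom_defs words_0_3 words_1_2 words_3_1 words_4_1
  unfolding u_def vl_ops(1,2) [OF valid_U, OF numeral_less6(2)] vl_scale vl_simps(3) [symmetric]
  by (rule vl_eqI_keys [where ks = "[(0, 6), (2, 3), (2, 4), (3, 2), (4, 2), (6, 0)]"]; simp add: U_def E_table_def wt_def power_int_minus q_nonzero divide_simps; algebra?)

lemma EB_u1: "(q * P2 ^ 2 * P5) *s (EB 0 *v u 1) =
    (- 1) *s Y1 + (1) *s X11 + (- (P2 ^ 2 * q ^ 3)) *s (F2 (u 3)) + (- (P2 ^ 2 * q ^ 8)) *s (F2 (u 4))"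
  unfolding atom_defs words_0_3 words_1_2 words_3_1 words_4_1
  unfolding u_def vl_ops(1,2) [OF valid_U, OF numeral_less6(2)] vl_scale vl_simps(3) [symmetric]
  by (rule vl_eqI_keys [where ks = "[(0, 6), (2, 3), (2, 4), (3, 2), (4, 2), (6, 0)]"]; simp add: U_def E_table_def wt_def power_int_minus q_nonzero divide_simps; algebra?)

lemma EA_u2: "(P2 ^ 2 * P5) *s (EA 0 *v u 2) =
    (- (q ^ 2)) *s Y2 + (1) *s X22 + (- (P2 ^ 2 * q ^ 6)) *s (F1 (u 3)) + (- (P2 ^ 2 * q)) *s (F1 (u 4))"
  unfolding atom_defs words_0_3 words_2_2 words_3_1 words_4_1
  unfolding u_def vl_ops(1,2) [OF valid_U, OF numeral_less6(3)] vl_scale vl_simps(3) [symmetric]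
  by (rule vl_eqI_keys [where ks = "[(0, 5), (1, 3), (1, 4), (3, 1), (4, 1), (5, 0)]"]; simp add: U_def E_table_def wt_def power_int_minus q_nonzero divide_simps; algebra?)

lemma EB_u2: "(P2 ^ 2 * P5) *s (EB 0 *v u 2) =
    (1) *s Y2 + (1) *s X22 + (P2 ^ 2 * q ^ 4) *s (F1 (u 3)) + (P2 ^ 2 * q ^ 9) *s (F1 (u 4))"
  unfolding atom_defs words_0_3 words_2_2 words_3_1 words_4_1
  unfolding u_def vl_ops(1,2) [OF valid_U, OF numeral_less6(3)] vl_scale vl_simps(3) [symmetric]
  by (rule vl_eqI_keys [where ks = "[(0, 5), (1, 3), (1, 4), (3, 1), (4, 1), (5, 0)]"]; simp add: U_def E_table_def wt_def power_int_minus q_nonzero divide_simps; algebra?)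

lemma EA_u3: "(q ^ 3 * P2 ^ 3 * Q4 * P5) *s (EA 0 *v u 3) =
    (- (q ^ 8)) *s Y3 + (- (q ^ 4)) *s X31 + (q ^ 4) *s X32 + (- (C3 * q ^ 2)) *s (F1 (F2 (u 3))) + (- (C3 * q ^ 7)) *s (F1 (F2 (u 4))) + (C3 * q * a21) *s (F2 (F1 (u 3))) + (- (C3 * q ^ 2)) *s (F2 (F1 (u 4))) + (q * P2 * P5) *s u 5"
  unfolding atom_defs words_0_4 words_1_3 words_2_3 words_3_2 words_4_2
  unfolding u_def vl_ops(1,2) [OF valid_U, OF numeral_less6(4)] vl_scale vl_simps(3) [symmetric]
  by (rule vl_eqI_keys [where ks = "[(0, 7), (1, 6), (2, 5), (3, 3), (3, 4), (4, 3), (4, 4), (5, 2), (6, 1), (7, 0)]"]; simp add: U_def E_table_def wt_def power_int_minus q_nonzero divide_simps; algebra?)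

lemma EB_u3: "(q ^ 3 * P2 ^ 3 * Q4 * P5) *s (EB 0 *v u 3) =
    (1) *s Y3 + (1) *s X31 + (- 1) *s X32 + (- (C3 * q ^ 2 * a12)) *s (F1 (F2 (u 3))) + (C3 * q ^ 9) *s (F1 (F2 (u 4))) + (C3 * q ^ 9) *s (F2 (F1 (u 3))) + (C3 * q ^ 4) *s (F2 (F1 (u 4))) + (- (q ^ 9 * P2 * P5)) *s u 5"
  unfolding atom_defs words_0_4 words_1_3 words_2_3 words_3_2 words_4_2
  unfolding u_def vl_ops(1,2) [OF valid_U, OF numeral_less6(4)] vl_scale vl_simps(3) [symmetric]
  by (rule vl_eqI_keys [where ks = "[(0, 7), (1, 6), (2, 5), (3, 3), (3, 4), (4, 3), (4, 4), (5, 2), (6, 1), (7, 0)]"]; simp add: U_def E_table_def wt_def power_int_minus q_nonzero divide_simps; algebra?)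

lemma EA_u4: "(q ^ 3 * P2 ^ 3 * Q4 * P5) *s (EA 0 *v u 4) =
    (q ^ 5) *s Y3 + (- (q ^ 3)) *s X31 + (q ^ 3) *s X32 + (C3 * q ^ 9) *s (F1 (F2 (u 3))) + (- (C3 * q ^ 2 * a12)) *s (F1 (F2 (u 4))) + (C3 * q ^ 4) *s (F2 (F1 (u 3))) + (C3 * q ^ 9) *s (F2 (F1 (u 4))) + (- (q ^ 6 * P2 * P5)) *s u 5"
  unfolding atom_defs words_0_4 words_1_3 words_2_3 words_3_2 words_4_2
  unfolding u_def vl_ops(1,2) [OF valid_U, OF numeral_less6(5)] vl_scale vl_simps(3) [symmetric]
  by (rule vl_eqI_keys [where ks = "[(0, 7), (1, 6), (2, 5), (3, 3), (3, 4), (4, 3), (4, 4), (5, 2), (6, 1), (7, 0)]"]; simp add: U_def E_table_def wt_def power_int_minus q_nonzero divide_simps; algebra?)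

lemma EB_u4: "(q ^ 3 * P2 ^ 3 * Q4 * P5) *s (EB 0 *v u 4) =
    (- (q ^ 3)) *s Y3 + (q) *s X31 + (- q) *s X32 + (- (C3 * q ^ 7)) *s (F1 (F2 (u 3))) + (- (C3 * q ^ 2)) *s (F1 (F2 (u 4))) + (- (C3 * q ^ 2)) *s (F2 (F1 (u 3))) + (C3 * q * a21) *s (F2 (F1 (u 4))) + (q ^ 4 * P2 * P5) *s u 5"
  unfolding atom_defs words_0_4 words_1_3 words_2_3 words_3_2 words_4_2
  unfolding u_def vl_ops(1,2) [OF valid_U, OF numeral_less6(5)] vl_scale vl_simps(3) [symmetric]
  by (rule vl_eqI_keys [where ks = "[(0, 7), (1, 6), (2, 5), (3, 3), (3, 4), (4, 3), (4, 4), (5, 2), (6, 1), (7, 0)]"]; simp add: U_def E_table_def wt_def power_int_minus q_nonzero divide_simps; algebra?)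

lemma EA_u5: "(P2) *s (EA 0 *v u 5) =
    (q ^ 5 * P3) *s (F1 (F2 (F2 (F1 (u 3))))) + (- (q ^ 6 * P3)) *s (F1 (F2 (F2 (F1 (u 4)))))"
  unfolding atom_defs words_3_4 words_4_4
  unfolding u_def vl_ops(1,2) [OF valid_U, OF numeral_less6(6)] vl_scale vl_simps(3) [symmetric]
  by (rule vl_eqI_keys [where ks = "[(3, 7), (4, 7), (5, 6), (6, 5), (7, 3), (7, 4)]"]; simp add: U_def E_table_def wt_def power_int_minus q_nonzero divide_simps; algebra?)

lemma EB_u5: "(P2) *s (EB 0 *v u 5) =
    (- (q ^ 3 * P3)) *s (F1 (F2 (F2 (F1 (u 3))))) + (q ^ 2 * P3) *s (F1 (F2 (F2 (F1 (u 4)))))"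
  unfolding atom_defs words_3_4 words_4_4
  unfolding u_def vl_ops(1,2) [OF valid_U, OF numeral_less6(6)] vl_scale vl_simps(3) [symmetric]
  by (rule vl_eqI_keys [where ks = "[(3, 7), (4, 7), (5, 6), (6, 5), (7, 3), (7, 4)]"]; simp add: U_def E_table_def wt_def power_int_minus q_nonzero divide_simps; algebra?)

end

section \<open>The intertwiner\<close>

text \<open>
  Comparison of coefficients for \<open>R (z A + B) u = (A + z B) R u\<close> when \<open>R u = r u\<close>. On \<open>x0, x1, x2\<close> the operator
  \<open>R\<close> acts by scalars, on the pair \<open>x3, x4\<close> by a two by two matrix.
\<close>

lemma intertwine_scalar:
  fixes R :: "complex^'m^'m"
  assumes A: "Z *s Au = a0 *s x0 + a1 *s x1 + a2 *s x2 + a3 *s x3 + a4 *s x4"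
    and B: "Z *s Bu = b0 *s x0 + b1 *s x1 + b2 *s x2 + b3 *s x3 + b4 *s x4"
    and R: "R *v x0 = r0 *s x0" "R *v x1 = r1 *s x1" "R *v x2 = r2 *s x2"
      "R *v x3 = m33 *s x3 + m43 *s x4" "R *v x4 = m34 *s x3 + m44 *s x4"
    and Z: "Z \<noteq> 0"
    and e: "(z * a0 + b0) * r0 = r * (a0 + z * b0)" "(z * a1 + b1) * r1 = r * (a1 + z * b1)"
      "(z * a2 + b2) * r2 = r * (a2 + z * b2)"
      "(z * a3 + b3) * m33 + (z * a4 + b4) * m34 = r * (a3 + z * b3)"
      "(z * a3 + b3) * m43 + (z * a4 + b4) * m44 = r * (a4 + z * b4)"
  shows "R *v (z *s Au + Bu) = r *s (Au + z *s Bu)"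
proof -
  have "Z *s (R *v (z *s Au + Bu)) = R *v (z *s (Z *s Au) + Z *s Bu)"
    by (simp add: mat_vec_simps vec.scale_right_distrib mult.commute)
  also have "\<dots> = ((z * a0 + b0) * r0) *s x0 + ((z * a1 + b1) * r1) *s x1 + ((z * a2 + b2) * r2) *s x2
      + ((z * a3 + b3) * m33 + (z * a4 + b4) * m34) *s x3 + ((z * a3 + b3) * m43 + (z * a4 + b4) * m44) *s x4"
    unfolding A B by (simp add: mat_vec_simps R) (simp add: vec_eq_iff algebra_simps)
  also have "\<dots> = r *s (Z *s Au + z *s (Z *s Bu))"
    unfolding e A B by (simp add: vec_eq_iff algebra_simps)
  also have "\<dots> = Z *s (r *s (Au + z *s Bu))"
    by (simp add: vec_eq_iff algebra_simps)
  finally show ?thesis by (rule vec.scale_left_imp_eq [OF Z])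
qed

text \<open>
  The same comparison when \<open>R u = p u + p' u'\<close>. Here two pairs of vectors are transformed by the same
  matrix.
\<close>

lemma intertwine_pair:
  fixes R :: "complex^'m^'m"
  assumes A: "Z *s Au = a0 *s x0 + a1 *s x1 + a2 *s x2 + a3 *s x3 + a4 *s x4 + a5 *s x5 + a6 *s x6 + a7 *s x7"
    and B: "Z *s Bu = b0 *s x0 + b1 *s x1 + b2 *s x2 + b3 *s x3 + b4 *s x4 + b5 *s x5 + b6 *s x6 + b7 *s x7"
    and A': "Z *s Au' = a0' *s x0 + a1' *s x1 + a2' *s x2 + a3' *s x3 + a4' *s x4 + a5' *s x5 + a6' *s x6 + a7' *s x7"
    and B': "Z *s Bu' = b0' *s x0 + b1' *s x1 + b2' *s x2 + b3' *s x3 + b4' *s x4 + b5' *s x5 + b6' *s x6 + b7' *s x7"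
    and R: "R *v x0 = r0 *s x0" "R *v x1 = r1 *s x1" "R *v x2 = r1 *s x2"
      "R *v x3 = m33 *s x3 + m43 *s x4" "R *v x4 = m34 *s x3 + m44 *s x4"
      "R *v x5 = m33 *s x5 + m43 *s x6" "R *v x6 = m34 *s x5 + m44 *s x6" "R *v x7 = r5 *s x7"
    and Z: "Z \<noteq> 0"
    and e: "(z * a0 + b0) * r0 = p * (a0 + z * b0) + p' * (a0' + z * b0')"
      "(z * a1 + b1) * r1 = p * (a1 + z * b1) + p' * (a1' + z * b1')"
      "(z * a2 + b2) * r1 = p * (a2 + z * b2) + p' * (a2' + z * b2')"
      "(z * a3 + b3) * m33 + (z * a4 + b4) * m34 = p * (a3 + z * b3) + p' * (a3' + z * b3')"
      "(z * a3 + b3) * m43 + (z * a4 + b4) * m44 = p * (a4 + z * b4) + p' * (a4' + z * b4')"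
      "(z * a5 + b5) * m33 + (z * a6 + b6) * m34 = p * (a5 + z * b5) + p' * (a5' + z * b5')"
      "(z * a5 + b5) * m43 + (z * a6 + b6) * m44 = p * (a6 + z * b6) + p' * (a6' + z * b6')"
      "(z * a7 + b7) * r5 = p * (a7 + z * b7) + p' * (a7' + z * b7')"
  shows "R *v (z *s Au + Bu) = p *s (Au + z *s Bu) + p' *s (Au' + z *s Bu')"
proof -
  have "Z *s (R *v (z *s Au + Bu)) = R *v (z *s (Z *s Au) + Z *s Bu)"
    by (simp add: mat_vec_simps vec.scale_right_distrib mult.commute)
  also have "\<dots> = ((z * a0 + b0) * r0) *s x0 + ((z * a1 + b1) * r1) *s x1 + ((z * a2 + b2) * r1) *s x2
      + ((z * a3 + b3) * m33 + (z * a4 + b4) * m34) *s x3 + ((z * a3 + b3) * m43 + (z * a4 + b4) * m44) *s x4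
      + ((z * a5 + b5) * m33 + (z * a6 + b6) * m34) *s x5 + ((z * a5 + b5) * m43 + (z * a6 + b6) * m44) *s x6
      + ((z * a7 + b7) * r5) *s x7"
    unfolding A B by (simp add: mat_vec_simps R) (simp add: vec_eq_iff algebra_simps)
  also have "\<dots> = p *s (Z *s Au + z *s (Z *s Bu)) + p' *s (Z *s Au' + z *s (Z *s Bu'))"
    unfolding e A B A' B' by (simp add: vec_eq_iff algebra_simps)
  also have "\<dots> = Z *s (p *s (Au + z *s Bu) + p' *s (Au' + z *s Bu'))"
    by (simp add: vec_eq_iff algebra_simps)
  finally show ?thesis by (rule vec.scale_left_imp_eq [OF Z])
qed

context adjoint_square
begin

abbreviation "Op \<equiv> split.Op"

text \<open>
  The coefficients of the intertwiner on singular vectors, multiplied by the common denominator \<open>r0\<close> to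
  make them polynomial: \<open>r0\<close>, \<open>r1\<close>, \<open>r5\<close> are the scalars on \<open>u\<^sub>0\<close>, on \<open>u\<^sub>1\<close> and \<open>u\<^sub>2\<close>, and on \<open>u\<^sub>5\<close>, while
  \<open>m33, m34, m43, m44\<close> form the matrix with respect to \<open>u\<^sub>3, u\<^sub>4\<close>.
\<close>

definition r0 :: "complex \<Rightarrow> complex" where
  "r0 z = q * (q ^ 2 - z) ^ 2 * (q ^ 6 - z)"
definition r1 :: "complex \<Rightarrow> complex" where
  "r1 z = - (q * (1 - q ^ 2 * z) * (q ^ 2 - z) * (q ^ 6 - z))"
definition r5 :: "complex \<Rightarrow> complex" where
  "r5 z = q * (1 - q ^ 2 * z) * (1 - q ^ 6 * z) * (q ^ 2 - z)"
definition m33 :: "complex \<Rightarrow> complex" where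
  "m33 z = - (q * P3 * (q ^ 2 - 1) ^ 2 * z * (z - q ^ 2))"
definition m34 :: "complex \<Rightarrow> complex" where
  "m34 z = - (q ^ 4 * (z - 1) * (q ^ 2 * z - 1) * (z - q ^ 2))"
definition m43 :: "complex \<Rightarrow> complex" where
  "m43 z = - ((z - 1) * (q ^ 6 * z ^ 2 - (q ^ 12 + 1 + q ^ 8 + q ^ 4 - 2 * q ^ 6) * z + q ^ 6))"
definition m44 :: "complex \<Rightarrow> complex" where
  "m44 z = q * P3 * (q ^ 2 - 1) ^ 2 * z * (q ^ 2 * z - 1)"

definition Rp :: "complex \<Rightarrow> complex^('n \<times> 'n)^('n \<times> 'n)" where
  "Rp z = r0 z *k Op 0 0 + r1 z *k (Op 1 1 + Op 2 2) +
    (m33 z *k Op 3 3 + m34 z *k Op 3 4 + m43 z *k Op 4 3 + m44 z *k Op 4 4) + r5 z *k Op 5 5"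

lemma weight_pairs:
  assumes "(m, k) \<in> {(0, 0), (1, 1), (2, 2), (3, 3), (3, 4), (4, 3), (4, 4), (5, 5)}"
  shows "m < 6" "k < 6" "L m = L k"
  using assms by (auto simp: L_def)

lemma Op_commutes6:
  assumes "(m, k) \<in> {(0, 0), (1, 1), (2, 2), (3, 3), (3, 4), (4, 3), (4, 4), (5, 5)}" "i \<in> {1, 2}"
  shows "Op m k *v (genF T0 i *v x) = genF T0 i *v (Op m k *v x)"
    "Op m k *v (genE T0 i *v x) = genE T0 i *v (Op m k *v x)"
    "Op m k *v (genK T0 i *v x) = genK T0 i *v (Op m k *v x)"
  using split.Op_commute [OF weight_pairs [OF assms(1)] assms(2)] by blast+

lemma Op_u6:
  assumes "(m, k) \<in> {(0, 0), (1, 1), (2, 2), (3, 3), (3, 4), (4, 3), (4, 4), (5, 5)}" "j < 6"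
  shows "Op m k *v u j = (if j = k then u m else 0)"
  using split.Op_u [OF weight_pairs [OF assms(1)] assms(2)] .

lemma Rp_commute:
  assumes "i \<in> {1, 2}"
  shows "Rp z *v (genF T0 i *v x) = genF T0 i *v (Rp z *v x)"
    "Rp z *v (genE T0 i *v x) = genE T0 i *v (Rp z *v x)"
    "Rp z *v (genK T0 i *v x) = genK T0 i *v (Rp z *v x)"
  unfolding Rp_def by (simp_all add: mat_vec_simps Op_commutes6 [OF _ assms])

lemma Rp_F: "Rp z *v (F1 x) = F1 (Rp z *v x)"
  "Rp z *v (F2 x) = F2 (Rp z *v x)"
  by (simp_all add: Rp_commute)

lemma Rp_u:
  "Rp z *v u 0 = r0 z *s u 0" "Rp z *v u 1 = r1 z *s u 1" "Rp z *v u 2 = r1 z *s u 2"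
  "Rp z *v u 3 = m33 z *s u 3 + m43 z *s u 4" "Rp z *v u 4 = m34 z *s u 3 + m44 z *s u 4"
  "Rp z *v u 5 = r5 z *s u 5"
  unfolding Rp_def by (simp_all add: mat_vec_simps Op_u6)

lemma Rp_atoms:
  "Rp z *v Y0 = r0 z *s Y0" "Rp z *v Y1 = r0 z *s Y1" "Rp z *v Y2 = r0 z *s Y2" "Rp z *v Y3 = r0 z *s Y3"
  "Rp z *v X01 = r1 z *s X01" "Rp z *v X02 = r1 z *s X02" "Rp z *v X11 = r1 z *s X11"
  "Rp z *v X22 = r1 z *s X22" "Rp z *v X31 = r1 z *s X31" "Rp z *v X32 = r1 z *s X32"
  unfolding atom_defs by (simp_all only: mat_vec_simps Rp_F Rp_u)
    (simp_all add: vec.scale_right_distrib mult.commute mult.left_commute)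

lemmas r_defs = r0_def r1_def r5_def m33_def m34_def m43_def m44_def

lemma scale_factors_nonzero:
  "q * P2 * P3 * P5 \<noteq> 0" "q * P2 ^ 2 * P5 \<noteq> 0" "P2 ^ 2 * P5 \<noteq> 0"
  "q ^ 3 * P2 ^ 3 * Q4 * P5 \<noteq> 0" "P2 \<noteq> 0"
  using q_nonzero two_sum_nonzero three_sum_nonzero four_sum_nonzero five_sum_nonzero by simp_all

lemma Rp_E0_u0: "Rp z *v (z *s (EA 0 *v u 0) + EB 0 *v u 0) = r0 z *s (EA 0 *v u 0 + z *s (EB 0 *v u 0))"
  by (rule intertwine_scalar [OF EA_u0 EB_u0 Rp_atoms(1,5,6) Rp_u(4,5) scale_factors_nonzero(1)];
      unfold r_defs; algebra)

lemma Rp_E0_u1: "Rp z *v (z *s (EA 0 *v u 1) + EB 0 *v u 1) = r1 z *s (EA 0 *v u 1 + z *s (EB 0 *v u 1))"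
proof (rule intertwine_scalar [where ?x2.0 = 0 and ?a2.0 = 0 and ?b2.0 = 0 and ?r2.0 = 0, OF _ _ Rp_atoms(2,7)])
  show "Rp z *v (F2 (u 3)) = m33 z *s (F2 (u 3)) + m43 z *s (F2 (u 4))"
    "Rp z *v (F2 (u 4)) = m34 z *s (F2 (u 3)) + m44 z *s (F2 (u 4))"
    by (simp_all add: Rp_F Rp_u mat_vec_simps)
  show "(q * P2 ^ 2 * P5) *s (EA 0 *v u 1) =
    (q ^ 2) *s Y1 + (1) *s X11 + 0 *s 0 + (P2 ^ 2 * q ^ 5) *s (F2 (u 3)) + (P2 ^ 2) *s (F2 (u 4))"
    using EA_u1 by simp
  show "(q * P2 ^ 2 * P5) *s (EB 0 *v u 1) =
    (- 1) *s Y1 + (1) *s X11 + 0 *s 0 + (- (P2 ^ 2 * q ^ 3)) *s (F2 (u 3)) + (- (P2 ^ 2 * q ^ 8)) *s (F2 (u 4))"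
    using EB_u1 by simp
qed (simp_all only: scale_factors_nonzero r_defs matrix_vector_mult_0_right, (algebra | simp)+)

lemma Rp_E0_u2: "Rp z *v (z *s (EA 0 *v u 2) + EB 0 *v u 2) = r1 z *s (EA 0 *v u 2 + z *s (EB 0 *v u 2))"
proof (rule intertwine_scalar [where ?x2.0 = 0 and ?a2.0 = 0 and ?b2.0 = 0 and ?r2.0 = 0, OF _ _ Rp_atoms(3,8)])
  show "Rp z *v (F1 (u 3)) = m33 z *s (F1 (u 3)) + m43 z *s (F1 (u 4))"
    "Rp z *v (F1 (u 4)) = m34 z *s (F1 (u 3)) + m44 z *s (F1 (u 4))"
    by (simp_all add: Rp_F Rp_u mat_vec_simps)
  show "(P2 ^ 2 * P5) *s (EA 0 *v u 2) =
    (- (q ^ 2)) *s Y2 + (1) *s X22 + 0 *s 0 + (- (P2 ^ 2 * q ^ 6)) *s (F1 (u 3)) + (- (P2 ^ 2 * q)) *s (F1 (u 4))"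
    using EA_u2 by simp
  show "(P2 ^ 2 * P5) *s (EB 0 *v u 2) =
    (1) *s Y2 + (1) *s X22 + 0 *s 0 + (P2 ^ 2 * q ^ 4) *s (F1 (u 3)) + (P2 ^ 2 * q ^ 9) *s (F1 (u 4))"
    using EB_u2 by simp
qed (simp_all only: scale_factors_nonzero r_defs matrix_vector_mult_0_right, (algebra | simp)+)

lemma Rp_F12:
  "Rp z *v (F1 (F2 (u 3))) = m33 z *s (F1 (F2 (u 3))) + m43 z *s (F1 (F2 (u 4)))"
  "Rp z *v (F1 (F2 (u 4))) = m34 z *s (F1 (F2 (u 3))) + m44 z *s (F1 (F2 (u 4)))"
  "Rp z *v (F2 (F1 (u 3))) = m33 z *s (F2 (F1 (u 3))) + m43 z *s (F2 (F1 (u 4)))"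
  "Rp z *v (F2 (F1 (u 4))) = m34 z *s (F2 (F1 (u 3))) + m44 z *s (F2 (F1 (u 4)))"
  by (simp_all add: Rp_F Rp_u mat_vec_simps)

lemma Rp_E0_u3: "Rp z *v (z *s (EA 0 *v u 3) + EB 0 *v u 3) =
    m33 z *s (EA 0 *v u 3 + z *s (EB 0 *v u 3)) + m43 z *s (EA 0 *v u 4 + z *s (EB 0 *v u 4))"
  by (rule intertwine_pair [OF EA_u3 EB_u3 EA_u4 EB_u4 Rp_atoms(4,9,10) Rp_F12 Rp_u(6) scale_factors_nonzero(4)];
      unfold r_defs; algebra)

lemma Rp_E0_u4: "Rp z *v (z *s (EA 0 *v u 4) + EB 0 *v u 4) =
    m44 z *s (EA 0 *v u 4 + z *s (EB 0 *v u 4)) + m34 z *s (EA 0 *v u 3 + z *s (EB 0 *v u 3))"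
  by (rule intertwine_pair [OF EA_u4 EB_u4 EA_u3 EB_u3 Rp_atoms(4,9,10) Rp_F12 Rp_u(6) scale_factors_nonzero(4)];
      unfold r_defs; algebra)

lemma Rp_E0_u5: "Rp z *v (z *s (EA 0 *v u 5) + EB 0 *v u 5) = r5 z *s (EA 0 *v u 5 + z *s (EB 0 *v u 5))"
proof (rule intertwine_scalar [where ?x0.0 = 0 and ?a0.0 = 0 and ?b0.0 = 0 and ?r0.0 = 0 and ?x1.0 = 0 and ?a1.0 = 0
    and ?b1.0 = 0 and ?r1.0 = 0 and ?x2.0 = 0 and ?a2.0 = 0 and ?b2.0 = 0 and ?r2.0 = 0])
  let ?w = "\<lambda>k. F1 (F2 (F2 (F1 (u k))))"
  show "Rp z *v ?w 3 = m33 z *s ?w 3 + m43 z *s ?w 4"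
    "Rp z *v ?w 4 = m34 z *s ?w 3 + m44 z *s ?w 4"
    by (simp_all add: Rp_F Rp_u mat_vec_simps)
  show "P2 *s (EA 0 *v u 5) = 0 *s 0 + 0 *s 0 + 0 *s 0 + (q ^ 5 * P3) *s ?w 3 + (- (q ^ 6 * P3)) *s ?w 4"
    using EA_u5 by simp
  show "P2 *s (EB 0 *v u 5) = 0 *s 0 + 0 *s 0 + 0 *s 0 + (- (q ^ 3 * P3)) *s ?w 3 + (q ^ 2 * P3) *s ?w 4"
    using EB_u5 by simp
qed (simp_all only: scale_factors_nonzero r_defs matrix_vector_mult_0_right, (algebra | simp)+)

lemma EF_T: "z \<noteq> 0 \<Longrightarrow> i \<in> {1, 2} \<Longrightarrow> genE (TL z) 0 *v (genF T0 i *v x) = genF T0 i *v (genE (TL z) 0 *v x)"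
  "z \<noteq> 0 \<Longrightarrow> i \<in> {1, 2} \<Longrightarrow> genE (TR z) 0 *v (genF T0 i *v x) = genF T0 i *v (genE (TR z) 0 *v x)"
proof -
  have *: "genE W 0 *v (genF T0 i *v x) = genF T0 i *v (genE W 0 *v x)"
    if "weight_relations q W" "genF W i = genF T0 i" "i \<in> {1, 2}" for W :: "('n \<times> 'n) chevalley"
  proof -
    have "0 \<noteq> i" using that(3) by auto
    then have "genE W 0 ** genF W i - genF W i ** genE W 0 = 0"
      using that(1) unfolding weight_relations_def by simp
    then have "(genE W 0 ** genF T0 i - genF T0 i ** genE W 0) *v x = 0" using that(2) by simp
    then show ?thesis by (simp add: mat_vec_simps)
  qed
  have F: "genF (TL z) i = genF T0 i" "genF (TR z) i = genF T0 i" if "i \<in> {1, 2}"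
    using that by (auto simp: tensor_gens)
  show "z \<noteq> 0 \<Longrightarrow> i \<in> {1, 2} \<Longrightarrow> genE (TL z) 0 *v (genF T0 i *v x) = genF T0 i *v (genE (TL z) 0 *v x)"
    "z \<noteq> 0 \<Longrightarrow> i \<in> {1, 2} \<Longrightarrow> genE (TR z) 0 *v (genF T0 i *v x) = genF T0 i *v (genE (TR z) 0 *v x)"
    using * [OF tensor_relations(2)] * [OF tensor_relations(3)] F by blast+
qed

lemma Rp_intertwines_E0:
  assumes z: "z \<noteq> 0"
  shows "Rp z ** genE (TL z) 0 = genE (TR z) 0 ** Rp z"
proof (rule split.generated_eqI)
  show "(Rp z ** genE (TL z) 0) *v (genF T0 i *v x) = genF T0 i *v ((Rp z ** genE (TL z) 0) *v x)"
    "(genE (TR z) 0 ** Rp z) *v (genF T0 i *v x) = genF T0 i *v ((genE (TR z) 0 ** Rp z) *v x)"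
    if "i \<in> {1, 2}" for i x
    using that by (simp_all add: EF_T [OF z] Rp_commute flip: matrix_vector_mul_assoc)
next
  have L: "(Rp z ** genE (TL z) 0) *v x = Rp z *v (z *s (EA 0 *v x) + EB 0 *v x)" for x
    by (simp add: tensor_gens mat_vec_simps)
  have R: "genE (TR z) 0 *v x = EA 0 *v x + z *s (EB 0 *v x)" for x
    by (simp add: tensor_gens mat_vec_simps)
  fix k :: nat assume "k < 6"
  then have "k = 0 \<or> k = 1 \<or> k = 2 \<or> k = 3 \<or> k = 4 \<or> k = 5" by auto
  then show "(Rp z ** genE (TL z) 0) *v u k = (genE (TR z) 0 ** Rp z) *v u k"
    unfolding L
    by (elim disjE; simp only: Rp_E0_u0 Rp_E0_u1 Rp_E0_u2 Rp_E0_u3 Rp_E0_u4 Rp_E0_u5 Rp_u matrix_vector_mul_assoc [symmetric];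
        simp only: mult_vec_add mult_vec_scale R; simp add: add.commute)
qed

lemma Rp_K0: "Rp z ** genK T0 0 = genK T0 0 ** Rp z"
proof -
  let ?X = "genK T0 1 ** genK T0 2"
  have 0: "genK T0 0 ** genK T0 1 ** genK T0 2 = mat 1"
    using tensor_relations(1) unfolding weight_relations_def by blast
  then have 1: "genK T0 0 ** ?X = mat 1" by (simp add: matrix_mul_assoc)
  then have 2: "?X ** genK T0 0 = mat 1" using matrix_left_right_inverse by blast
  have X: "Rp z ** ?X = ?X ** Rp z" by (simp add: matrix_eq Rp_commute flip: matrix_vector_mul_assoc)
  have "Rp z ** genK T0 0 = genK T0 0 ** (?X ** Rp z) ** genK T0 0" by (simp add: matrix_mul_assoc 0)
  also have "\<dots> = genK T0 0 ** Rp z ** (?X ** genK T0 0)" unfolding X [symmetric] by (simp add: matrix_mul_assoc)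
  finally show ?thesis by (simp add: 2)
qed

text \<open>
  The difference of the two sides commutes with \<open>E\<^sub>0\<close>, by the relation for \<open>E\<^sub>0\<close> and the formula for
  \<open>[E\<^sub>0, F\<^sub>0]\<close>, and lowers \<open>K\<^sub>0\<close>-weights by \<open>2\<close>.
\<close>

lemma Rp_intertwines_F0:
  assumes z: "z \<noteq> 0"
  shows "Rp z ** genF (TL z) 0 = genF (TR z) 0 ** Rp z"
proof -
  let ?K = "genK T0 0" let ?E = "genE (TL z) 0" let ?F = "genF (TL z) 0"
  let ?E' = "genE (TR z) 0" let ?F' = "genF (TR z) 0"
  define D where "D = Rp z ** ?F - ?F' ** Rp z"
  have rel: "invertible ?K" "?K ** ?E = (q powi 2) *k (?E ** ?K)" "?K ** ?F = (q powi (- 2)) *k (?F ** ?K)"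
    "?E ** ?F - ?F ** ?E = inverse (q - inverse q) *k (?K - matrix_inv ?K)"
    using tensor_relations(2) [OF z] cartan_values(9) unfolding weight_relations_def tensor_gens(7) by metis+
  have rel': "?K ** ?E' = (q powi 2) *k (?E' ** ?K)" "?K ** ?F' = (q powi (- 2)) *k (?F' ** ?K)"
    "?E' ** ?F' - ?F' ** ?E' = inverse (q - inverse q) *k (?K - matrix_inv ?K)"
    using tensor_relations(3) [OF z] cartan_values(9) unfolding weight_relations_def tensor_gens(8) by metis+
  have KR: "matrix_inv ?K ** Rp z = Rp z ** matrix_inv ?K"
  proof -
    have "Rp z ** matrix_inv ?K = 1 *k (matrix_inv ?K ** Rp z)"
      by (rule inverse_commute [OF rel(1)]) (simp add: Rp_K0)
    then show ?thesis by simp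
  qed
  have ED: "?E' ** D = D ** ?E"
  proof -
    have "?E' ** D - D ** ?E = Rp z ** (?E ** ?F - ?F ** ?E) - (?E' ** ?F' - ?F' ** ?E') ** Rp z"
      using Rp_intertwines_E0 [OF z]
      by (simp add: D_def matrix_diff_distrib matrix_mul_assoc)
        (simp add: Rp_intertwines_E0 [OF z] flip: matrix_mul_assoc)
    also have "\<dots> = 0"
      unfolding rel rel' by (simp add: mat_scale_mult_left mat_scale_mult_right matrix_diff_distrib KR Rp_K0)
    finally show ?thesis by simp
  qed
  have KD: "?K ** D = (q powi (- 2)) *k (D ** ?K)"
  proof -
    have "?K ** D = Rp z ** (?K ** ?F) - (?K ** ?F') ** Rp z"
      by (simp add: D_def matrix_diff_distrib matrix_mul_assoc Rp_K0)
    also have "\<dots> = (q powi (- 2)) *k (D ** ?K)"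
      unfolding rel rel' by (simp add: D_def mat_scale_mult_left mat_scale_mult_right matrix_diff_distrib
          mat_scale_diff matrix_mul_assoc) (simp add: Rp_K0 flip: matrix_mul_assoc)
    finally show ?thesis .
  qed
  have crd_K: "crd m n (?K *v x) = q powi (wt 0 m + wt 0 n) * crd m n x" if "m < 8" "n < 8" for m n x
  proof -
    have "crd m n (?K *v x) = (\<Sum>m'<8. \<Sum>n'<8. crd m' n' x * (q powi (wt 0 m' + wt 0 n') * crd m n (t m' n')))"
      by (subst t_expand [of x]) (simp add: mult_vec_sum mult_vec_scale crd_sum crd_linear t_ops mult.assoc cong: sum.cong_simp)
    also have "\<dots> = (\<Sum>m'<8. \<Sum>n'<8. if n' = n then if m' = m then q powi (wt 0 m + wt 0 n) * crd m n x else 0 else 0)"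
      by (intro sum.cong refl) (use that in \<open>auto simp: crd_t\<close>)
    finally show ?thesis using that by simp
  qed
  have bound: "wt 0 k \<le> 2 \<and> wt 0 k \<ge> - 2" if "k < 8" for k
    using less8 [OF that] by (elim disjE) (simp_all add: wt_def)
  let ?I = "{..<8} \<times> {..<8::nat}"
  have expand: "x = (\<Sum>p\<in>?I. crd (fst p) (snd p) x *s t (fst p) (snd p))" for x
    using t_expand [of x] by (simp add: sum.cartesian_product split_def)
  have "D = 0"
  proof (rule commutes_E_lowers_weight_zero [OF q_nonzero q_generic rel(4) rel'(3) _ _ rel(2,3) rel'(1,2) ED KD
      expand _ expand, where w = "\<lambda>p. wt 0 (fst p) + wt 0 (snd p)" and w' = "\<lambda>p. wt 0 (fst p) + wt 0 (snd p)" and c = 4])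
    show "matrix_inv ?K ** ?K = mat 1" "matrix_inv ?K ** ?K = mat 1"
      using mult_matrix_inv [OF rel(1)] by simp_all
    show "?K *v t (fst p) (snd p) = q powi (wt 0 (fst p) + wt 0 (snd p)) *s t (fst p) (snd p)" if "p \<in> ?I" for p
      using that t_ops(5) by auto
    show "crd (fst p) (snd p) (?K *v x) = q powi (wt 0 (fst p) + wt 0 (snd p)) * crd (fst p) (snd p) x" if "p \<in> ?I" for p x
      using that crd_K by auto
    show "wt 0 (fst p) + wt 0 (snd p) \<le> int 4" "wt 0 (fst p) + wt 0 (snd p) \<ge> - int 4" if "p \<in> ?I" for p
      using that bound [of "fst p"] bound [of "snd p"] by auto
  qed (simp_all add: crd_linear)
  then show ?thesis by (simp add: D_def)
qed

lemma Rp_intertwines: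
  assumes z: "z \<noteq> 0"
  shows "intertwines (TL z) (TR z) (Rp z)"
proof -
  have "Rp z ** genE (TL z) i = genE (TR z) i ** Rp z \<and> Rp z ** genF (TL z) i = genF (TR z) i ** Rp z \<and>
      Rp z ** genK (TL z) i = genK (TR z) i ** Rp z" for i
  proof (cases "i = 0")
    case True
    then show ?thesis using Rp_intertwines_E0 [OF z] Rp_intertwines_F0 [OF z] Rp_K0 by (simp add: tensor_gens(7,8))
  next
    case False
    then have i: "i \<in> {1, 2}" using three_cases [of i] by auto
    have "genE (TL z) i = genE T0 i" "genE (TR z) i = genE T0 i" "genF (TL z) i = genF T0 i" "genF (TR z) i = genF T0 i"
      using False by (simp_all add: tensor_gens)
    then show ?thesis using Rp_commute [OF i]
      by (simp add: tensor_gens(7,8) matrix_eq flip: matrix_vector_mul_assoc)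
  qed
  then show ?thesis by (simp add: intertwines_def)
qed

end

section \<open>Rationality and uniqueness\<close>

lemma eventually_poly_nonzero:
  assumes "(r :: complex poly) \<noteq> 0" shows "\<forall>\<^sub>F z in cofinite. poly r z \<noteq> 0"
  using poly_roots_finite [OF assms] by (simp add: eventually_cofinite)

lemma rational_fun_const: "rational_fun (\<lambda>z. c)"
  unfolding rational_fun_def by (intro exI [of _ "[:c:]"] exI [of _ 1]) simp

lemma rational_fun_id: "rational_fun (\<lambda>z. z)"
  unfolding rational_fun_def by (intro exI [of _ "[:0, 1:]"] exI [of _ 1]) simp

lemma rational_fun_add:
  assumes "rational_fun f" "rational_fun g" shows "rational_fun (\<lambda>z. f z + g z)"
proof -
  from assms obtain p r p' r' where *: "r \<noteq> 0" "\<forall>\<^sub>F z in cofinite. f z = poly p z / poly r z"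
      "r' \<noteq> 0" "\<forall>\<^sub>F z in cofinite. g z = poly p' z / poly r' z"
    unfolding rational_fun_def by blast
  have "\<forall>\<^sub>F z in cofinite. f z + g z = poly (p * r' + p' * r) z / poly (r * r') z"
    using *(2,4) eventually_poly_nonzero [OF *(1)] eventually_poly_nonzero [OF *(3)]
    by eventually_elim (simp add: field_simps)
  then show ?thesis unfolding rational_fun_def using * by (metis mult_eq_0_iff)
qed

lemma rational_fun_mult:
  assumes "rational_fun f" "rational_fun g" shows "rational_fun (\<lambda>z. f z * g z)"
proof -
  from assms obtain p r p' r' where *: "r \<noteq> 0" "\<forall>\<^sub>F z in cofinite. f z = poly p z / poly r z"
      "r' \<noteq> 0" "\<forall>\<^sub>F z in cofinite. g z = poly p' z / poly r' z"
    unfolding rational_fun_def by blast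
  have "\<forall>\<^sub>F z in cofinite. f z * g z = poly (p * p') z / poly (r * r') z"
    using *(2,4) by eventually_elim simp
  then show ?thesis unfolding rational_fun_def using * by (metis mult_eq_0_iff)
qed

lemma rational_fun_inverse:
  assumes "rational_fun f" shows "rational_fun (\<lambda>z. inverse (f z))"
proof -
  from assms obtain p r where *: "r \<noteq> 0" "\<forall>\<^sub>F z in cofinite. f z = poly p z / poly r z"
    unfolding rational_fun_def by blast
  show ?thesis
  proof (cases "p = 0")
    case True
    have "\<forall>\<^sub>F z in cofinite. inverse (f z) = poly 0 z / poly 1 z"
      using *(2) by eventually_elim (simp add: True)
    then show ?thesis unfolding rational_fun_def by (metis one_neq_zero)
  next
    case False
    have "\<forall>\<^sub>F z in cofinite. inverse (f z) = poly r z / poly p z"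
      using *(2) by eventually_elim simp
    then show ?thesis unfolding rational_fun_def using False by blast
  qed
qed

lemma rational_fun_minus: "rational_fun f \<Longrightarrow> rational_fun (\<lambda>z. - f z)"
  using rational_fun_mult [OF rational_fun_const [of "-1"]] by simp

lemma rational_fun_diff: "rational_fun f \<Longrightarrow> rational_fun g \<Longrightarrow> rational_fun (\<lambda>z. f z - g z)"
  using rational_fun_add [OF _ rational_fun_minus, of f g] by simp

lemma rational_fun_power: "rational_fun f \<Longrightarrow> rational_fun (\<lambda>z. f z ^ n)"
  by (induct n) (simp_all add: rational_fun_const rational_fun_mult)

lemmas rational_fun_intros = rational_fun_const rational_fun_id rational_fun_add rational_fun_mult
  rational_fun_inverse rational_fun_minus rational_fun_diff rational_fun_power

lemma rational_fun_cong:
  assumes "rational_fun f" "\<forall>\<^sub>F z in cofinite. g z = f z" shows "rational_fun g"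
proof -
  from assms(1) obtain p r where *: "r \<noteq> 0" "\<forall>\<^sub>F z in cofinite. f z = poly p z / poly r z"
    unfolding rational_fun_def by blast
  have "\<forall>\<^sub>F z in cofinite. g z = poly p z / poly r z"
    using *(2) assms(2) by eventually_elim simp
  with * show ?thesis unfolding rational_fun_def by blast
qed

lemma eventually_neq_cofinite: "\<forall>\<^sub>F z in cofinite. z \<noteq> (c :: complex)"
  by (simp add: eventually_cofinite)

context adjoint_square
begin

text \<open>
  The positions of the two singular vectors of weight \<open>\<omega>\<^sub>1 + \<omega>\<^sub>2\<close>, indexed as the rows of \<open>f\<close>.
\<close>

definition cidx :: "2 \<Rightarrow> nat" where
  "cidx j = (if j = 1 then 3 else 4)"

lemma two_cases: "j = (1::2) \<or> j = 2"
  by (rule exhaust_2)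

lemma weight_sets:
  "{k. k < 6 \<and> L k = (2, 2)} = {0}" "{k. k < 6 \<and> L k = (3, 0)} = {1}" "{k. k < 6 \<and> L k = (0, 3)} = {2}"
  "{k. k < 6 \<and> L k = (1, 1)} = {3, 4}" "{k. k < 6 \<and> L k = (0, 0)} = {5}"
  by (auto simp: L_def dest!: less6)

lemma cidx: "inj cidx" "range cidx = {k. k < 6 \<and> L k = (1, 1)}"
proof -
  show "inj cidx" using two_cases by (auto simp: inj_def cidx_def)
  have "3 \<in> range cidx" "4 \<in> range cidx"
    using rangeI [of cidx 1] rangeI [of cidx 2] by (simp_all add: cidx_def)
  then show "range cidx = {k. k < 6 \<and> L k = (1, 1)}" unfolding weight_sets by (auto simp: cidx_def)
qed

lemma qnum_values:
  "qnum q 1 3 = P3 / q ^ 2" "qnum q 6 2 = q ^ 6 + 1 / q ^ 6" "qnum q 2 2 = q ^ 2 + 1 / q ^ 2"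
proof -
  have nz: "q ^ k - inverse q ^ k \<noteq> 0" if "k > 0" for k
  proof
    assume "q ^ k - inverse q ^ k = 0"
    then have "q ^ k * q ^ k = 1" using q_nonzero by (simp add: power_inverse field_simps)
    then have "q ^ (k + k) = 1" by (simp add: power_add)
    then show False using q_generic [of "k + k"] that by simp
  qed
  have quot: "n / d = a" if "a * d = n" "d \<noteq> 0" for a d n :: complex
    using that by auto
  have "P3 / q ^ 2 * (q ^ 1 - inverse q ^ 1) = q ^ (1 * 3) - inverse q ^ (1 * 3)"
    using q_nonzero by (simp add: power_inverse divide_simps) algebra
  then show "qnum q 1 3 = P3 / q ^ 2" unfolding qnum_def by (rule quot) (rule nz, simp)
  have "(q ^ 6 + 1 / q ^ 6) * (q ^ 6 - inverse q ^ 6) = q ^ (6 * 2) - inverse q ^ (6 * 2)"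
    using q_nonzero by (simp add: power_inverse divide_simps) algebra
  then show "qnum q 6 2 = q ^ 6 + 1 / q ^ 6" unfolding qnum_def by (rule quot) (rule nz, simp)
  have "(q ^ 2 + 1 / q ^ 2) * (q ^ 2 - inverse q ^ 2) = q ^ (2 * 2) - inverse q ^ (2 * 2)"
    using q_nonzero by (simp add: power_inverse divide_simps) algebra
  then show "qnum q 2 2 = q ^ 2 + 1 / q ^ 2" unfolding qnum_def by (rule quot) (rule nz, simp)
qed

definition Rad :: "complex \<Rightarrow> complex^('n \<times> 'n)^('n \<times> 'n)" where
  "Rad z = isotypic_projector q T0 (2, 2)
      - (q powi (-2) * ((1 - q\<^sup>2 * z) / (1 - q powi (-2) * z))) *k
          (isotypic_projector q T0 (3, 0) + isotypic_projector q T0 (0, 3))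
      - tensor_projector q T0 (1, 1) (\<lambda>j. u (cidx j))
          ((q powi (-5) / ((1 - q powi (-2) * z)\<^sup>2 * (1 - q powi (-6) * z))) *k f_matrix q z)
      + (q powi (-8) * (((1 - q\<^sup>2 * z) * (1 - q ^ 6 * z)) /
          ((1 - q powi (-2) * z) * (1 - q powi (-6) * z)))) *k isotypic_projector q T0 (0, 0)"

lemma Rad_eq:
  assumes z: "z \<noteq> q ^ 2" "z \<noteq> q ^ 6"
  shows "Rad z = inverse (r0 z) *k Rp z"
proof -
  define A where "A = q ^ 2 - z"
  define B where "B = q ^ 6 - z"
  have nz: "A \<noteq> 0" "B \<noteq> 0" "q \<noteq> 0" using z q_nonzero by (auto simp: A_def B_def)
  have w: "1 - q powi (-2) * z = A / q ^ 2" "1 - q powi (-6) * z = B / q ^ 6"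
    using nz(3) by (simp_all add: power_int_minus field_simps A_def B_def)
  have r: "r0 z = q * A ^ 2 * B" "r1 z = - (q * (1 - q ^ 2 * z) * A * B)"
    "r5 z = q * (1 - q ^ 2 * z) * (1 - q ^ 6 * z) * A" "m33 z = q * P3 * (q ^ 2 - 1) ^ 2 * z * A"
    "m34 z = q ^ 4 * (z - 1) * (q ^ 2 * z - 1) * A"
    unfolding r_defs A_def B_def by (simp, simp, simp, algebra, algebra)
  have qp: "q powi (-2) = 1 / q ^ 2" "q powi (-5) = 1 / q ^ 5" "q powi (-8) = 1 / q ^ 8"
    by (simp_all add: power_int_minus inverse_eq_divide)
  define c where "c = q powi (-5) / ((1 - q powi (-2) * z)\<^sup>2 * (1 - q powi (-6) * z))"
  have c: "c = q ^ 5 / (A ^ 2 * B)"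
    unfolding c_def w unfolding qp using nz(3) by (simp add: power_divide power_numeral_reduce)
  have f: "f_matrix q z $ 1 $ 1 = - (P3 * (q ^ 2 - 1) ^ 2 * z * A / q ^ 5)"
    "f_matrix q z $ 1 $ 2 = - ((z - 1) * (q ^ 2 * z - 1) * A / q ^ 2)"
    "f_matrix q z $ 2 $ 1 = (z - 1) * (q ^ 6 * z ^ 2 - (q ^ 12 + 1 + q ^ 8 + q ^ 4 - 2 * q ^ 6) * z + q ^ 6) / q ^ 6"
    "f_matrix q z $ 2 $ 2 = - (P3 * (q ^ 2 - 1) ^ 2 * z * (q ^ 2 * z - 1) / q ^ 5)"
    unfolding A_def using q_nonzero
    by (simp add: f_matrix_def qnum_values divide_simps; algebra)+
  have e: "inverse (r0 z) * r0 z = 1"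
    "inverse (r0 z) * r1 z = - (q powi (-2) * ((1 - q\<^sup>2 * z) / (1 - q powi (-2) * z)))"
    "inverse (r0 z) * r5 z = q powi (-8) * (((1 - q\<^sup>2 * z) * (1 - q ^ 6 * z)) / ((1 - q powi (-2) * z) * (1 - q powi (-6) * z)))"
    "inverse (r0 z) * m33 z = - (c * f_matrix q z $ 1 $ 1)"
    "inverse (r0 z) * m34 z = - (c * f_matrix q z $ 1 $ 2)"
    "inverse (r0 z) * m43 z = - (c * f_matrix q z $ 2 $ 1)"
    "inverse (r0 z) * m44 z = - (c * f_matrix q z $ 2 $ 2)"
  proof -
    show "inverse (r0 z) * r0 z = 1" using nz by (intro left_inverse) (simp add: r)
    show "inverse (r0 z) * r1 z = - (q powi (-2) * ((1 - q\<^sup>2 * z) / (1 - q powi (-2) * z)))"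
      unfolding w r unfolding qp using nz by (simp add: divide_simps power2_eq_square)
    show "inverse (r0 z) * r5 z = q powi (-8) * (((1 - q\<^sup>2 * z) * (1 - q ^ 6 * z)) / ((1 - q powi (-2) * z) * (1 - q powi (-6) * z)))"
      unfolding w r unfolding qp using nz by (simp add: divide_simps) algebra
    show "inverse (r0 z) * m33 z = - (c * f_matrix q z $ 1 $ 1)"
      "inverse (r0 z) * m34 z = - (c * f_matrix q z $ 1 $ 2)"
      "inverse (r0 z) * m43 z = - (c * f_matrix q z $ 2 $ 1)"
      "inverse (r0 z) * m44 z = - (c * f_matrix q z $ 2 $ 2)"
      unfolding c f r m43_def m44_def using nz by (simp add: divide_simps; algebra)+
  qed
  have sum2: "(\<Sum>i\<in>(UNIV :: 2 set). g i) = g 1 + g 2" for g :: "2 \<Rightarrow> complex^('n \<times> 'n)^('n \<times> 'n)"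
    by (rule sum_2)
  have T: "tensor_projector q T0 (1, 1) (\<lambda>j. u (cidx j)) (c *k f_matrix q z) =
    (c * f_matrix q z $ 1 $ 1) *k Op 3 3 + (c * f_matrix q z $ 1 $ 2) *k Op 3 4 +
    ((c * f_matrix q z $ 2 $ 1) *k Op 4 3 + (c * f_matrix q z $ 2 $ 2) *k Op 4 4)"
    unfolding split.tensor_projector_eq [OF cidx] sum2 by (simp add: cidx_def)
  have P: "isotypic_projector q T0 (2, 2) = Op 0 0" "isotypic_projector q T0 (3, 0) = Op 1 1"
    "isotypic_projector q T0 (0, 3) = Op 2 2" "isotypic_projector q T0 (0, 0) = Op 5 5"
    unfolding split.isotypic_projector_eq split.proj_def weight_sets by simp_all
  have "inverse (r0 z) *k Rp z = (inverse (r0 z) * r0 z) *k Op 0 0 + (inverse (r0 z) * r1 z) *k (Op 1 1 + Op 2 2) +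
    ((inverse (r0 z) * m33 z) *k Op 3 3 + (inverse (r0 z) * m34 z) *k Op 3 4 + (inverse (r0 z) * m43 z) *k Op 4 3
     + (inverse (r0 z) * m44 z) *k Op 4 4) + (inverse (r0 z) * r5 z) *k Op 5 5"
    unfolding Rp_def by (simp only: mat_scale_add mat_scale_scale)
  also have "\<dots> = Rad z"
    unfolding e Rad_def P T [unfolded c_def] unfolding c_def
    by (simp add: vec_eq_iff algebra_simps)
  finally show ?thesis by simp
qed

lemma eventually_Rad_eq: "\<forall>\<^sub>F z in cofinite. Rad z = inverse (r0 z) *k Rp z"
  using eventually_neq_cofinite [of "q ^ 2"] eventually_neq_cofinite [of "q ^ 6"]
  by eventually_elim (rule Rad_eq)

lemma intertwines_scale: "intertwines M N R \<Longrightarrow> intertwines M N (c *k R)"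
  by (simp add: intertwines_def mat_scale_mult_left mat_scale_mult_right)

lemma tensor_vec_v: "tensor_vec v v = s powi 2 *s u 0"
  using s_powi_add [of 2 "- 2"]
  by (simp add: u_def U_def vl_simps t_def b_rec(1) root_pairing_def root_coord_def wt_def)

lemma Rad_normalized: "normalized_R s V v Rad"
  unfolding normalized_R_def
proof (intro conjI allI)
  fix a c
  have "rational_fun (\<lambda>z. inverse (r0 z) * (Rp z $ a $ c))"
    unfolding Rp_def r_defs by (simp add: rational_fun_intros)
  moreover have "\<forall>\<^sub>F z in cofinite. Rad z $ a $ c = inverse (r0 z) * (Rp z $ a $ c)"
    using eventually_Rad_eq by eventually_elim simp
  ultimately show "rational_fun (\<lambda>z. Rad z $ a $ c)" by (rule rational_fun_cong)
next
  show "\<forall>\<^sub>F z in cofinite. intertwines (TL z) (TR z) (Rad z) \<and> Rad z *v tensor_vec v v = tensor_vec v v"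
    using eventually_neq_cofinite [of 0] eventually_neq_cofinite [of "q ^ 2"] eventually_neq_cofinite [of "q ^ 6"]
  proof eventually_elim
    case (elim z)
    then have "r0 z \<noteq> 0" using q_nonzero by (simp add: r0_def)
    with elim show ?case
      by (simp add: Rad_eq intertwines_scale Rp_intertwines tensor_vec_v mat_vec_simps Rp_u)
  qed
qed

text \<open>
  The difference of two normalized intertwiners annihilates \<open>u 0\<close>. The singular vectors occurring in the
  images of \<open>u 0\<close>, \<open>u 1\<close> and \<open>u 4\<close> under \<open>E\<^sub>0\<close> are then annihilated in turn.
\<close>

lemma intertwiner_unique_0:
  assumes X: "intertwines (TL z) (TR z) X" "X *v u 0 = 0"
    and z: "z \<noteq> 0" "z \<noteq> q ^ 2" "z \<noteq> q ^ 6" "q ^ 2 * z \<noteq> 1"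
  shows "X = 0"
proof -
  have XF: "X *v (genF T0 i *v x) = genF T0 i *v (X *v x)" if "i \<in> {1, 2}" for i x
  proof -
    have "X ** genF (TL z) i = genF (TR z) i ** X" using X(1) by (simp add: intertwines_def)
    moreover have "genF (TL z) i = genF T0 i" "genF (TR z) i = genF T0 i" using that by (auto simp: tensor_gens)
    ultimately show ?thesis by (metis matrix_vector_mul_assoc)
  qed
  have XE: "X ** genE T0 i = genE T0 i ** X" if "i \<in> {1, 2}" for i
  proof -
    have "X ** genE (TL z) i = genE (TR z) i ** X" using X(1) by (simp add: intertwines_def)
    moreover have "genE (TL z) i = genE T0 i" "genE (TR z) i = genE T0 i" using that by (auto simp: tensor_gens)
    ultimately show ?thesis by simp
  qed
  have XK: "X ** genK T0 i = genK T0 i ** X" for i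
    using X(1) by (simp add: intertwines_def tensor_gens(7,8))
  have X0: "X *v (z *s (EA 0 *v x) + EB 0 *v x) = 0" if "X *v x = 0" for x
  proof -
    have "X ** genE (TL z) 0 = genE (TR z) 0 ** X" using X(1) by (simp add: intertwines_def)
    then have "(X ** genE (TL z) 0) *v x = (genE (TR z) 0 ** X) *v x" by simp
    then show ?thesis using that by (simp add: tensor_gens mat_vec_simps)
  qed
  note on_u = split.equivariant_on_u [of X, OF XE XK]
  define d where "d m k = \<phi> m (X *v u k)" for m k
  have X1: "X *v u 1 = d 1 1 *s u 1" using on_u [of 1] by (simp add: L_def weight_sets [unfolded L_def] d_def)
  have X2: "X *v u 2 = d 2 2 *s u 2" using on_u [of 2] by (simp add: L_def weight_sets [unfolded L_def] d_def)
  have X3: "X *v u 3 = d 3 3 *s u 3 + d 4 3 *s u 4" using on_u [of 3] by (simp add: L_def weight_sets [unfolded L_def] d_def)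
  have X4: "X *v u 4 = d 3 4 *s u 3 + d 4 4 *s u 4" using on_u [of 4] by (simp add: L_def weight_sets [unfolded L_def] d_def)
  have X5: "X *v u 5 = d 5 5 *s u 5" using on_u [of 5] by (simp add: L_def weight_sets [unfolded L_def] d_def)
  have F0: "X *v (F1 x) = F1 (X *v x)" "X *v (F2 x) = F2 (X *v x)" for x
    by (simp_all add: XF)
  have XY: "X *v Y0 = 0" "X *v Y1 = 0" "X *v Y3 = 0"
    unfolding atom_defs by (simp_all add: mat_vec_simps F0 X(2))
  note proj = split.proj_commute [of 1] split.proj_commute [of 2] split.proj_u
  have F_nonzero: "F1 (u 1) \<noteq> 0" "F2 (u 2) \<noteq> 0"
  proof -
    show "F1 (u 1) \<noteq> 0"
    proof
      assume "F1 (u 1) = 0"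
      then have "crd 4 0 (F1 (u 1)) = 0" by (simp add: crd_linear)
      then show False unfolding words_1_1 by (simp add: crd_vl)
    qed
    show "F2 (u 2) \<noteq> 0"
    proof
      assume "F2 (u 2) = 0"
      then have "crd 3 0 (F2 (u 2)) = 0" by (simp add: crd_linear)
      then show False unfolding words_2_1 by (simp add: crd_vl)
    qed
  qed
  have u_nonzero: "u 5 \<noteq> 0" using \<phi>_u [of 5 5] \<phi>_linear(2) [of 5 0 0] by auto
  have scaled: "X *v (z *s (Z *s (EA 0 *v x)) + Z *s (EB 0 *v x)) = 0" if "X *v x = 0" for x Z
  proof -
    have "X *v (z *s (Z *s (EA 0 *v x)) + Z *s (EB 0 *v x)) = Z *s (X *v (z *s (EA 0 *v x) + EB 0 *v x))"
      by (simp add: mat_vec_simps vec.scale_right_distrib mult.commute)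
    then show ?thesis using X0 [OF that] by simp
  qed
  \<comment> \<open>\<open>?x3\<close> and \<open>?x4\<close> are the coefficients of \<open>u 3\<close> and \<open>u 4\<close> in \<open>(z A + B) u\<^sub>0\<close>, up to a common factor.\<close>
  let ?x3 = "q ^ 5 * pe - z * q * ph" and ?x4 = "z * pe - q ^ 6 * ph"
  have E0: "(d 1 1 * (q ^ 2 - z)) *s X01 + (d 2 2 * (z - q ^ 2)) *s X02
      + (P2 * (d 3 3 * ?x3 + d 3 4 * ?x4)) *s u 3 + (P2 * (d 4 3 * ?x3 + d 4 4 * ?x4)) *s u 4 = 0"
    using scaled [OF X(2), of "q * P2 * P3 * P5"] unfolding EA_u0 EB_u0
    by (simp add: mat_vec_simps XY X3 X4 X01_def X02_def F0 X1 X2) (simp add: vec_eq_iff algebra_simps)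
  have "split.proj (3, 0) *v ((d 1 1 * (q ^ 2 - z)) *s X01 + (d 2 2 * (z - q ^ 2)) *s X02
      + (P2 * (d 3 3 * ?x3 + d 3 4 * ?x4)) *s u 3 + (P2 * (d 4 3 * ?x3 + d 4 4 * ?x4)) *s u 4) = 0"
    unfolding E0 by simp
  then have "(d 1 1 * (q ^ 2 - z) * (q ^ 5 * P5)) *s (F1 (u 1)) = 0"
    by (simp add: mat_vec_simps X01_def X02_def proj L_def mult.assoc)
  then have d1: "d 1 1 = 0" using F_nonzero z q_nonzero five_sum_nonzero by simp
  have "split.proj (0, 3) *v ((d 1 1 * (q ^ 2 - z)) *s X01 + (d 2 2 * (z - q ^ 2)) *s X02
      + (P2 * (d 3 3 * ?x3 + d 3 4 * ?x4)) *s u 3 + (P2 * (d 4 3 * ?x3 + d 4 4 * ?x4)) *s u 4) = 0"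
    unfolding E0 by simp
  then have "(d 2 2 * (z - q ^ 2) * (q ^ 2 * P5)) *s (F2 (u 2)) = 0"
    by (simp add: mat_vec_simps X01_def X02_def proj L_def mult.assoc)
  then have d2: "d 2 2 = 0" using F_nonzero z q_nonzero five_sum_nonzero by simp
  have "(P2 * (d 3 3 * ?x3 + d 3 4 * ?x4)) *s u 3 + (P2 * (d 4 3 * ?x3 + d 4 4 * ?x4)) *s u 4 = 0"
    using E0 d1 d2 by simp
  then have "\<phi> k ((P2 * (d 3 3 * ?x3 + d 3 4 * ?x4)) *s u 3 + (P2 * (d 4 3 * ?x3 + d 4 4 * ?x4)) *s u 4) = \<phi> k (0 *s 0)" for k
    by simp
  from this [of 3] this [of 4] have x: "d 3 3 * ?x3 + d 3 4 * ?x4 = 0" "d 4 3 * ?x3 + d 4 4 * ?x4 = 0"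
    using two_sum_nonzero by (simp_all only: \<phi>_linear \<phi>_u) simp_all
  have Xu1: "X *v u 1 = 0" using X1 d1 by simp
  \<comment> \<open>\<open>?y3\<close> and \<open>?y4\<close> are the coefficients of \<open>F\<^sub>2 u\<^sub>3\<close> and \<open>F\<^sub>2 u\<^sub>4\<close> in \<open>(z A + B) u\<^sub>1\<close>, up to a common factor.\<close>
  let ?y3 = "z * q ^ 5 - q ^ 3" and ?y4 = "z - q ^ 8"
  have "X *v X11 = 0" unfolding X11_def by (simp add: mat_vec_simps F0 Xu1)
  then have E1: "(P2 ^ 2 * (d 3 3 * ?y3 + d 3 4 * ?y4)) *s (F2 (u 3)) + (P2 ^ 2 * (d 4 3 * ?y3 + d 4 4 * ?y4)) *s (F2 (u 4)) = 0"
    using scaled [OF Xu1, of "q * P2 ^ 2 * P5"] unfolding EA_u1 EB_u1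
    by (simp add: mat_vec_simps XY X3 X4 F0) (simp add: vec_eq_iff algebra_simps)
  have "crd m 2 ((P2 ^ 2 * (d 3 3 * ?y3 + d 3 4 * ?y4)) *s (F2 (u 3)) + (P2 ^ 2 * (d 4 3 * ?y3 + d 4 4 * ?y4)) *s (F2 (u 4))) = 0" for m
    unfolding E1 by (rule crd_linear)
  \<comment> \<open>In the coordinates at \<open>t 4 2\<close> and \<open>t 3 2\<close> the vectors \<open>F\<^sub>2 u\<^sub>3\<close> and \<open>F\<^sub>2 u\<^sub>4\<close> form a triangular matrix.\<close>
  from this [of 4] this [of 3] have y: "d 3 3 * ?y3 + d 3 4 * ?y4 = 0" "d 4 3 * ?y3 + d 4 4 * ?y4 = 0"
    using two_sum_nonzero q_nonzero unfolding words_3_1 words_4_1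
    by (simp_all add: crd_linear crd_vl)
  have det: "?x3 * ?y4 - ?x4 * ?y3 = q * (z - q ^ 2) * (q ^ 6 - z) * (P2 * P5)" by algebra
  have det_nz: "?x3 * ?y4 - ?x4 * ?y3 \<noteq> 0"
    unfolding det using z q_nonzero two_sum_nonzero five_sum_nonzero by simp
  have kernel: "a * (x3 * y4 - x4 * y3) = 0" "c * (x3 * y4 - x4 * y3) = 0"
    if "a * x3 + c * x4 = 0" "a * y3 + c * y4 = 0" for a c x3 x4 y3 y4 :: complex
    using that by algebra+
  have "d 3 3 * (?x3 * ?y4 - ?x4 * ?y3) = 0" "d 3 4 * (?x3 * ?y4 - ?x4 * ?y3) = 0"
    "d 4 3 * (?x3 * ?y4 - ?x4 * ?y3) = 0" "d 4 4 * (?x3 * ?y4 - ?x4 * ?y3) = 0"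
    by (rule kernel [OF x(1) y(1)] kernel [OF x(2) y(2)])+
  then have d34: "d 3 3 = 0" "d 3 4 = 0" "d 4 3 = 0" "d 4 4 = 0" using det_nz by simp_all
  have Xu3: "X *v u 3 = 0" and Xu4: "X *v u 4 = 0" and Xu2: "X *v u 2 = 0" using X2 X3 X4 d34 d2 by simp_all
  have "X *v X31 = 0" "X *v X32 = 0" unfolding atom_defs by (simp_all add: mat_vec_simps F0 Xu1 Xu2)
  then have "(d 5 5 * (q ^ 4 * (1 - q ^ 2 * z) * (P2 * P5))) *s u 5 = 0"
    using scaled [OF Xu4, of "q ^ 3 * P2 ^ 3 * Q4 * P5"] unfolding EA_u4 EB_u4
    by (simp add: mat_vec_simps XY Xu3 Xu4 X5 F0) (auto simp: vec_eq_iff algebra_simps power_numeral_reduce)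
  then have "d 5 5 * (q ^ 4 * (1 - q ^ 2 * z) * (P2 * P5)) = 0" using u_nonzero by (simp only: vec.scale_eq_0_iff) simp
  then have d5: "d 5 5 = 0" using z(4) q_nonzero two_sum_nonzero five_sum_nonzero by auto
  show ?thesis
  proof (rule split.generated_eqI)
    fix k :: nat assume "k < 6"
    then show "X *v u k = 0 *v u k"
      using less6 [of k] X(2) Xu1 Xu2 Xu3 Xu4 X5 d5 by auto
  qed (simp_all add: XF)
qed

lemma normalized_unique:
  assumes R: "normalized_R s V v R"
  shows "\<forall>\<^sub>F z in cofinite. R z = Rad z"
proof -
  have 1: "\<forall>\<^sub>F z in cofinite. intertwines (TL z) (TR z) (R z) \<and> R z *v tensor_vec v v = tensor_vec v v"
    and 2: "\<forall>\<^sub>F z in cofinite. intertwines (TL z) (TR z) (Rad z) \<and> Rad z *v tensor_vec v v = tensor_vec v v"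
    using R Rad_normalized unfolding normalized_R_def by blast+
  show ?thesis
    using 1 2 eventually_neq_cofinite [of 0] eventually_neq_cofinite [of "q ^ 2"]
      eventually_neq_cofinite [of "q ^ 6"] eventually_neq_cofinite [of "1 / q ^ 2"]
  proof eventually_elim
    case (elim z)
    have "R z - Rad z = 0"
    proof (rule intertwiner_unique_0)
      show "intertwines (TL z) (TR z) (R z - Rad z)"
        using elim(1,2) by (simp add: intertwines_def matrix_diff_distrib)
      show "(R z - Rad z) *v u 0 = 0"
        using elim(1,2) s_nonzero by (simp add: mat_vec_simps tensor_vec_v)
      show "q ^ 2 * z \<noteq> 1" using elim(6) q_nonzero by (auto simp: field_simps)
    qed (use elim in simp_all)
    then show ?case by simp
  qed
qed

end

theorem theorem6p4:
  fixes q s :: complex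
    and V :: "'n::finite affine_rep"
    and v :: "complex^'n"
  assumes q_nonzero: "q \<noteq> 0"
    and q_not_root_of_unity: "\<And>n::nat. n > 0 \<Longrightarrow> q ^ n \<noteq> 1"
    and s_sqrt: "s\<^sup>2 = q"
    and dim: "CARD('n) = 8"
    and V: "evaluation_adjoint q V v"
  shows
    "decomposes_as q (tensor_module s V V) [(2, 2), (3, 0), (0, 3), (1, 1), (1, 1), (0, 0)] \<and>
     (\<exists>u. singular_basis q (tensor_module s V V) (1, 1) u \<and>
       (let P = isotypic_projector q (tensor_module s V V);
            Rad = (\<lambda>z.
              P (2, 2)
              - (q powi (-2) * ((1 - q\<^sup>2 * z) / (1 - q powi (-2) * z))) *k (P (3, 0) + P (0, 3))
              - tensor_projector q (tensor_module s V V) (1, 1) u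
                  ((q powi (-5) / ((1 - q powi (-2) * z)\<^sup>2 * (1 - q powi (-6) * z))) *k f_matrix q z)
              + (q powi (-8) * (((1 - q\<^sup>2 * z) * (1 - q ^ 6 * z)) /
                  ((1 - q powi (-2) * z) * (1 - q powi (-6) * z)))) *k P (0, 0))
        in normalized_R s V v Rad \<and>
           (\<forall>R. normalized_R s V v R \<longrightarrow> (\<forall>\<^sub>F z in cofinite. R z = Rad z))))"
proof -
  interpret adjoint_square q V v s
    by unfold_locales (fact assms)+
  have "map L [0..<6] = [(2, 2), (3, 0), (0, 3), (1, 1), (1, 1), (0, 0)]"
    by (simp add: upt_rec L_def)
  then have dec: "decomposes_as q T0 [(2, 2), (3, 0), (0, 3), (1, 1), (1, 1), (0, 0)]"
    using split.decomposes by simp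
  show ?thesis
    unfolding Let_def
    using dec split.singular_basis_u [OF cidx] Rad_normalized normalized_unique
    unfolding Rad_def by blast
qed

end
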